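(* Let $\mathcal{P}$ be a balanced $3$-polytope, i.e. a simplicial convex $3$-polytope whose graph is $3$-colorable. Then there exists a proper cross-polytopal subdivision of $\mathcal{P}$. In particular, there is a proper cross-polytopal subdivision $\Delta$ of $\mathcal{P}$ with $f_3(\Delta)=23\,(f_0(\mathcal{P})-2)$.
   Context: A $d$-polytope is a $d$-dimensional convex polytope; it is simplicial if all its proper faces are simplices. The graph of a polytope consists of its vertices and edges; $k$-colorable is meant in the classical graph-theoretic sense. The regular $d$-dimensional cross-polytope is $\Diamond_d=\mathrm{conv}(\pm e_1,\dots,\pm e_d)\subseteq\mathbb{R}^d$. A $d$-dimensional cross-polytope is any convex polytope whose face lattice is isomorphic to that of $\Diamond_d$. A (geometric) polytopal complex $\Delta$ in $\mathbb{R}^d$ is a finite collection of polytopes in $\mathbb{R}^d$ (its cells), closed under taking faces, such that the intersection of any two cells is a (possibly empty) face of both. It is pure if all maximal cells have the same dimension. A (geometric) cross-polytopal complex in $\mathbb{R}^d$ is a pure polytopal complex all of whose maximal cells are $d$-dimensional cross-polytopes. The support is $|\Delta|=\bigcup_{\mathcal{C}\in\Delta}\mathcal{C}$, and $\Delta$ is called a cross-polytopal subdivision of $|\Delta|$. The boundary $\partial\Delta$ is the simplicial complex generated by (i.e. consisting of all faces of) the $(d-1)$-dimensional cells of $\Delta$ that belong to a unique maximal cell. For a polytope $\mathcal{P}$, $\partial\mathcal{P}$ is its boundary complex (the complex of its proper faces). The symbol $\simeq$ denotes combinatorial equivalence (isomorphism of face posets). A cross-polytopal subdivision $\Delta$ of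 a simplicial polytope $\mathcal{P}$ is proper if $\partial\Delta\simeq\partial\mathcal{P}$. $f_i$ denotes the number of $i$-dimensional cells (respectively faces). *)

theory Defs
  imports "HOL-Analysis.Analysis"
begin

definition faces :: "'a::euclidean_space set \<Rightarrow> 'a set set" where
  "faces P = {F. F face_of P}"

definition boundary_complex :: "'a::euclidean_space set \<Rightarrow> 'a set set" where
  "boundary_complex P = {F. F face_of P \<and> F \<noteq> P}"

text \<open>Combinatorial equivalence. The two families may live in different ambient spaces. The order
  is inclusion; on a polytopal complex it coincides with the relation of being a face.\<close>

definition face_poset_iso :: "'a set set \<Rightarrow> 'b set set \<Rightarrow> bool"  (infix "\<simeq>\<^sub>c" 50) where
  "X \<simeq>\<^sub>c Y \<longleftrightarrow>
     (\<exists>f. bij_betw f X Y \<and> (\<forall>F\<in>X. \<forall>G\<in>X. F \<subseteq> G \<longleftrightarrow> f F \<subseteq> f G))"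

definition f_number :: "nat \<Rightarrow> 'a::euclidean_space set set \<Rightarrow> nat" where
  "f_number i X = card {F \<in> X. aff_dim F = int i}"

definition simplicial_polytope :: "nat \<Rightarrow> 'a::euclidean_space set \<Rightarrow> bool" where
  "simplicial_polytope d P \<longleftrightarrow>
     polytope P \<and> aff_dim P = int d \<and> (\<forall>F \<in> boundary_complex P. \<exists>n. n simplex F)"

definition polytope_vertices :: "'a::euclidean_space set \<Rightarrow> 'a set" where
  "polytope_vertices P = {v. v extreme_point_of P}"

definition polytope_edges :: "'a::euclidean_space set \<Rightarrow> 'a set set" where
  "polytope_edges P = {{u, v} | u v. closed_segment u v edge_of P}"

definition graph_colorable :: "nat \<Rightarrow> 'v set \<Rightarrow> 'v set set \<Rightarrow> bool" where
  "graph_colorable k V E \<longleftrightarrow>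
     (\<exists>c :: 'v \<Rightarrow> nat. (\<forall>v\<in>V. c v < k) \<and> (\<forall>u v. {u, v} \<in> E \<longrightarrow> c u \<noteq> c v))"

definition balanced_polytope :: "nat \<Rightarrow> 'a::euclidean_space set \<Rightarrow> bool" where
  "balanced_polytope d P \<longleftrightarrow>
     simplicial_polytope d P \<and> graph_colorable d (polytope_vertices P) (polytope_edges P)"

text \<open>In the following, the dimension \<open>d\<close> is the dimension of the ambient Euclidean space.\<close>

definition regular_cross_polytope :: "'a::euclidean_space set" where
  "regular_cross_polytope = convex hull (Basis \<union> uminus ` Basis)"

definition cross_polytope :: "'a::euclidean_space set \<Rightarrow> bool" where
  "cross_polytope C \<longleftrightarrow> polytope C \<and> faces C \<simeq>\<^sub>c faces (regular_cross_polytope :: 'a set)"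

text \<open>Since the library relation \<open>face_of\<close> admits the empty face, the empty set is a
  cell of every nonempty complex.\<close>

definition polytopal_complex :: "'a::euclidean_space set set \<Rightarrow> bool" where
  "polytopal_complex \<Delta> \<longleftrightarrow>
     finite \<Delta> \<and>
     (\<forall>C\<in>\<Delta>. polytope C) \<and>
     (\<forall>C\<in>\<Delta>. \<forall>F. F face_of C \<longrightarrow> F \<in> \<Delta>) \<and>
     (\<forall>C\<in>\<Delta>. \<forall>D\<in>\<Delta>. (C \<inter> D) face_of C \<and> (C \<inter> D) face_of D)"

definition maximal_cells :: "'a set set \<Rightarrow> 'a set set" where
  "maximal_cells \<Delta> = {C \<in> \<Delta>. \<forall>D\<in>\<Delta>. C \<subseteq> D \<longrightarrow> D = C}"

definition pure_complex :: "'a::euclidean_space set set \<Rightarrow> bool" where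
  "pure_complex \<Delta> \<longleftrightarrow> (\<exists>k. \<forall>C \<in> maximal_cells \<Delta>. aff_dim C = k)"

definition cross_polytopal_complex :: "'a::euclidean_space set set \<Rightarrow> bool" where
  "cross_polytopal_complex \<Delta> \<longleftrightarrow>
     polytopal_complex \<Delta> \<and> pure_complex \<Delta> \<and> (\<forall>C \<in> maximal_cells \<Delta>. cross_polytope C)"

definition complex_boundary :: "'a::euclidean_space set set \<Rightarrow> 'a set set" where
  "complex_boundary \<Delta> =
     {F. \<exists>G\<in>\<Delta>. aff_dim G = int DIM('a) - 1 \<and>
           (\<exists>!C. C \<in> maximal_cells \<Delta> \<and> G face_of C) \<and> F face_of G}"

definition cross_polytopal_subdivision ::
    "'a::euclidean_space set set \<Rightarrow> 'a set \<Rightarrow> bool" where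
  "cross_polytopal_subdivision \<Delta> P \<longleftrightarrow> cross_polytopal_complex \<Delta> \<and> \<Union>\<Delta> = P"

definition proper_cross_polytopal_subdivision ::
    "'a::euclidean_space set set \<Rightarrow> 'a set \<Rightarrow> bool" where
  "proper_cross_polytopal_subdivision \<Delta> P \<longleftrightarrow>
     cross_polytopal_subdivision \<Delta> P \<and> complex_boundary \<Delta> \<simeq>\<^sub>c boundary_complex P"

end

theory Submission
  imports Defs
begin

text \<open>Cone the facets of \<open>P\<close> from an interior point \<open>p\<close>. A facet has vertices \<open>a, b, c\<close> of the three colours, and the
  facets are matched along their edges \<open>ab\<close>. Let \<open>q\<close> be the midpoint of \<open>pa\<close>. The union of the tetrahedra \<open>pabc\<close> and
  \<open>pabd\<close> over two matched facets is bounded by the triangles \<open>abc, abd, pbc, pbd, pqc, pqd, qac, qad\<close>, a degenerate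
  octahedron with antipodal pairs \<open>(a,p), (b,q), (c,d)\<close>. It is filled like a Schlegel diagram of the 24-cell, by 23
  octahedra, with the wall \<open>pab\<close> in the role of a mirror: each tetrahedron is cut into 9 octahedra and 5
  pyramids with square bases on the wall, and two pyramids with a common base form an octahedron, which is convex if the
  apexes are close enough to the wall. There are \<open>2 (f\<^sub>0 - 2)\<close> facets, hence \<open>f\<^sub>0 - 2\<close> matched pairs.\<close>

section \<open>Affine functionals and faces of convex hulls\<close>

text \<open>The colours make independent subdivisions fit. Off the wall, q is the only new node on
  the boundary of a tetrahedron, and it lies on the edge pa, which every tetrahedron containing that
  edge recognizes by the colour of a. The wall is shared only by the two matched tetrahedra, which
  give it the same subdivision. The counts 9 and 5 come from the 24-cell with vertices +-e_i +- e_j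
  (i < j): the mirror x_4 = 0 contains twelve vertices, forming a cuboctahedron, and leaves six on
  each side. Its six squares bisect six of the octahedra, namely the outer one of the diagram and
  the five that appear as double pyramids; the other 18 lie 9 on each side. The obstacle is that
  matched tetrahedra are not reflections of each other, so the segment between two apexes may miss
  the common base. Multiplying the homogeneous coordinate of c by a small number e, the same in all
  tetrahedra, is a projective map that fixes the wall pointwise and preserves the combinatorics; as
  e tends to 0, the apexes approach interior points of the bases.\<close>

definition affine_fun :: "('a::euclidean_space \<Rightarrow> real) \<Rightarrow> bool" where
  "affine_fun f \<longleftrightarrow> (\<exists>n k. \<forall>x. f x = n \<bullet> x + k)"

lemma affine_funI: "(\<And>x. f x = n \<bullet> x + k) \<Longrightarrow> affine_fun f"
  unfolding affine_fun_def by blast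

lemma affine_fun_const: "affine_fun (\<lambda>x. c)"
  by (rule affine_funI[where n = 0 and k = c]) simp

lemma affine_fun_add:
  assumes "affine_fun f" "affine_fun g" shows "affine_fun (\<lambda>x. f x + g x)"
proof -
  obtain n k m l where "\<And>x. f x = n \<bullet> x + k" "\<And>x. g x = m \<bullet> x + l"
    using assms unfolding affine_fun_def by metis
  then show ?thesis by (intro affine_funI[where n = "n + m" and k = "k + l"]) (simp add: inner_left_distrib)
qed

lemma affine_fun_scale:
  assumes "affine_fun f" shows "affine_fun (\<lambda>x. c * f x)"
proof -
  obtain n k where "\<And>x. f x = n \<bullet> x + k" using assms unfolding affine_fun_def by metis
  then show ?thesis by (intro affine_funI[where n = "c *\<^sub>R n" and k = "c * k"]) (simp add: algebra_simps)
qed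

lemma affine_fun_diff:
  assumes "affine_fun f" "affine_fun g" shows "affine_fun (\<lambda>x. f x - g x)"
  using affine_fun_add[OF assms(1) affine_fun_scale[OF assms(2), of "-1"]] by simp

lemma affine_fun_sum:
  "finite I \<Longrightarrow> (\<And>i. i \<in> I \<Longrightarrow> affine_fun (f i)) \<Longrightarrow> affine_fun (\<lambda>x. \<Sum>i\<in>I. f i x)"
  by (induction I rule: finite_induct) (auto intro: affine_fun_add affine_fun_const)

lemma affine_fun_comb:
  assumes "affine_fun f" "sum u I = 1"
  shows "f (\<Sum>i\<in>I. u i *\<^sub>R x i) = (\<Sum>i\<in>I. u i * f (x i))"
proof -
  obtain n k where f: "\<And>x. f x = n \<bullet> x + k" using assms unfolding affine_fun_def by metis
  have "(\<Sum>i\<in>I. u i * f (x i)) = (\<Sum>i\<in>I. u i * (n \<bullet> x i)) + sum u I * k"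
    by (simp add: f distrib_left sum.distrib sum_distrib_right)
  then show ?thesis by (simp add: f inner_sum_right assms(2))
qed

lemma affine_fun_comb2:
  assumes "affine_fun f" "a + b = 1"
  shows "f (a *\<^sub>R x + b *\<^sub>R y) = a * f x + b * f y"
proof -
  obtain n k where f: "\<And>x. f x = n \<bullet> x + k" using assms unfolding affine_fun_def by metis
  have "k = (a + b) * k" using assms(2) by simp
  then show ?thesis by (simp add: f algebra_simps)
qed

lemma affine_fun_hull_nonneg:
  assumes "affine_fun f" "\<And>v. v \<in> V \<Longrightarrow> 0 \<le> f v" "x \<in> convex hull V"
  shows "0 \<le> f x"
proof -
  obtain n k where f: "\<And>x. f x = n \<bullet> x + k" using assms unfolding affine_fun_def by metis
  have "convex hull V \<subseteq> {x. - k \<le> n \<bullet> x}"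
  proof (rule hull_minimal)
    show "V \<subseteq> {x. - k \<le> n \<bullet> x}"
    proof
      fix v assume "v \<in> V"
      then have "0 \<le> n \<bullet> v + k" using assms(2) f by metis
      then show "v \<in> {x. - k \<le> n \<bullet> x}" by simp
    qed
    show "convex {x. - k \<le> n \<bullet> x}" by (rule convex_halfspace_ge)
  qed
  then show ?thesis using assms(3) f by force
qed

lemma hull_face_vertices:
  fixes V :: "'a::euclidean_space set"
  assumes "finite V" "F face_of convex hull V"
  shows "F = convex hull (V \<inter> F)"
proof -
  obtain S where S: "S \<subseteq> V" "F = convex hull S"
    using face_of_convex_hull_subset[OF finite_imp_compact[OF assms(1)] assms(2)] by metis
  have "S \<subseteq> V \<inter> F" using S hull_subset by fastforce
  then have "F \<subseteq> convex hull (V \<inter> F)" using S(2) hull_mono by metis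
  moreover have "convex hull (V \<inter> F) \<subseteq> F"
    by (rule hull_minimal) (use assms(2) face_of_imp_convex in auto)
  ultimately show ?thesis by blast
qed

lemma exposed_hull_face:
  fixes V :: "'a::euclidean_space set"
  assumes "finite V" "affine_fun f" "\<And>v. v \<in> V \<Longrightarrow> 0 \<le> f v"
  shows "convex hull V \<inter> {x. f x = 0} = convex hull {v \<in> V. f v = 0}"
    and "convex hull {v \<in> V. f v = 0} face_of convex hull V"
proof -
  obtain n k where f: "\<And>x. f x = n \<bullet> x + k" using assms unfolding affine_fun_def by metis
  have e: "{x. f x = 0} = {x. n \<bullet> x = - k}" by (auto simp: f)
  have F: "(convex hull V \<inter> {x. n \<bullet> x = - k}) face_of convex hull V"
    using affine_fun_hull_nonneg[OF assms(2,3)] f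
    by (intro face_of_Int_supporting_hyperplane_ge convex_convex_hull) force
  show 1: "convex hull V \<inter> {x. f x = 0} = convex hull {v \<in> V. f v = 0}"
  proof -
    have "V \<inter> (convex hull V \<inter> {x. f x = 0}) = {v \<in> V. f v = 0}"
      using hull_subset[of V convex] by auto
    then show ?thesis using hull_face_vertices[OF assms(1) F] unfolding e by simp
  qed
  show "convex hull {v \<in> V. f v = 0} face_of convex hull V" using F 1 e by simp
qed

text \<open>The combination lies on the open segment between \<open>x b\<close> and the normalized
  combination \<open>y\<close> of the other points, and a face that meets an open segment in
  \<open>S\<close> contains its ends.\<close>

lemma face_absorb:
  fixes x :: "'b \<Rightarrow> 'a::euclidean_space"
  assumes "F face_of S" "convex S" "finite B" "\<And>b. b \<in> B \<Longrightarrow> 0 < \<beta> b" "sum \<beta> B = 1"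
    "\<And>b. b \<in> B \<Longrightarrow> x b \<in> S" "(\<Sum>b\<in>B. \<beta> b *\<^sub>R x b) \<in> F" "b \<in> B"
  shows "x b \<in> F"
proof (cases "B = {b}")
  case True then show ?thesis using assms by simp
next
  case False
  define B' where "B' = B - {b}"
  have B': "finite B'" "B' \<noteq> {}" "b \<notin> B'" "B = insert b B'" using False assms(3,8) B'_def by auto
  define s where "s = sum \<beta> B'"
  have s: "s > 0" unfolding s_def using B' assms(4) by (intro sum_pos) auto
  have bs: "\<beta> b + s = 1" using assms(5) B' s_def by simp
  define y where "y = (\<Sum>c\<in>B'. (\<beta> c / s) *\<^sub>R x c)"
  have yS: "y \<in> S" unfolding y_def
    using B' assms(4,6) s by (intro convex_sum assms(2)) (auto simp: sum_divide_distrib[symmetric] s_def less_imp_le)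
  have eq: "(\<Sum>b\<in>B. \<beta> b *\<^sub>R x b) = \<beta> b *\<^sub>R x b + s *\<^sub>R y"
    using B' s by (simp add: y_def scaleR_sum_right)
  show ?thesis
  proof (cases "x b = y")
    case True
    then have "(\<Sum>b\<in>B. \<beta> b *\<^sub>R x b) = x b" using eq bs by (metis scaleR_left_distrib scaleR_one)
    then show ?thesis using assms(7) by simp
  next
    case False
    have "\<beta> b *\<^sub>R x b + s *\<^sub>R y \<in> open_segment (x b) y"
      unfolding in_segment
    proof (intro conjI exI[of _ s])
      have "\<beta> b = 1 - s" using bs by simp
      then show "\<beta> b *\<^sub>R x b + s *\<^sub>R y = (1 - s) *\<^sub>R x b + s *\<^sub>R y" by simp
    qed (use False s bs assms(4)[OF assms(8)] in auto)
    then show ?thesis using face_ofD[OF assms(1)] assms(6)[OF assms(8)] yS assms(7) eq by metis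
  qed
qed

text \<open>Positive relations between vertices are the means of excluding faces: after division by
  the common total weight \<open>s\<close>, the left side is a point of \<open>F\<close> and the
  right side a convex combination in \<open>S\<close>, so that \<open>face_absorb\<close>
  applies.\<close>

lemma face_absorb_relation:
  fixes x :: "'b \<Rightarrow> 'a::euclidean_space"
  assumes F: "F face_of S" and S: "convex S" and fin: "finite A" "finite B" "A \<noteq> {}"
    and pos: "\<And>b. b \<in> A \<Longrightarrow> 0 < \<alpha> b" "\<And>b. b \<in> B \<Longrightarrow> 0 < \<beta> b" "sum \<alpha> A = sum \<beta> B"
    and eq: "(\<Sum>b\<in>A. \<alpha> b *\<^sub>R x b) = (\<Sum>b\<in>B. \<beta> b *\<^sub>R x b)"
    and mem: "\<And>b. b \<in> A \<Longrightarrow> x b \<in> F" "\<And>b. b \<in> B \<Longrightarrow> x b \<in> S" and b: "b \<in> B"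
  shows "x b \<in> F"
proof -
  define s where "s = sum \<alpha> A"
  have s: "s > 0" unfolding s_def using fin pos by (intro sum_pos) auto
  have "(\<Sum>b\<in>A. (\<alpha> b / s) *\<^sub>R x b) \<in> F"
    using fin pos mem s face_of_imp_convex[OF F]
    by (intro convex_sum) (auto simp: sum_divide_distrib[symmetric] s_def less_imp_le)
  moreover have "(\<Sum>b\<in>A. (\<alpha> b / s) *\<^sub>R x b) = (1/s) *\<^sub>R (\<Sum>b\<in>A. \<alpha> b *\<^sub>R x b)"
    by (simp add: scaleR_sum_right)
  moreover have "(\<Sum>b\<in>B. (\<beta> b / s) *\<^sub>R x b) = (1/s) *\<^sub>R (\<Sum>b\<in>B. \<beta> b *\<^sub>R x b)"
    by (simp add: scaleR_sum_right)
  ultimately have in_F: "(\<Sum>b\<in>B. (\<beta> b / s) *\<^sub>R x b) \<in> F" using eq by simp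
  show ?thesis
    by (rule face_absorb[OF F S fin(2) _ _ _ in_F b])
       (use s pos mem in \<open>auto simp: sum_divide_distrib[symmetric] s_def\<close>)
qed

text \<open>If \<open>x\<close> were outside, the segment from \<open>m\<close> to \<open>x\<close>
  would leave \<open>S\<close> at a point \<open>y\<close> of a proper face. Some functional
  vanishes there, although it is positive at \<open>m\<close> and nonnegative at \<open>x\<close>.
  Covering a tetrahedron by cells is thereby reduced to signs.\<close>

lemma polytope_eq_halfspaces:
  fixes S :: "'a::euclidean_space set"
  assumes S: "polytope S" and m: "m \<in> interior S"
    and aff: "\<And>f. f \<in> \<F> \<Longrightarrow> affine_fun f" "\<And>f. f \<in> \<F> \<Longrightarrow> 0 < f m"
    and faces: "\<And>F. F face_of S \<Longrightarrow> F \<noteq> S \<Longrightarrow> \<exists>f\<in>\<F>. \<forall>y\<in>F. f y = 0"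
    and x: "\<And>f. f \<in> \<F> \<Longrightarrow> 0 \<le> f x"
  shows "x \<in> S"
proof (rule ccontr)
  assume xS: "x \<notin> S"
  have mS: "m \<in> S" using m interior_subset by blast
  have "closed_segment m x \<inter> S \<noteq> {}" using mS by auto
  moreover have "closed_segment m x - S \<noteq> {}" using xS by auto
  ultimately have "closed_segment m x \<inter> frontier S \<noteq> {}"
    using connected_Int_frontier[OF connected_segment(1)] by metis
  then obtain y where y: "y \<in> closed_segment m x" "y \<in> frontier S" by blast
  have yS: "y \<in> S" using y(2) S polytope_imp_closed frontier_subset_closed by blast
  have "y \<in> rel_frontier S"
    using y(2) m by (metis empty_iff rel_frontier_nonempty_interior)
  then obtain F where F: "F face_of S" "F \<noteq> S" "y \<in> F"
    using rel_frontier_of_polyhedron_alt[OF polytope_imp_polyhedron[OF S]] by blast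
  obtain f where f: "f \<in> \<F>" "f y = 0" using faces[OF F(1,2)] F(3) by blast
  obtain u where u: "0 \<le> u" "u \<le> 1" "y = (1-u) *\<^sub>R m + u *\<^sub>R x" using y(1) unfolding in_segment(1) by blast
  have u1: "u \<noteq> 1" using u xS yS by auto
  have "f y = (1-u) * f m + u * f x" using affine_fun_comb2[OF aff(1)[OF f(1)]] u(3) by simp
  then have "f y > 0" using u u1 aff(2)[OF f(1)] x[OF f(1)] by (simp add: add_pos_nonneg)
  then show False using f by simp
qed

text \<open>If \<open>f\<close> vanished at \<open>m\<close>, it would be negative just beyond
  \<open>m\<close> on the line coming from \<open>y\<close>.\<close>

lemma affine_fun_pos_interior:
  fixes S :: "'a::euclidean_space set"
  assumes f: "affine_fun f" and nn: "\<And>x. x \<in> S \<Longrightarrow> 0 \<le> f x" and y: "y \<in> S" "f y \<noteq> 0" and m: "m \<in> interior S"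
  shows "0 < f m"
proof (rule ccontr)
  assume "\<not> 0 < f m"
  then have fm: "f m = 0" using nn m interior_subset by (metis subsetD order_less_le)
  obtain e where e: "e > 0" "ball m e \<subseteq> S" using m mem_interior by blast
  \<comment> \<open>Adding 1 to the norm keeps the denominator positive without a separate proof
    that \<open>y\<close> differs from \<open>m\<close>.\<close>
  define d where "d = (e/2) / (norm (y - m) + 1)"
  have d: "d > 0" unfolding d_def using e by (simp add: add_nonneg_pos)
  have "d * norm (y - m) \<le> d * (norm (y - m) + 1)" using d by (simp add: mult_left_mono)
  also have "\<dots> = e/2"
    unfolding d_def using norm_ge_zero[of "y - m"] by (simp add: field_simps del: norm_ge_zero)
  finally have "d * norm (y - m) < e" using e by simp
  then have "m + (-d) *\<^sub>R (y - m) \<in> ball m e" using d by (simp add: dist_norm)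
  then have "0 \<le> f ((1 + d) *\<^sub>R m + (-d) *\<^sub>R y)" using nn e by (force simp: algebra_simps)
  also have "\<dots> = (1 + d) * f m + (-d) * f y" by (rule affine_fun_comb2[OF f]) simp
  finally have "f y \<le> 0" using fm d by (simp add: mult_le_0_iff)
  then show False using nn[OF y(1)] y(2) by simp
qed

lemma affine_fun_relation:
  assumes f: "affine_fun f" and "sum \<alpha> A = sum \<beta> B"
    and eq: "(\<Sum>b\<in>A. \<alpha> b *\<^sub>R x b) = (\<Sum>b\<in>B. \<beta> b *\<^sub>R x b)"
  shows "(\<Sum>b\<in>A. \<alpha> b * f (x b)) = (\<Sum>b\<in>B. \<beta> b * f (x b))"
proof -
  obtain n k where f: "\<And>x. f x = n \<bullet> x + k" using f unfolding affine_fun_def by metis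
  have *: "(\<Sum>b\<in>S. \<gamma> b * f (x b)) = n \<bullet> (\<Sum>b\<in>S. \<gamma> b *\<^sub>R x b) + sum \<gamma> S * k" for \<gamma> S
    by (simp add: f inner_sum_right distrib_left sum.distrib sum_distrib_right)
  show ?thesis unfolding * using assms by simp
qed

lemma affine_fun_zero_hull:
  assumes "affine_fun f" "\<And>y. y \<in> V \<Longrightarrow> f y = 0" "x \<in> convex hull V"
  shows "f x = 0"
proof -
  have "0 \<le> f x" using assms(2) by (intro affine_fun_hull_nonneg[OF assms(1) _ assms(3)]) simp
  moreover have "0 \<le> -1 * f x"
    using assms(2) by (intro affine_fun_hull_nonneg[OF affine_fun_scale[OF assms(1)] _ assms(3)]) simp
  ultimately show ?thesis by simp
qed

section \<open>Exposed vertex sets\<close>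

text \<open>Faces are handled through index sets. Nothing prevents the points from coinciding a
  priori; the equivalence for all \<open>m < n\<close> is what recovers the index set from its
  hull.\<close>

definition exposed_set :: "(nat \<Rightarrow> 'a::euclidean_space) \<Rightarrow> nat \<Rightarrow> nat set \<Rightarrow> bool" where
  "exposed_set P n A \<longleftrightarrow> A \<subseteq> {..<n} \<and> (\<exists>f. affine_fun f \<and> (\<forall>m<n. 0 \<le> f (P m) \<and> (f (P m) = 0 \<longleftrightarrow> m \<in> A)))"

lemma exposed_setI:
  assumes "A \<subseteq> {..<n}" "affine_fun f" "\<And>m. m < n \<Longrightarrow> 0 \<le> f (P m)" "\<And>m. m < n \<Longrightarrow> f (P m) = 0 \<longleftrightarrow> m \<in> A"
  shows "exposed_set P n A"
  unfolding exposed_set_def using assms by (intro conjI exI[of _ f]) simp_all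

definition exposing :: "(nat \<Rightarrow> 'a::euclidean_space) \<Rightarrow> nat \<Rightarrow> nat set \<Rightarrow> 'a \<Rightarrow> real" where
  "exposing P n A = (SOME f. affine_fun f \<and> (\<forall>m<n. 0 \<le> f (P m) \<and> (f (P m) = 0 \<longleftrightarrow> m \<in> A)))"

lemma exposing:
  assumes "exposed_set P n A"
  shows "affine_fun (exposing P n A)" "m < n \<Longrightarrow> 0 \<le> exposing P n A (P m)"
    "m < n \<Longrightarrow> exposing P n A (P m) = 0 \<longleftrightarrow> m \<in> A"
proof -
  have "\<exists>f. affine_fun f \<and> (\<forall>m<n. 0 \<le> f (P m) \<and> (f (P m) = 0 \<longleftrightarrow> m \<in> A))"
    using assms unfolding exposed_set_def by (rule conjunct2)
  then have *: "affine_fun (exposing P n A) \<and> (\<forall>m<n. 0 \<le> exposing P n A (P m) \<and> (exposing P n A (P m) = 0 \<longleftrightarrow> m \<in> A))"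
    unfolding exposing_def by (rule someI_ex)
  show "affine_fun (exposing P n A)" by (rule conjunct1[OF *])
  show "m < n \<Longrightarrow> 0 \<le> exposing P n A (P m)" "m < n \<Longrightarrow> exposing P n A (P m) = 0 \<longleftrightarrow> m \<in> A"
    using conjunct2[OF *] by simp_all
qed

lemma exposed_set_subset: "exposed_set P n A \<Longrightarrow> A \<subseteq> {..<n}"
  unfolding exposed_set_def by simp

text \<open>The sum of two nonnegative functionals vanishes exactly where both do.\<close>

lemma exposed_set_Int:
  assumes "exposed_set P n A" "exposed_set P n B"
  shows "exposed_set P n (A \<inter> B)"
proof -
  define f g where "f = exposing P n A" and "g = exposing P n B"
  note f = exposing[OF assms(1), folded f_def] and g = exposing[OF assms(2), folded g_def]
  show ?thesis
  proof (rule exposed_setI)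
    show "A \<inter> B \<subseteq> {..<n}" using exposed_set_subset[OF assms(1)] by blast
    show "affine_fun (\<lambda>x. f x + g x)" by (rule affine_fun_add[OF f(1) g(1)])
    show "0 \<le> f (P m) + g (P m)" if "m < n" for m using f(2)[OF that] g(2)[OF that] by simp
    show "f (P m) + g (P m) = 0 \<longleftrightarrow> m \<in> A \<inter> B" if "m < n" for m
      using f(2,3)[OF that] g(2,3)[OF that] by (simp add: add_nonneg_eq_0_iff)
  qed
qed

lemma exposed_set_Inter:
  assumes "finite \<T>" "\<And>T. T \<in> \<T> \<Longrightarrow> exposed_set P n T"
  shows "exposed_set P n ({..<n} \<inter> \<Inter>\<T>)"
  using assms
proof (induction \<T> rule: finite_induct)
  case empty
  show ?case by (rule exposed_setI[OF _ affine_fun_const[of 0]]) auto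
next
  case (insert T \<T>)
  have "{..<n} \<inter> \<Inter>(insert T \<T>) = T \<inter> ({..<n} \<inter> \<Inter>\<T>)" by blast
  moreover have "exposed_set P n T" "exposed_set P n ({..<n} \<inter> \<Inter>\<T>)" using insert by simp_all
  ultimately show ?case using exposed_set_Int by metis
qed

lemma exposed_set_face:
  assumes "exposed_set P n A"
  shows "convex hull (P ` A) face_of convex hull (P ` {..<n})"
    and "m < n \<Longrightarrow> P m \<in> convex hull (P ` A) \<longleftrightarrow> m \<in> A"
proof -
  define f where "f = exposing P n A"
  note f = exposing[OF assms(1), folded f_def]
  have A: "{y \<in> P ` {..<n}. f y = 0} = P ` A"
    using f(3) exposed_set_subset[OF assms] by force
  have nn: "0 \<le> f y" if "y \<in> P ` {..<n}" for y using that f(2) by auto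
  have E: "convex hull (P ` {..<n}) \<inter> {x. f x = 0} = convex hull (P ` A)"
      "convex hull (P ` A) face_of convex hull (P ` {..<n})"
    using exposed_hull_face[of "P ` {..<n}" f] f(1) nn unfolding A by simp_all
  show "convex hull (P ` A) face_of convex hull (P ` {..<n})" by (rule E(2))
  show "P m \<in> convex hull (P ` A) \<longleftrightarrow> m \<in> A" if "m < n"
  proof -
    have "P m \<in> convex hull (P ` {..<n})" using that by (intro hull_inc) auto
    then show ?thesis using E(1) f(3)[OF that] by blast
  qed
qed

text \<open>Lower bounds on dimensions come from flags: the hull of the empty set has dimension -1,
  and each step of a chain of exposed sets gains at least 1.\<close>

lemma exposed_set_chain:
  assumes "exposed_set P n A" "exposed_set P n B" "A \<subset> B"
  shows "aff_dim (convex hull (P ` A)) < aff_dim (convex hull (P ` B))"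
proof (rule face_of_aff_dim_lt)
  have "convex hull (P ` A) \<subseteq> convex hull (P ` B)" using assms(3) by (intro hull_mono) auto
  then show "convex hull (P ` A) face_of convex hull (P ` B)"
    using face_of_face[OF exposed_set_face(1)[OF assms(2)]] exposed_set_face(1)[OF assms(1)] by blast
  obtain m where m: "m \<in> B" "m \<notin> A" using assms(3) by blast
  then have "m < n" using exposed_set_subset[OF assms(2)] by blast
  then show "convex hull (P ` A) \<noteq> convex hull (P ` B)"
    using exposed_set_face(2)[OF assms(1), of m] exposed_set_face(2)[OF assms(2), of m] m by blast
qed simp

lemma hull_eq_if_all_vertices:
  assumes "F face_of convex hull V" "V \<subseteq> F" shows "F = convex hull V"
proof
  show "F \<subseteq> convex hull V" by (rule face_of_imp_subset[OF assms(1)])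
  show "convex hull V \<subseteq> F" by (rule hull_minimal) (use assms face_of_imp_convex in auto)
qed

lemma exposed_set_cong:
  assumes "\<And>m. m < n \<Longrightarrow> P m = Q m" shows "exposed_set P n A = exposed_set Q n A"
proof -
  have *: "(\<forall>m<n. 0 \<le> f (P m) \<and> (f (P m) = 0 \<longleftrightarrow> m \<in> A)) = (\<forall>m<n. 0 \<le> f (Q m) \<and> (f (Q m) = 0 \<longleftrightarrow> m \<in> A))" for f
    using assms by simp
  show ?thesis unfolding exposed_set_def
    by (rule arg_cong[where f = "\<lambda>b. A \<subseteq> {..<n} \<and> b"], rule arg_cong[where f = Ex], rule ext) (simp only: *)
qed

section \<open>Octahedra\<close>

text \<open>The vertex sets of the faces of an octahedron whose antipodal pairs are 0,1 and 2,3 and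
  4,5.\<close>

definition octahedron_sets :: "nat set set" where
  "octahedron_sets = {A. A \<subseteq> {..<6} \<and>
     (A = {..<6} \<or> \<not> {0,1} \<subseteq> A \<and> \<not> {2,3} \<subseteq> A \<and> \<not> {4,5} \<subseteq> A)}"

text \<open>The two halves bound the face lattice from below and from above. The eight triangles
  yield the smaller faces as intersections; the closure condition, which follows from positive
  linear relations, rules out proper faces with an antipodal pair. No metric regularity is
  involved.\<close>

definition octahedral :: "(nat \<Rightarrow> 'a::euclidean_space) \<Rightarrow> bool" where
  "octahedral P \<longleftrightarrow> (\<forall>i\<in>{0,1}. \<forall>j\<in>{2,3}. \<forall>k\<in>{4,5}. exposed_set P 6 {i,j,k}) \<and>
     (\<forall>F. F face_of convex hull (P ` {..<6}) \<longrightarrow>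
        P ` {0,1} \<subseteq> F \<or> P ` {2,3} \<subseteq> F \<or> P ` {4,5} \<subseteq> F \<longrightarrow> P ` {..<6} \<subseteq> F)"

lemma octahedralI:
  assumes "\<And>i j k. i \<in> {0,1} \<Longrightarrow> j \<in> {2,3} \<Longrightarrow> k \<in> {4,5} \<Longrightarrow> exposed_set P 6 {i,j,k}"
    and "\<And>F. F face_of convex hull (P ` {..<6}) \<Longrightarrow> P ` {0,1} \<subseteq> F \<or> P ` {2,3} \<subseteq> F \<or> P ` {4,5} \<subseteq> F \<Longrightarrow> P ` {..<6} \<subseteq> F"
  shows "octahedral P"
  unfolding octahedral_def by (intro conjI ballI allI impI assms)

lemma octahedral_triangle:
  "octahedral P \<Longrightarrow> i \<in> {0,1} \<Longrightarrow> j \<in> {2,3} \<Longrightarrow> k \<in> {4,5} \<Longrightarrow> exposed_set P 6 {i,j,k}"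
  unfolding octahedral_def by (elim conjE) (drule (1) bspec, drule (1) bspec, drule (1) bspec)

lemma octahedral_closure:
  assumes "octahedral P" "F face_of convex hull (P ` {..<6})"
    and "P ` {0,1} \<subseteq> F \<or> P ` {2,3} \<subseteq> F \<or> P ` {4,5} \<subseteq> F"
  shows "F = convex hull (P ` {..<6})"
proof (rule hull_eq_if_all_vertices[OF assms(2)])
  show "P ` {..<6} \<subseteq> F"
    using assms unfolding octahedral_def by (elim conjE) (drule spec, drule (1) mp, drule (1) mp)
qed

text \<open>From each antipodal pair the label in \<open>A\<close> is forced, and if there is none,
  a label other than \<open>m\<close> is taken. Consequently a proper face is the intersection of
  the triangles containing it.\<close>

lemma octahedron_sets_avoid:
  assumes "A \<in> octahedron_sets" "m < 6" "m \<notin> A"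
  shows "\<exists>i\<in>{0,1}. \<exists>j\<in>{2,3}. \<exists>k\<in>{4,5}. A \<subseteq> {i,j,k} \<and> m \<notin> {i,j,k}"
proof -
  have A: "A \<subseteq> {..<6}" "\<not> {0,1} \<subseteq> A" "\<not> {2,3} \<subseteq> A" "\<not> {4,5} \<subseteq> A"
    using assms by (auto simp: octahedron_sets_def)
  have six: "{..<6::nat} = {0,1,2,3,4,5}" by auto
  show ?thesis
    by (rule bexI[of _ "if 1 \<in> A \<or> m = 0 then 1 else 0"], rule bexI[of _ "if 3 \<in> A \<or> m = 2 then 3 else 2"],
        rule bexI[of _ "if 5 \<in> A \<or> m = 4 then 5 else 4"])
       (use A assms(2,3) in \<open>auto simp: six split: if_splits\<close>)
qed

lemma octahedral_exposed:
  assumes P: "octahedral P" and A: "A \<in> octahedron_sets"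
  shows "exposed_set P 6 A"
proof -
  define \<T> where "\<T> = {T \<in> (\<lambda>(i,j,k). {i,j,k}) ` ({0,1::nat} \<times> {2,3::nat} \<times> {4,5::nat}). A \<subseteq> T}"
  have "exposed_set P 6 ({..<6} \<inter> \<Inter>\<T>)"
  proof (rule exposed_set_Inter)
    show "finite \<T>" unfolding \<T>_def by simp
    fix T assume "T \<in> \<T>"
    then obtain i j k where "T = {i,j,k}" "i \<in> {0,1}" "j \<in> {2,3}" "k \<in> {4,5}" unfolding \<T>_def by auto
    then show "exposed_set P 6 T" using octahedral_triangle[OF P] by simp
  qed
  moreover have "{..<6} \<inter> \<Inter>\<T> = A"
  proof
    show "A \<subseteq> {..<6} \<inter> \<Inter>\<T>" using A by (auto simp: octahedron_sets_def \<T>_def)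
    show "{..<6} \<inter> \<Inter>\<T> \<subseteq> A"
    proof (rule subsetI, rule ccontr)
      fix m assume m: "m \<in> {..<6} \<inter> \<Inter>\<T>" "m \<notin> A"
      then have "m < 6" by simp
      obtain i j k where t: "i \<in> {0,1}" "j \<in> {2,3}" "k \<in> {4,5}" "A \<subseteq> {i,j,k}" "m \<notin> {i,j,k}"
        using octahedron_sets_avoid[OF A \<open>m < 6\<close> m(2)] by (elim bexE conjE) (rule that)
      have "(i,j,k) \<in> {0,1} \<times> {2,3} \<times> {4,5}" by (intro SigmaI t)
      then have "{i,j,k} \<in> (\<lambda>(i,j,k). {i,j,k}) ` ({0,1} \<times> {2,3} \<times> {4,5})" by (rule image_eqI[rotated]) simp
      then have "{i,j,k} \<in> \<T>" unfolding \<T>_def by (intro CollectI conjI t(4))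
      then show False using m(1) t(5) by blast
    qed
  qed
  ultimately show ?thesis by simp
qed

lemma octahedral_faces:
  assumes P: "octahedral P"
  shows "faces (convex hull (P ` {..<6})) = (\<lambda>A. convex hull (P ` A)) ` octahedron_sets"
    and "\<And>A m. A \<in> octahedron_sets \<Longrightarrow> m < 6 \<Longrightarrow> P m \<in> convex hull (P ` A) \<longleftrightarrow> m \<in> A"
proof -
  let ?V = "P ` {..<6}"
  show "\<And>A m. A \<in> octahedron_sets \<Longrightarrow> m < 6 \<Longrightarrow> P m \<in> convex hull (P ` A) \<longleftrightarrow> m \<in> A"
    by (rule exposed_set_face(2)[OF octahedral_exposed[OF P]])
  show "faces (convex hull ?V) = (\<lambda>A. convex hull (P ` A)) ` octahedron_sets"
  proof (intro equalityI subsetI)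
    fix F assume "F \<in> faces (convex hull ?V)"
    then have F: "F face_of convex hull ?V" by (simp add: faces_def)
    let ?B = "{m \<in> {..<6}. P m \<in> F}"
    have "?V \<inter> F = P ` ?B" by auto
    then have "F = convex hull (P ` ?B)" using hull_face_vertices[OF _ F] by simp
    moreover have "?B \<in> octahedron_sets"
    proof (cases "F = convex hull ?V")
      case True
      then have "?B = {..<6}" using hull_subset[of ?V convex] by auto
      then show ?thesis by (auto simp: octahedron_sets_def)
    next
      case False
      then have "\<not> P ` {0,1} \<subseteq> F \<and> \<not> P ` {2,3} \<subseteq> F \<and> \<not> P ` {4,5} \<subseteq> F"
        using octahedral_closure[OF P F] by blast
      then show ?thesis unfolding octahedron_sets_def by auto
    qed
    ultimately show "F \<in> (\<lambda>A. convex hull (P ` A)) ` octahedron_sets" by (rule image_eqI)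
  qed (use exposed_set_face(1)[OF octahedral_exposed[OF P]] in \<open>auto simp: faces_def\<close>)
qed

lemma octahedral_hull_subset_iff:
  assumes P: "octahedral P" and A: "A \<in> octahedron_sets" "B \<in> octahedron_sets"
  shows "convex hull (P ` A) \<subseteq> convex hull (P ` B) \<longleftrightarrow> A \<subseteq> B"
proof
  assume H: "convex hull (P ` A) \<subseteq> convex hull (P ` B)"
  show "A \<subseteq> B"
  proof
    fix m assume m: "m \<in> A"
    then have "P m \<in> convex hull (P ` A)" by (simp add: hull_inc)
    moreover have "m < 6" using m A by (auto simp: octahedron_sets_def)
    ultimately show "m \<in> B" using H octahedral_faces(2)[OF P A(2)] by blast
  qed
qed (simp add: hull_mono image_mono)

text \<open>Both face posets are copies of \<open>octahedron_sets\<close> ordered by inclusion, and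
  the isomorphism goes through the label sets.\<close>

lemma octahedral_iso:
  assumes "octahedral P" "octahedral Q"
  shows "faces (convex hull (P ` {..<6})) \<simeq>\<^sub>c faces (convex hull (Q ` {..<6}))"
proof -
  let ?p = "\<lambda>A. convex hull (P ` A)" and ?q = "\<lambda>A. convex hull (Q ` A)"
  have ip: "inj_on ?p octahedron_sets" and iq: "inj_on ?q octahedron_sets"
    using octahedral_hull_subset_iff[OF assms(1)] octahedral_hull_subset_iff[OF assms(2)]
    by (metis (no_types, lifting) inj_onI order_refl subset_antisym)+
  have bp: "bij_betw ?p octahedron_sets (faces (convex hull (P ` {..<6})))"
    and bq: "bij_betw ?q octahedron_sets (faces (convex hull (Q ` {..<6})))"
    using ip iq octahedral_faces(1) assms unfolding bij_betw_def by auto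
  define f where "f = ?q \<circ> the_inv_into octahedron_sets ?p"
  have "bij_betw f (faces (convex hull (P ` {..<6}))) (faces (convex hull (Q ` {..<6})))"
    unfolding f_def by (rule bij_betw_trans[OF bij_betw_the_inv_into[OF bp] bq])
  moreover have "\<forall>F\<in>faces (convex hull (P ` {..<6})). \<forall>G\<in>faces (convex hull (P ` {..<6})). F \<subseteq> G \<longleftrightarrow> f F \<subseteq> f G"
  proof (intro ballI)
    fix F G assume "F \<in> faces (convex hull (P ` {..<6}))" "G \<in> faces (convex hull (P ` {..<6}))"
    then obtain A B where A: "A \<in> octahedron_sets" "F = ?p A" and B: "B \<in> octahedron_sets" "G = ?p B"
      using octahedral_faces(1)[OF assms(1)] by auto
    have "f F = ?q A" "f G = ?q B" using A B by (simp_all add: f_def the_inv_into_f_f[OF ip])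
    then show "F \<subseteq> G \<longleftrightarrow> f F \<subseteq> f G"
      using A B octahedral_hull_subset_iff assms by metis
  qed
  ultimately show ?thesis unfolding face_poset_iso_def by blast
qed

lemma octahedral_aff_dim_ge:
  assumes P: "octahedral P" shows "3 \<le> aff_dim (convex hull (P ` {..<6}))"
proof -
  have m: "{} \<in> octahedron_sets" "{0} \<in> octahedron_sets" "{0,2} \<in> octahedron_sets" "{0,2,4} \<in> octahedron_sets" "{..<6} \<in> octahedron_sets"
    by (auto simp: octahedron_sets_def)
  note lt = exposed_set_chain[OF octahedral_exposed[OF P] octahedral_exposed[OF P]]
  have "aff_dim (convex hull (P ` {})) < aff_dim (convex hull (P ` {0}))"
    "aff_dim (convex hull (P ` {0})) < aff_dim (convex hull (P ` {0,2}))"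
    "aff_dim (convex hull (P ` {0,2})) < aff_dim (convex hull (P ` {0,2,4}))"
    "aff_dim (convex hull (P ` {0,2,4})) < aff_dim (convex hull (P ` {..<6}))"
    by (rule lt[OF m(1,2)], force, rule lt[OF m(2,3)], force, rule lt[OF m(3,4)], force, rule lt[OF m(4,5)], force)
  then show ?thesis by simp
qed

section \<open>The regular octahedron as a model\<close>

definition axis_pair :: "nat \<Rightarrow> real^3" where
  "axis_pair m = (if even m then 1 else - 1) *\<^sub>R (if m < 2 then axis 1 1 else if m < 4 then axis 2 1 else axis 3 1)"

lemma inner_axis_pair: "i < 6 \<Longrightarrow> j < 6 \<Longrightarrow>
  axis_pair i \<bullet> axis_pair j = (if i div 2 = j div 2 then if i = j then 1 else - 1 else 0)"
proof -
  assume "i < 6" "j < 6"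
  then have "i \<in> {0,1,2,3,4,5}" "j \<in> {0,1,2,3,4,5}" by auto
  then show ?thesis by (elim insertE emptyE; simp add: axis_pair_def inner_axis_axis)
qed

lemma axis_pair_exposed: "m < 6 \<Longrightarrow> i \<in> {0,1} \<Longrightarrow> j \<in> {2,3} \<Longrightarrow> k \<in> {4,5} \<Longrightarrow>
   n =  - (axis_pair i + axis_pair j + axis_pair k)  \<Longrightarrow> 0 \<le> n \<bullet> axis_pair m + 1 \<and> (n \<bullet> axis_pair m + 1 = 0 \<longleftrightarrow> m \<in> {i,j,k})"
proof -
  assume a: "m < 6" "i \<in> {0,1}" "j \<in> {2,3}" "k \<in> {4,5}" "n =  - (axis_pair i + axis_pair j + axis_pair k)"
  have b: "i < 6" "j < 6" "k < 6" "i div 2 = 0" "j div 2 = 1" "k div 2 = 2" using a by auto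
  have n: "n \<bullet> axis_pair m = - (axis_pair i \<bullet> axis_pair m) - axis_pair j \<bullet> axis_pair m - axis_pair k \<bullet> axis_pair m"
    by (simp add: a(5) inner_add_left inner_diff_left inner_minus_left)
  consider "m div 2 = 0" | "m div 2 = 1" | "m div 2 = 2" using a(1) by linarith
  then show ?thesis
  proof cases
    case 1
    then have "m \<noteq> j" "m \<noteq> k" "j \<noteq> m" "k \<noteq> m" using b by auto
    then show ?thesis unfolding n using 1 a(1) b by (simp add: inner_axis_pair)
  next
    case 2
    then have "m \<noteq> i" "m \<noteq> k" "i \<noteq> m" "k \<noteq> m" using b by auto
    then show ?thesis unfolding n using 2 a(1) b by (simp add: inner_axis_pair)
  next
    case 3
    then have "m \<noteq> i" "m \<noteq> j" "i \<noteq> m" "j \<noteq> m" using b by auto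
    then show ?thesis unfolding n using 3 a(1) b by (simp add: inner_axis_pair)
  qed
qed

lemma axis_pair_octahedral: "octahedral axis_pair"
proof (rule octahedralI)
  fix i j k :: nat assume ijk: "i \<in> {0,1}" "j \<in> {2,3}" "k \<in> {4,5}"
  define n :: "real^3" where "n = - (axis_pair i + axis_pair j + axis_pair k)"
  show "exposed_set axis_pair 6 {i,j,k}"
  proof (rule exposed_setI)
    show "{i,j,k} \<subseteq> {..<6}" using ijk by auto
    show "affine_fun (\<lambda>x. n \<bullet> x + 1)" by (rule affine_funI) simp
    show "0 \<le> n \<bullet> axis_pair m + 1" "n \<bullet> axis_pair m + 1 = 0 \<longleftrightarrow> m \<in> {i,j,k}" if "m < 6" for m
      using axis_pair_exposed[OF that ijk n_def] by blast+
  qed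
next
  fix F assume F: "F face_of convex hull (axis_pair ` {..<6})"
    and "axis_pair ` {0,1} \<subseteq> F \<or> axis_pair ` {2,3} \<subseteq> F \<or> axis_pair ` {4,5} \<subseteq> F"
  then obtain i where i: "i \<in> {0,2,4}" "axis_pair i \<in> F" "axis_pair (i+1) \<in> F"
    by (auto simp: numeral_eq_Suc)
  have six: "{..<6::nat} = {0,1,2,3,4,5}" by auto
  \<comment> \<open>The centre 0 is the mean of an antipodal pair and also of all six vertices; this
    is the relation that spreads a pair to the whole vertex set.\<close>
  have z: "(\<Sum>b\<in>{i,i+1}. (1/2) *\<^sub>R axis_pair b) = 0" using i(1) by (auto simp: axis_pair_def)
  have z6: "(\<Sum>b\<in>{..<6}. (1/6) *\<^sub>R axis_pair b) = 0" by (simp add: six axis_pair_def)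
  have "axis_pair b \<in> F" if "b \<in> {..<6}" for b
    by (rule face_absorb_relation[where A = "{i,i+1}" and B = "{..<6}" and \<alpha> = "\<lambda>_. 1/2" and \<beta> = "\<lambda>_. 1/6", OF F convex_convex_hull])
       (use i z z6 that in \<open>auto simp: hull_inc\<close>)
  then show "axis_pair ` {..<6} \<subseteq> F" by blast
qed

lemma axis_pair_hull: "convex hull (axis_pair ` {..<6}) = (regular_cross_polytope :: (real^3) set)"
proof -
  have six: "{..<6::nat} = {0,1,2,3,4,5}" by auto
  have B: "(Basis :: (real^3) set) = {axis 1 1, axis 2 1, axis 3 1}"
    unfolding Basis_vec_def UNIV_3 by auto
  have "axis_pair ` {..<6} = (Basis :: (real^3) set) \<union> uminus ` Basis"
    unfolding six B by (auto simp add: axis_pair_def)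
  then show ?thesis unfolding regular_cross_polytope_def by simp
qed

lemma octahedral_cross_polytope:
  fixes P :: "nat \<Rightarrow> real^3"
  assumes "octahedral P" shows "cross_polytope (convex hull (P ` {..<6}))"
  unfolding cross_polytope_def
  using octahedral_iso[OF assms axis_pair_octahedral] polytope_convex_hull[of "P ` {..<6}"]
  by (simp add: axis_pair_hull)

lemma octahedral_aff_dim:
  fixes P :: "nat \<Rightarrow> real^3"
  assumes "octahedral P" shows "aff_dim (convex hull (P ` {..<6})) = 3"
  using octahedral_aff_dim_ge[OF assms] aff_dim_le_DIM[of "convex hull (P ` {..<6})"] by simp

section \<open>A combinatorial half of the 24-cell\<close>

text \<open>The labels \<open>0, \<dots>, 17\<close> stand for points given in homogeneous coordinates with respect to \<open>p, a, b, c\<close>: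
  \<open>0, 1, 2, 3\<close> are these points themselves, \<open>4\<close> is \<open>q\<close>, the labels \<open>5, \<dots>, 12\<close> lie on the wall \<open>pab\<close>,
  and \<open>13, \<dots>, 17\<close> are the apexes of the pyramids. The cell with number \<open>M\<close> is the set of labels at which the
  row \<open>M\<close> of \<open>lifts\<close> attains the minimum of all rows, that is, the subdivision is regular. The list of an octahedron
  (\<open>M < 9\<close>) consists of its three antipodal pairs, the list of a pyramid of the two diagonals of the base and the apex.\<close>

definition coords :: "int list list" where
  "coords =
    [[1, 0, 0, 0], [0, 1, 0, 0], [0, 0, 1, 0], [0, 0, 0, 1],
     [1, 1, 0, 0], [2, 5, 9, 0], [5, 2, 9, 0], [1, 2, 1, 0],
     [2, 1, 1, 0], [2, 3, 3, 0], [3, 2, 3, 0], [1, 1, 2, 0],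
     [1, 1, 1, 0], [5, 15, 12, 6], [15, 5, 12, 6], [2, 2, 8, 3],
     [5, 5, 4, 2], [5, 5, 7, 1]]"

definition lifts :: "int list list" where
  "lifts =
    [[28, 0, 0, 0], [4, 0, 10, 0], [0, 28, 0, 0], [0, 4, 10, 0],
     [7, 3, 3, 4], [4, 2, 6, 3], [3, 7, 3, 4], [2, 4, 6, 3],
     [4, 4, 5, 0], [10, 0, 4, 7], [0, 10, 4, 7], [8, 8, 0, 8],
     [2, 2, 8, 4], [4, 4, 4, 7]]"

definition cells :: "nat list list" where
  "cells =
    [[1, 15, 2, 13, 5, 3], [1, 16, 4, 13, 7, 3], [0, 15, 2, 14, 6, 3], [0, 16, 4, 14, 8, 3],
     [9, 15, 11, 13, 5, 17], [9, 16, 12, 13, 7, 17], [10, 15, 11, 14, 6, 17], [10, 16, 12, 14, 8, 17],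
     [3, 17, 13, 14, 15, 16], [1, 9, 5, 7, 13], [0, 10, 6, 8, 14], [2, 11, 5, 6, 15],
     [4, 12, 7, 8, 16], [9, 10, 11, 12, 17]]"

text \<open>Positive linear relations: an antipodal pair against the other four vertices (one row for each pair of an
  octahedron), or one diagonal of the base of a pyramid against the other.\<close>

definition relations :: "int list list list" where
  "relations =
    [[[23, 6, 15, 2, 1, 6], [14, 3, 18, 2, 2, 3], [1, 2, 23, 2, 7, 18]], [[14, 4, 11, 1, 4, 2], [2, 1, 8, 1, 8, 4], [6, 1, 6, 1, 16, 8]], [[23, 6, 15, 2, 1, 6], [14, 3, 18, 2, 2, 3], [1, 2, 23, 2, 7, 18]], [[14, 4, 11, 1, 4, 2], [2, 1, 8, 1, 8, 4], [6, 1, 6, 1, 16, 8]],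
     [[45, 10, 25, 3, 5, 12], [6, 2, 77, 3, 8, 12], [11, 2, 43, 1, 7, 12]], [[15, 4, 30, 1, 5, 2], [5, 2, 30, 1, 5, 2], [20, 3, 30, 1, 30, 12]], [[45, 10, 25, 3, 5, 12], [6, 2, 77, 3, 8, 12], [11, 2, 43, 1, 7, 12]], [[15, 4, 30, 1, 5, 2], [5, 2, 30, 1, 5, 2], [20, 3, 30, 1, 30, 12]],
     [[35, 16, 2, 2, 5, 6], [25, 8, 7, 7, 5, 18], [15, 8, 1, 1, 5, 10]], [[8, 7, 1, 12]], [[8, 7, 1, 12]], [[4, 7, 1, 1]],
     [[1, 2, 1, 1]], [[1, 1, 1, 4]]]"

text \<open>For each pyramid, the projection of the apex to the wall, and \<open>p, a, b\<close>, as combinations of the base corners.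
  The last entry of a row of \<open>apex_coeffs\<close> and \<open>corner_denom\<close> are the common denominators.\<close>

definition apex_coeffs :: "int list list" where
  "apex_coeffs =
    [[28, 7, 4, 3, 5], [28, 7, 4, 3, 5], [12, 1, 1, 1, 4], [1, 6, 1, 1, 2],
     [1, 1, 3, 2, 2]]"

definition corner_coeffs :: "int list list list" where
  "corner_coeffs =
    [[[-12, 9, -3, 0], [12, 0, 0, 0], [-4, -2, 2, 0]], [[12, 0, 0, 0], [-12, 9, -3, 0], [-4, -2, 2, 0]], [[-1, 5, -1, 0], [-5, -2, 1, 0], [3, 0, 0, 0]], [[1, 1, -1, 0], [0, -1, 1, 0], [-1, 1, 0, 0]],
     [[-1, 3, -3, 0], [3, -1, -3, 0], [-1, -1, 5, 0]]]"

definition corner_denom :: "int list" where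
  "corner_denom = [12, 12, 3, 1, 4]"

definition height :: "nat \<Rightarrow> nat \<Rightarrow> int" where
  "height M l = sum_list (map (\<lambda>i. lifts ! M ! i * coords ! l ! i) [0..<4])"

text \<open>Numbers \<open>q < 14\<close> refer to cells, \<open>14 \<le> q\<close> to the coordinate planes.\<close>

definition exposed_indices :: "nat \<Rightarrow> nat \<Rightarrow> nat list" where
  "exposed_indices M q = filter (\<lambda>m. if q < 14 then cells ! M ! m \<in> set (cells ! q) else coords ! (cells ! M ! m) ! (q - 14) = 0)
     [0..<length (cells ! M)]"

definition weighted_coord :: "nat \<Rightarrow> int list \<Rightarrow> nat list \<Rightarrow> nat \<Rightarrow> int" where
  "weighted_coord M r ms i = sum_list (map (\<lambda>m. r ! m * coords ! (cells ! M ! m) ! i) ms)"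

section \<open>Finite checks by evaluation\<close>

lemma coords_nonneg: "list_all (\<lambda>l. list_all (\<lambda>i. 0 \<le> coords ! l ! i) [0..<4] \<and> list_ex (\<lambda>i. 0 < coords ! l ! i) [0..<4]) [0..<18]"
  by code_simp

lemma coords_unit: "list_all (\<lambda>l. list_all (\<lambda>i. coords ! l ! i = (if i = l then 1 else 0)) [0..<4]) [0..<4]"
  by code_simp

lemma cells_labels: "list_all (\<lambda>M. length (cells ! M) = (if M < 9 then 6 else 5) \<and> list_all (\<lambda>l. l < 18) (cells ! M) \<and> distinct (cells ! M)) [0..<14]"
  by code_simp

lemma cells_cover: "list_all (\<lambda>l. list_ex (\<lambda>M. l \<in> set (cells ! M)) [0..<14]) [0..<18]"
  by code_simp

text \<open>All statements on how cells meet rest on this check: the difference of two rows is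
  nonnegative on one cell, nonpositive on the other, and vanishes exactly at the common
  labels.\<close>

lemma cells_argmin: "list_all (\<lambda>M. list_all (\<lambda>q. list_all (\<lambda>l.
    if l \<in> set (cells ! q) then height q l = height M l else height M l < height q l) (cells ! M)) [0..<14]) [0..<14]"
  by code_simp

text \<open>Every triangle of an octahedron is cut out by another cell or by a coordinate plane. The
  lists can be compared literally because filtering keeps the indices in increasing order.\<close>

lemma octahedron_exposed: "list_all (\<lambda>M. list_all (\<lambda>i. list_all (\<lambda>j. list_all (\<lambda>k.
     list_ex (\<lambda>q. exposed_indices M q = [i,j,k]) [0..<18]) [4,5]) [2,3]) [0,1]) [0..<9]"
  by code_simp

text \<open>Number 17 is the plane where the coordinate of \<open>c\<close> vanishes, that is, the
  wall carrying the base.\<close>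

lemma pyramid_exposed: "list_all (\<lambda>M. list_all (\<lambda>i. list_all (\<lambda>j.
     list_ex (\<lambda>q. exposed_indices M q = [i,j,4]) [0..<18]) [2,3]) [0,1] \<and> exposed_indices M 17 = [0,1,2,3]) [9..<14]"
  by code_simp

lemma relations_octahedron: "list_all (\<lambda>M. list_all (\<lambda>t. let r = relations ! M ! t in
     list_all (\<lambda>m. 0 < r ! m) [0..<6] \<and>
     list_all (\<lambda>i. weighted_coord M r [2*t, 2*t+1] i = weighted_coord M r (filter (\<lambda>m. m div 2 \<noteq> t) [0..<6]) i) [0..<4]) [0..<3]) [0..<9]"
  by code_simp

lemma relations_pyramid: "list_all (\<lambda>M. let r = relations ! M ! 0 in
     list_all (\<lambda>m. 0 < r ! m) [0..<4] \<and>
     list_all (\<lambda>i. weighted_coord M r [0,1] i = weighted_coord M r [2,3] i) [0..<4]) [9..<14]"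
  by code_simp

lemma apex_relation: "list_all (\<lambda>M. let r = apex_coeffs ! (M - 9) in
     list_all (\<lambda>m. 0 < r ! m) [0..<5] \<and> 0 < coords ! (cells ! M ! 4) ! 3 \<and>
     list_all (\<lambda>m. coords ! (cells ! M ! m) ! 3 = 0) [0..<4] \<and>
     list_all (\<lambda>i. r ! 4 * coords ! (cells ! M ! 4) ! i = weighted_coord M r [0..<4] i) [0..<3]) [9..<14]"
  by code_simp

lemma corner_relation: "list_all (\<lambda>M. 0 < corner_denom ! (M - 9) \<and> list_all (\<lambda>k.
     list_all (\<lambda>i. weighted_coord M (corner_coeffs ! (M - 9) ! k) [0..<4] i = (if i = k then corner_denom ! (M - 9) else 0)) [0..<3]) [0..<3]) [9..<14]"
  by code_simp

text \<open>No base lies in an edge of the wall triangle; hence a tetrahedron that contains a base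
  shares the whole wall.\<close>

lemma base_support: "list_all (\<lambda>M. list_all (\<lambda>i. list_ex (\<lambda>m. 0 < coords ! (cells ! M ! m) ! i) [0..<4]) [0..<3]) [9..<14]"
  by code_simp

lemma base_unique: "list_all (\<lambda>M. list_all (\<lambda>q. list_all (\<lambda>l. l \<in> set (cells ! q)) (take 4 (cells ! M)) \<longrightarrow> q = M) [0..<14]) [9..<14]"
  by code_simp

text \<open>The facet \<open>abc\<close> stays undivided and belongs to one cell; this keeps the
  boundary of the polytope unchanged.\<close>

lemma outer_unique: "list_all (\<lambda>q. list_all (\<lambda>l. l \<in> set (cells ! q)) [1,2,3] \<longleftrightarrow> q = 0) [0..<14]"
  by code_simp

lemma cells_antichain: "list_all (\<lambda>M. list_all (\<lambda>q. list_all (\<lambda>l. l \<in> set (cells ! q)) (cells ! M) \<longrightarrow> q = M) [0..<14]) [0..<14]"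
  by code_simp

section \<open>The subdivided tetrahedron\<close>

text \<open>Three of the points span a plane that misses the fourth; its equation, normalized to 1
  at the fourth point, is the barycentric coordinate.\<close>

lemma barycentric_functionals:
  fixes v :: "nat \<Rightarrow> real^3"
  assumes inj: "inj_on v {..<4}" and indep: "\<not> affine_dependent (v ` {..<4})"
  shows "\<exists>\<beta>. \<forall>i<4. affine_fun (\<beta> i) \<and> (\<forall>j<4. \<beta> i (v j) = (if i = j then 1 else 0))"
proof -
  have "\<exists>f. affine_fun f \<and> (\<forall>j<4. f (v j) = (if i = j then 1 else 0))" if i: "i < 4" for i
  proof -
    let ?S = "v ` ({..<4} - {i})"
    have S: "?S = v ` {..<4} - {v i}" using inj i by (auto dest: inj_onD)
    have "card ?S = card ({..<4::nat} - {i})" using inj by (intro card_image) (auto intro: inj_on_subset)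
    then have c: "card ?S = 3" using i by simp
    have "\<not> affine_dependent ?S" by (rule affine_independent_subset[OF indep]) auto
    then have "aff_dim ?S = 2" using aff_dim_affine_independent c by fastforce
    then obtain n k where nk: "affine hull ?S = {x. n \<bullet> x = k}"
      using aff_dim_eq_hyperplane[of ?S] by auto
    have "v i \<notin> affine hull ?S" using indep i unfolding S affine_dependent_def by blast
    then have ne: "n \<bullet> v i \<noteq> k" using nk by auto
    define f where "f x = (n \<bullet> x - k) / (n \<bullet> v i - k)" for x
    have "affine_fun f"
      by (rule affine_funI[where n = "(1 / (n \<bullet> v i - k)) *\<^sub>R n" and k = "- k / (n \<bullet> v i - k)"])
         (simp add: f_def diff_divide_distrib)
    moreover have "f (v j) = (if i = j then 1 else 0)" if "j < 4" for j
    proof (cases "i = j")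
      case False
      then have "v j \<in> affine hull ?S" using that by (intro hull_inc) auto
      then show ?thesis using nk False by (simp add: f_def)
    qed (use ne in \<open>simp add: f_def\<close>)
    ultimately show ?thesis by blast
  qed
  then show ?thesis by metis
qed

section \<open>Reading entries off the tables\<close>

lemma list_all_upt: "list_all P [0..<n] \<Longrightarrow> i < n \<Longrightarrow> P i"
  by (simp add: list_all_iff)

lemma list_all_mem: "list_all P xs \<Longrightarrow> x \<in> set xs \<Longrightarrow> P x"
  by (simp add: list_all_iff)

lemma list_ex_upt: "list_ex P [0..<n] \<Longrightarrow> \<exists>i<n. P i"
  by (auto simp: list_ex_iff)

lemma coord_nonneg: "l < 18 \<Longrightarrow> i < 4 \<Longrightarrow> 0 \<le> coords ! l ! i"
  by (rule list_all_upt[OF conjunct1[OF list_all_upt[OF coords_nonneg]]])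

lemma coord_pos: "l < 18 \<Longrightarrow> \<exists>i<4. 0 < coords ! l ! i"
  by (rule list_ex_upt[OF conjunct2[OF list_all_upt[OF coords_nonneg]]])

lemma coord_unit: "l < 4 \<Longrightarrow> i < 4 \<Longrightarrow> coords ! l ! i = (if i = l then 1 else 0)"
  by (rule list_all_upt[OF list_all_upt[OF coords_unit]])

lemma cell_label: "M < 14 \<Longrightarrow> l \<in> set (cells ! M) \<Longrightarrow> l < 18"
  by (rule list_all_mem[OF conjunct1[OF conjunct2[OF list_all_upt[OF cells_labels]]]])

lemma cell_length: "M < 14 \<Longrightarrow> length (cells ! M) = (if M < 9 then 6 else 5)"
  by (rule conjunct1[OF list_all_upt[OF cells_labels]])

lemma cell_nth: "M < 14 \<Longrightarrow> m < (if M < 9 then 6 else 5) \<Longrightarrow> cells ! M ! m \<in> set (cells ! M)"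
  using cell_length by (metis nth_mem)

lemma cell_cover: "l < 18 \<Longrightarrow> \<exists>M<14. l \<in> set (cells ! M)"
  by (rule list_ex_upt[OF list_all_upt[OF cells_cover]])

lemma cell_argmin:
  "M < 14 \<Longrightarrow> q < 14 \<Longrightarrow> l \<in> set (cells ! M) \<Longrightarrow>
   if l \<in> set (cells ! q) then height q l = height M l else height M l < height q l"
  by (rule list_all_mem[OF list_all_upt[OF list_all_upt[OF cells_argmin]]])

lemma height_sum: "height M l = (\<Sum>i<4. lifts ! M ! i * coords ! l ! i)"
  unfolding height_def by (subst sum_list_distinct_conv_sum_set) (auto intro!: sum.cong)

lemma weighted_coord_sum:
  "distinct ms \<Longrightarrow> weighted_coord M r ms i = (\<Sum>m\<in>set ms. r ! m * coords ! (cells ! M ! m) ! i)"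
  unfolding weighted_coord_def by (rule sum_list_distinct_conv_sum_set)

text \<open>The barycentric coordinate of \<open>v 3\<close> enters a node with the additional weight \<open>e\<close>; small values
  of \<open>e\<close> flatten the interior nodes towards the wall opposite to \<open>v 3\<close> without changing the combinatorics.\<close>

definition node_weight :: "real \<Rightarrow> nat \<Rightarrow> nat \<Rightarrow> real" where
  "node_weight e l i = (if i = 3 then e else 1) * of_int (coords ! l ! i)"

definition node_total :: "real \<Rightarrow> nat \<Rightarrow> real" where
  "node_total e l = (\<Sum>i<4. node_weight e l i)"

definition node :: "(nat \<Rightarrow> real^3) \<Rightarrow> real \<Rightarrow> nat \<Rightarrow> real^3" where
  "node v e l = (\<Sum>i<4. (node_weight e l i / node_total e l) *\<^sub>R v i)"

definition hull_cell :: "(nat \<Rightarrow> real^3) \<Rightarrow> real \<Rightarrow> nat \<Rightarrow> (real^3) set" where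
  "hull_cell v e M = convex hull (node v e ` set (cells ! M))"

text \<open>The nodes with these labels lie in the face with corners \<open>J\<close>, whatever the
  position of the corners and the value of \<open>e\<close>.\<close>

definition face_labels :: "nat set \<Rightarrow> nat set" where
  "face_labels J = {l. l < 18 \<and> (\<forall>i<4. i \<notin> J \<longrightarrow> coords ! l ! i = 0)}"

lemma node_weight_nonneg: "0 < e \<Longrightarrow> l < 18 \<Longrightarrow> i < 4 \<Longrightarrow> 0 \<le> node_weight e l i"
  unfolding node_weight_def using coord_nonneg by simp

lemma node_weight_0_iff: "0 < e \<Longrightarrow> node_weight e l i = 0 \<longleftrightarrow> coords ! l ! i = 0"
  unfolding node_weight_def by simp

lemma node_total_pos:
  assumes "0 < e" "l < 18" shows "0 < node_total e l"
proof -
  obtain i where i: "i < 4" "0 < coords ! l ! i" using coord_pos[OF assms(2)] by blast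
  have "0 < node_weight e l i" using i assms(1) by (simp add: node_weight_def)
  then show ?thesis unfolding node_total_def
    using i node_weight_nonneg[OF assms] by (intro sum_pos2[of _ i]) auto
qed

text \<open>The extra weight \<open>e\<close> cancels in the normalization, so the corners do not
  move when \<open>e\<close> changes.\<close>

lemma node_unit:
  assumes "0 < e" "i < 4" shows "node v e i = v i"
proof -
  have w: "node_weight e i j = (if j = i then (if i = 3 then e else 1) else 0)" if "j < 4" for j
    using coord_unit[OF assms(2) that] by (simp add: node_weight_def)
  have t: "node_total e i = (if i = 3 then e else 1)"
    unfolding node_total_def using assms by (simp add: w)
  have "node v e i = (\<Sum>j<4. if j = i then v i else 0)"
    unfolding node_def t using assms(1) by (intro sum.cong) (auto simp: w)
  then show ?thesis using assms(2) by simp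
qed

lemma node_in_face_hull:
  assumes e: "0 < e" and l: "l \<in> face_labels J" "J \<subseteq> {..<4}"
  shows "node v e l \<in> convex hull (v ` J)"
proof -
  have l18: "l < 18" using l by (simp add: face_labels_def)
  have z: "node_weight e l i = 0" if "i < 4" "i \<notin> J" for i
    using l that by (simp add: face_labels_def node_weight_def)
  have fJ: "finite J" using l(2) finite_subset by blast
  have n: "node v e l = (\<Sum>i\<in>J. (node_weight e l i / node_total e l) *\<^sub>R v i)"
    unfolding node_def using z l(2) by (intro sum.mono_neutral_right) auto
  have "node_total e l = (\<Sum>i\<in>J. node_weight e l i)"
    unfolding node_total_def using z l(2) by (intro sum.mono_neutral_right) auto
  then have "(\<Sum>i\<in>J. node_weight e l i / node_total e l) = 1"
    using node_total_pos[OF e l18] by (simp add: sum_divide_distrib[symmetric])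
  then show ?thesis unfolding n
    using node_weight_nonneg[OF e l18] node_total_pos[OF e l18] l(2)
    by (intro convex_sum fJ convex_convex_hull) (auto simp: hull_inc divide_nonneg_pos)
qed

text \<open>Multiplying by \<open>node_total\<close> clears the denominators, so that relations
  between nodes become relations between coordinate rows.\<close>

lemma node_sum:
  assumes "0 < e" "finite S" "\<And>m. m \<in> S \<Longrightarrow> l m < 18"
  shows "(\<Sum>m\<in>S. (c m * node_total e (l m)) *\<^sub>R node v e (l m)) = (\<Sum>i<4. (\<Sum>m\<in>S. c m * node_weight e (l m) i) *\<^sub>R v i)"
proof -
  have "(\<Sum>m\<in>S. (c m * node_total e (l m)) *\<^sub>R node v e (l m)) = (\<Sum>m\<in>S. \<Sum>i<4. (c m * node_weight e (l m) i) *\<^sub>R v i)"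
  proof (rule sum.cong[OF refl])
    fix m assume "m \<in> S"
    then have "node_total e (l m) > 0" using node_total_pos[OF assms(1)] assms(3) by blast
    then show "(c m * node_total e (l m)) *\<^sub>R node v e (l m) = (\<Sum>i<4. (c m * node_weight e (l m) i) *\<^sub>R v i)"
      unfolding node_def scaleR_sum_right by (intro sum.cong) auto
  qed
  then show ?thesis by (subst (asm) sum.swap) (simp add: scaleR_sum_left)
qed

lemma node_total_sum:
  "(\<Sum>m\<in>S. c m * node_total e (l m)) = (\<Sum>i<4. \<Sum>m\<in>S. c m * node_weight e (l m) i)"
  by (subst sum.swap) (simp add: node_total_def sum_distrib_left)

locale frame =
  fixes v :: "nat \<Rightarrow> real^3" and e :: real
  assumes e_pos: "0 < e" and inj_v: "inj_on v {..<4}" and indep_v: "\<not> affine_dependent (v ` {..<4})"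
begin

text \<open>These coordinates are determined by \<open>v\<close> alone. Their independence of
  \<open>e\<close> matters later, when \<open>e\<close> is chosen after their signs are
  known.\<close>

definition bary :: "nat \<Rightarrow> real^3 \<Rightarrow> real" where
  "bary = (SOME \<beta>. \<forall>i<4. affine_fun (\<beta> i) \<and> (\<forall>j<4. \<beta> i (v j) = (if i = j then 1 else 0)))"

lemma bary_all: "\<forall>i<4. affine_fun (bary i) \<and> (\<forall>j<4. bary i (v j) = (if i = j then 1 else 0))"
  unfolding bary_def by (rule someI_ex[OF barycentric_functionals[OF inj_v indep_v]])

lemma bary_affine: "i < 4 \<Longrightarrow> affine_fun (bary i)"
  using bary_all by simp

lemma bary_vertex: "i < 4 \<Longrightarrow> j < 4 \<Longrightarrow> bary i (v j) = (if i = j then 1 else 0)"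
  using bary_all[THEN spec, THEN mp, THEN conjunct2, THEN spec, THEN mp] .

lemma bary_comb:
  assumes "sum u {..<4} = 1" "i < 4"
  shows "bary i (\<Sum>j<4. u j *\<^sub>R v j) = u i"
proof -
  have "bary i (\<Sum>j<4. u j *\<^sub>R v j) = (\<Sum>j<4. u j * bary i (v j))"
    by (rule affine_fun_comb[OF bary_affine[OF assms(2)] assms(1)])
  also have "\<dots> = (\<Sum>j<4. if j = i then u i else 0)"
    using assms(2) by (intro sum.cong) (auto simp: bary_vertex)
  finally show ?thesis using assms(2) by simp
qed

lemma bary_expand: "(\<Sum>i<4. bary i x) = 1" "(\<Sum>i<4. bary i x *\<^sub>R v i) = x"
proof -
  have "card (v ` {..<4}) = 4" using card_image[OF inj_v] by simp
  then have "affine hull (v ` {..<4}) = UNIV"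
    using affine_independent_span_eq[OF indep_v] by simp
  then obtain u where u: "sum u (v ` {..<4}) = 1" "(\<Sum>w\<in>v ` {..<4}. u w *\<^sub>R w) = x"
    using affine_hull_finite[of "v ` {..<4}"] by auto
  have s: "(\<Sum>i<4. u (v i)) = 1" "(\<Sum>i<4. u (v i) *\<^sub>R v i) = x"
    using u by (simp_all add: sum.reindex[OF inj_v])
  have b: "bary i x = u (v i)" if "i < 4" for i
    using bary_comb[OF s(1) that] s(2) by simp
  show "(\<Sum>i<4. bary i x) = 1" "(\<Sum>i<4. bary i x *\<^sub>R v i) = x"
    using s b by simp_all
qed

lemma hull_iff_bary:
  assumes "J \<subseteq> {..<4}"
  shows "x \<in> convex hull (v ` J) \<longleftrightarrow> (\<forall>i<4. 0 \<le> bary i x) \<and> (\<forall>i<4. i \<notin> J \<longrightarrow> bary i x = 0)"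
proof
  assume x: "x \<in> convex hull (v ` J)"
  have nn: "0 \<le> bary i y" if "i < 4" "y \<in> convex hull (v ` J)" for i y
    using that assms by (intro affine_fun_hull_nonneg[OF bary_affine _ that(2)]) (auto simp: bary_vertex)
  have "bary i x = 0" if "i < 4" "i \<notin> J" for i
  proof -
    have "0 \<le> - 1 * bary i x"
      by (rule affine_fun_hull_nonneg[OF affine_fun_scale[OF bary_affine] _ x])
         (use that assms in \<open>auto simp: bary_vertex\<close>)
    then show ?thesis using nn[OF that(1) x] by simp
  qed
  then show "(\<forall>i<4. 0 \<le> bary i x) \<and> (\<forall>i<4. i \<notin> J \<longrightarrow> bary i x = 0)" using nn x by blast
next
  assume H: "(\<forall>i<4. 0 \<le> bary i x) \<and> (\<forall>i<4. i \<notin> J \<longrightarrow> bary i x = 0)"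
  have fJ: "finite J" using assms finite_subset by blast
  have "(\<Sum>i<4. bary i x *\<^sub>R v i) = (\<Sum>i\<in>J. bary i x *\<^sub>R v i)"
    using H assms by (intro sum.mono_neutral_right) auto
  moreover have "(\<Sum>i<4. bary i x) = (\<Sum>i\<in>J. bary i x)"
    using H assms by (intro sum.mono_neutral_right) auto
  moreover have "(\<Sum>i\<in>J. bary i x *\<^sub>R v i) \<in> convex hull (v ` J)" if "(\<Sum>i\<in>J. bary i x) = 1"
    by (rule convex_sum[OF fJ convex_convex_hull that]) (use H assms in \<open>auto simp: hull_inc\<close>)
  ultimately show "x \<in> convex hull (v ` J)" by (simp add: bary_expand)
qed

abbreviation "pt \<equiv> node v e"
abbreviation "K \<equiv> hull_cell v e"

lemma bary_pt:
  assumes "l < 18" "i < 4" shows "bary i (pt l) = node_weight e l i / node_total e l"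
  unfolding node_def
proof (rule bary_comb[OF _ assms(2)])
  show "(\<Sum>i<4. node_weight e l i / node_total e l) = 1"
    using node_total_pos[OF e_pos assms(1)] by (simp add: sum_divide_distrib[symmetric] node_total_def)
qed

text \<open>Coefficients are divided by the weight by which node coordinates are multiplied. The
  value at a node is therefore the integer \<open>height\<close> up to the positive factor
  \<open>1 / node_total e l\<close>, which is why the combinatorics does not depend on
  \<open>e\<close>.\<close>

definition lift :: "nat \<Rightarrow> real^3 \<Rightarrow> real" where
  "lift M x = (\<Sum>i<4. of_int (lifts ! M ! i) / (if i = 3 then e else 1) * bary i x)"

lemma lift_affine: "affine_fun (lift M)"
  unfolding lift_def[abs_def] by (intro affine_fun_sum affine_fun_scale bary_affine) auto

lemma lift_pt: assumes "l < 18" shows "lift M (pt l) = of_int (height M l) / node_total e l"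
proof -
  have "lift M (pt l) = (\<Sum>i<4. of_int (lifts ! M ! i * coords ! l ! i) / node_total e l)"
    unfolding lift_def using e_pos by (intro sum.cong) (auto simp: bary_pt[OF assms] node_weight_def)
  then show ?thesis by (simp add: height_sum sum_divide_distrib)
qed

definition sep :: "nat \<Rightarrow> nat \<Rightarrow> real^3 \<Rightarrow> real" where
  "sep M q x = (if q < 14 then lift q x - lift M x else bary (q - 14) x)"

lemma sep_affine: "q < 18 \<Longrightarrow> affine_fun (sep M q)"
  by (cases "q < 14") (simp_all add: sep_def[abs_def] affine_fun_diff lift_affine bary_affine)

lemma sep_pt:
  assumes "M < 14" "q < 18" "l \<in> set (cells ! M)"
  shows "0 \<le> sep M q (pt l)"
    "sep M q (pt l) = 0 \<longleftrightarrow> (if q < 14 then l \<in> set (cells ! q) else coords ! l ! (q - 14) = 0)"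
proof -
  have l: "l < 18" using cell_label assms by blast
  note N = node_total_pos[OF e_pos l]
  have "0 \<le> sep M q (pt l) \<and> (sep M q (pt l) = 0 \<longleftrightarrow> (if q < 14 then l \<in> set (cells ! q) else coords ! l ! (q - 14) = 0))"
  proof (cases "q < 14")
    case True
    have "sep M q (pt l) = of_int (height q l - height M l) / node_total e l"
      using True by (simp add: sep_def lift_pt[OF l] diff_divide_distrib)
    then show ?thesis using cell_argmin[OF assms(1) True assms(3)] True N
      by (auto simp: divide_nonneg_pos split: if_splits)
  next
    case False
    then have q: "q - 14 < 4" using assms(2) by simp
    then show ?thesis using False N node_weight_nonneg[OF e_pos l q] node_weight_0_iff[OF e_pos, of l "q - 14"]
      by (simp add: sep_def bary_pt[OF l q])
  qed
  then show "0 \<le> sep M q (pt l)"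
    "sep M q (pt l) = 0 \<longleftrightarrow> (if q < 14 then l \<in> set (cells ! q) else coords ! l ! (q - 14) = 0)" by blast+
qed

lemma K_polytope: "polytope (K M)"
  unfolding hull_cell_def by (rule polytope_convex_hull) simp

lemma K_subset: "M < 14 \<Longrightarrow> K M \<subseteq> convex hull (v ` {..<4})"
  unfolding hull_cell_def
  by (intro hull_minimal) (auto intro!: node_in_face_hull e_pos simp: face_labels_def cell_label)

text \<open>The sum of \<open>sep M M'\<close> and the coordinates outside \<open>J\<close> supports
  \<open>K M\<close> and vanishes at exactly the wanted nodes. Conversely, at a common point
  \<open>sep M M'\<close> and \<open>sep M' M\<close> are nonnegative and opposite to each other,
  hence zero. The face \<open>J\<close> is there for cells of different tetrahedra, which meet
  inside a shared face.\<close>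

lemma K_Int_face:
  assumes M: "M < 14" "M' < 14" and J: "J \<subseteq> {..<4}"
  shows "K M \<inter> K M' \<inter> convex hull (v ` J) = convex hull (pt ` (set (cells ! M) \<inter> set (cells ! M') \<inter> face_labels J))" (is "?L = ?R")
    and "convex hull (pt ` (set (cells ! M) \<inter> set (cells ! M') \<inter> face_labels J)) face_of K M"
proof -
  define f where "f x = sep M M' x + (\<Sum>i\<in>{..<4} - J. sep M (14 + i) x)" for x
  have aff: "affine_fun f" unfolding f_def[abs_def]
    using M by (intro affine_fun_add affine_fun_sum sep_affine) auto
  have f_pt: "0 \<le> f (pt l) \<and> (f (pt l) = 0 \<longleftrightarrow> l \<in> set (cells ! M') \<inter> face_labels J)" if l: "l \<in> set (cells ! M)" for l
  proof -
    have nn: "0 \<le> sep M (14 + i) (pt l)" "sep M (14 + i) (pt l) = 0 \<longleftrightarrow> coords ! l ! i = 0" if "i \<in> {..<4} - J" for i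
      using sep_pt[OF M(1) _ l, of "14 + i"] that by auto
    have s: "0 \<le> (\<Sum>i\<in>{..<4} - J. sep M (14 + i) (pt l))" using nn by (intro sum_nonneg) auto
    have "(\<Sum>i\<in>{..<4} - J. sep M (14 + i) (pt l)) = 0 \<longleftrightarrow> (\<forall>i\<in>{..<4} - J. sep M (14 + i) (pt l) = 0)"
      using nn by (intro sum_nonneg_eq_0_iff) auto
    also have "\<dots> \<longleftrightarrow> l \<in> face_labels J" using nn cell_label[OF M(1) l] by (auto simp: face_labels_def)
    finally have s0: "(\<Sum>i\<in>{..<4} - J. sep M (14 + i) (pt l)) = 0 \<longleftrightarrow> l \<in> face_labels J" .
    have "0 \<le> sep M M' (pt l)" "sep M M' (pt l) = 0 \<longleftrightarrow> l \<in> set (cells ! M')"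
      using sep_pt[OF M(1) _ l, of M'] M(2) by auto
    then show ?thesis using s s0 unfolding f_def by (auto simp: add_nonneg_eq_0_iff)
  qed
  have eq: "{y \<in> pt ` set (cells ! M). f y = 0} = pt ` (set (cells ! M) \<inter> set (cells ! M') \<inter> face_labels J)"
    using f_pt by blast
  have nn: "0 \<le> f y" if "y \<in> pt ` set (cells ! M)" for y using f_pt that by blast
  have E: "K M \<inter> {x. f x = 0} = ?R" "?R face_of K M"
    using exposed_hull_face[of "pt ` set (cells ! M)" f] aff nn unfolding eq hull_cell_def by simp_all
  show "?R face_of K M" using E(2) by simp
  have R: "K M \<inter> {x. f x = 0} = ?R" using E(1) by simp
  show "?L = ?R"
  proof
    show "?L \<subseteq> ?R"
    proof
      fix x assume x: "x \<in> ?L"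
      have "0 \<le> sep M M' x"
        by (rule affine_fun_hull_nonneg[where V = "pt ` set (cells ! M)", OF sep_affine])
           (use x M sep_pt in \<open>auto simp: hull_cell_def\<close>)
      moreover have "0 \<le> sep M' M x"
        by (rule affine_fun_hull_nonneg[where V = "pt ` set (cells ! M')", OF sep_affine])
           (use x M sep_pt in \<open>auto simp: hull_cell_def\<close>)
      ultimately have "sep M M' x = 0" using M by (simp add: sep_def)
      moreover have "sep M (14 + i) x = 0" if "i \<in> {..<4} - J" for i
        using x hull_iff_bary[OF J, of x] that by (auto simp: sep_def)
      ultimately have "f x = 0" by (simp add: f_def)
      then show "x \<in> ?R" using R x by blast
    qed
    show "?R \<subseteq> ?L"
    proof -
      have "?R \<subseteq> convex hull (v ` J)"
        by (intro hull_minimal) (auto intro!: node_in_face_hull e_pos J)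
      moreover have "?R \<subseteq> K M" "?R \<subseteq> K M'" unfolding hull_cell_def by (auto intro!: hull_mono)
      ultimately show ?thesis by blast
    qed
  qed
qed

text \<open>Some cell \<open>q\<close> has the label \<open>l\<close>. Both differences of the rows
  of \<open>M\<close> and \<open>q\<close> are nonnegative at the node, so the rows tie there, and
  by \<open>cells_argmin\<close> a tie means membership.\<close>

lemma pt_in_K:
  assumes "l < 18" "M < 14" "pt l \<in> K M" shows "l \<in> set (cells ! M)"
proof -
  obtain q where q: "q < 14" "l \<in> set (cells ! q)" using cell_cover[OF assms(1)] by blast
  have "0 \<le> sep M q (pt l)"
    by (rule affine_fun_hull_nonneg[where V = "pt ` set (cells ! M)", OF sep_affine])
       (use assms q sep_pt in \<open>auto simp: hull_cell_def\<close>)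
  moreover have "0 \<le> sep q M (pt l)" using sep_pt[of q M l] q assms by auto
  ultimately have "sep q M (pt l) = 0" using q assms by (simp add: sep_def)
  then show ?thesis using sep_pt[of q M l] q assms by auto
qed

text \<open>An integer relation between homogeneous coordinates becomes an affine relation between
  nodes once each coefficient is multiplied by \<open>node_total\<close>; in the last coordinate
  \<open>e\<close> is a common factor of both sides.\<close>

lemma relation_absorb:
  assumes M: "M < 14" and F: "F face_of K M" and A: "A \<subseteq> {..<length (cells ! M)}" "A \<noteq> {}" and B: "B \<subseteq> {..<length (cells ! M)}"
    and pos: "\<And>m. m \<in> A \<union> B \<Longrightarrow> 0 < r ! m"
    and rel: "\<And>i. i < 4 \<Longrightarrow> (\<Sum>m\<in>A. r ! m * coords ! (cells ! M ! m) ! i) = (\<Sum>m\<in>B. r ! m * coords ! (cells ! M ! m) ! i)"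
    and mem: "\<And>m. m \<in> A \<Longrightarrow> pt (cells ! M ! m) \<in> F" and b: "b \<in> B"
  shows "pt (cells ! M ! b) \<in> F"
proof -
  let ?l = "\<lambda>m. cells ! M ! m"
  let ?c = "\<lambda>m. of_int (r ! m) * node_total e (?l m)"
  have lt: "?l m \<in> set (cells ! M)" "?l m < 18" if "m \<in> A \<union> B" for m
    using that A B M by (auto intro!: nth_mem cell_label[OF M])
  have w: "(\<Sum>m\<in>S. of_int (r ! m) * node_weight e (?l m) i) =
      (if i = 3 then e else 1) * of_int (\<Sum>m\<in>S. r ! m * coords ! ?l m ! i)" for S i
    by (simp add: node_weight_def sum_distrib_left mult_ac)
  have AB: "(\<Sum>m\<in>A. of_int (r ! m) * node_weight e (?l m) i) = (\<Sum>m\<in>B. of_int (r ! m) * node_weight e (?l m) i)" if "i < 4" for i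
    unfolding w using rel[OF that] by simp
  have vec: "(\<Sum>m\<in>S. ?c m *\<^sub>R pt (?l m)) = (\<Sum>i<4. (\<Sum>m\<in>S. of_int (r ! m) * node_weight e (?l m) i) *\<^sub>R v i)"
    if "S \<subseteq> A \<union> B" for S
  proof (rule node_sum[OF e_pos])
    show "finite S" by (rule finite_subset[OF that]) (use A B finite_subset in blast)
    show "?l m < 18" if "m \<in> S" for m using lt(2) that \<open>S \<subseteq> A \<union> B\<close> by blast
  qed
  have fin: "finite A" "finite B" using A B finite_subset by blast+
  show ?thesis
  proof (rule face_absorb_relation[where A = A and B = B and \<alpha> = ?c and \<beta> = ?c and x = "\<lambda>m. pt (?l m)", OF F _ fin A(2)])
    show "sum ?c A = sum ?c B" unfolding node_total_sum using AB by simp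
    show "(\<Sum>b\<in>A. ?c b *\<^sub>R pt (?l b)) = (\<Sum>b\<in>B. ?c b *\<^sub>R pt (?l b))"
      using AB by (simp add: vec)
    show "0 < ?c m" if "m \<in> A" for m using that pos[of m] lt(2)[of m] node_total_pos[OF e_pos] by simp
    show "0 < ?c m" if "m \<in> B" for m using that pos[of m] lt(2)[of m] node_total_pos[OF e_pos] by simp
    show "pt (?l m) \<in> K M" if "m \<in> B" for m unfolding hull_cell_def using that lt(1)[of m] by (intro hull_inc) auto
  qed (use mem b K_polytope polytope_imp_convex in auto)
qed

end

section \<open>Square pyramids and bipyramids\<close>

text \<open>The diagonals of the base are 0,1 and 2,3, and the apex is 4. As for octahedra, exposed
  sets provide the faces, and the closure condition excludes faces that contain a diagonal without
  the whole base.\<close>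

definition pyramidal :: "(nat \<Rightarrow> 'a::euclidean_space) \<Rightarrow> bool" where
  "pyramidal P \<longleftrightarrow> (\<forall>i\<in>{0,1}. \<forall>j\<in>{2,3}. exposed_set P 5 {i,j,4}) \<and> exposed_set P 5 {..<4} \<and>
     (\<forall>F. F face_of convex hull (P ` {..<5}) \<longrightarrow> P ` {0,1} \<subseteq> F \<or> P ` {2,3} \<subseteq> F \<longrightarrow> P ` {..<4} \<subseteq> F)"

lemma pyramidal_side: "pyramidal P \<Longrightarrow> i \<in> {0,1} \<Longrightarrow> j \<in> {2,3} \<Longrightarrow> exposed_set P 5 {i,j,4}"
  unfolding pyramidal_def by (elim conjE) (drule (1) bspec, drule (1) bspec)

lemma pyramidal_base: "pyramidal P \<Longrightarrow> exposed_set P 5 {..<4}"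
  unfolding pyramidal_def by (elim conjE)

lemma pyramidal_closure:
  "pyramidal P \<Longrightarrow> F face_of convex hull (P ` {..<5}) \<Longrightarrow> P ` {0,1} \<subseteq> F \<or> P ` {2,3} \<subseteq> F \<Longrightarrow> P ` {..<4} \<subseteq> F"
  unfolding pyramidal_def by (elim conjE) (drule spec, drule (1) mp, drule (1) mp)

lemma pyramidal_face_cases:
  assumes P: "pyramidal P" and F: "F face_of convex hull (P ` {..<5})"
  obtains "F = convex hull (P ` {..<5})" | "F = convex hull (P ` {..<4})"
  | i j A where "i \<in> {0,1}" "j \<in> {2,3}" "A \<subseteq> {i,j,4}" "F = convex hull (P ` A)"
proof -
  define A where "A = {m \<in> {..<5}. P m \<in> F}"
  have FA: "F = convex hull (P ` A)"
  proof -
    have "P ` {..<5} \<inter> F = P ` A" by (auto simp: A_def)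
    then show ?thesis using hull_face_vertices[OF _ F] by simp
  qed
  show thesis
  proof (cases "{0,1} \<subseteq> A \<or> {2,3} \<subseteq> A")
    case True
    then have "P ` {0,1} \<subseteq> F \<or> P ` {2,3} \<subseteq> F" by (auto simp: A_def)
    then have "P ` {..<4} \<subseteq> F" by (rule pyramidal_closure[OF P F])
    then have A4: "{..<4} \<subseteq> A" by (auto simp: A_def)
    have five: "{..<5::nat} = insert 4 {..<4}" by auto
    have "A \<subseteq> {..<5}" by (auto simp: A_def)
    then have "A = {..<4} \<or> A = {..<5}" using A4 unfolding five by blast
    then show ?thesis using that(1,2) FA by blast
  next
    case False
    \<comment> \<open>The other ends of the diagonals through \<open>i\<close> and \<open>j\<close>
      are \<open>1 - i\<close> and \<open>5 - j\<close>.\<close>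
    then have "\<exists>i\<in>{0,1}. 1 - i \<notin> A" "\<exists>j\<in>{2,3}. 5 - j \<notin> A" by simp_all blast+
    then obtain i j where ij: "i \<in> {0,1}" "j \<in> {2,3}" "1 - i \<notin> A" "5 - j \<notin> A" by blast
    have "m \<in> {i,j,4}" if "m \<in> A" for m
    proof -
      have "m \<in> {0,1,2,3,4}" using that by (auto simp: A_def)
      then show ?thesis using ij that by auto
    qed
    then show ?thesis using that(3)[OF ij(1,2) _ FA] by blast
  qed
qed

lemma pyramidal_aff_dim:
  fixes P :: "nat \<Rightarrow> 'a::euclidean_space"
  assumes P: "pyramidal P" shows "aff_dim (convex hull (P ` {..<5})) \<ge> 3"
proof -
  have E: "exposed_set P 5 {0,2,4}" "exposed_set P 5 {0,3,4}" "exposed_set P 5 {1,3,4}" "exposed_set P 5 {..<4}"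
    using pyramidal_side[OF P, of 0 2] pyramidal_side[OF P, of 0 3] pyramidal_side[OF P, of 1 3] pyramidal_base[OF P] by simp_all
  have "{0,2,4} \<inter> {..<4} = {0,2::nat}" by auto
  then have E1: "exposed_set P 5 {0,2}" using exposed_set_Int[OF E(1,4)] by simp
  have "{0,2} \<inter> {0,3,4} = {0::nat}" by auto
  then have E2: "exposed_set P 5 {0}" using exposed_set_Int[OF E1 E(2)] by simp
  have "{0,2} \<inter> {1,3,4} = ({}::nat set)" by auto
  then have E3: "exposed_set P 5 {}" using exposed_set_Int[OF E1 E(3)] by simp
  have E4: "exposed_set P 5 {..<5}"
    by (rule exposed_setI[OF _ affine_fun_const[of 0]]) auto
  have "aff_dim (convex hull (P ` {})) < aff_dim (convex hull (P ` {0}))"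
    "aff_dim (convex hull (P ` {0})) < aff_dim (convex hull (P ` {0,2}))"
    "aff_dim (convex hull (P ` {0,2})) < aff_dim (convex hull (P ` {0,2,4}))"
    "aff_dim (convex hull (P ` {0,2,4})) < aff_dim (convex hull (P ` {..<5}))"
    by (rule exposed_set_chain[OF E3 E2], force, rule exposed_set_chain[OF E2 E1], force,
        rule exposed_set_chain[OF E1 E(1)], force, rule exposed_set_chain[OF E(1) E4], force)
  then show ?thesis by simp
qed

text \<open>By \<open>rel\<close> the segment between the apexes crosses the interior of the base. A
  side plane of one pyramid is positive at two base corners, hence at the crossing point; as it
  vanishes at one apex, it is positive at the other and supports the whole bipyramid.\<close>

lemma bipyramid_octahedral:
  fixes P :: "nat \<Rightarrow> 'a::euclidean_space"
  assumes P: "pyramidal P" and P': "pyramidal (P(4 := P 5))"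
    and g: "0 < g" and \<sigma>: "\<And>j. j < 4 \<Longrightarrow> 0 < \<sigma> j" "sum \<sigma> {..<4} = g + 1"
    and rel: "g *\<^sub>R P 4 + P 5 = (\<Sum>j<4. \<sigma> j *\<^sub>R P j)"
    and diag: "\<And>j::nat. j < 4 \<Longrightarrow> 0 < \<rho> j" "\<rho> 0 + \<rho> 1 = \<rho> 2 + \<rho> 3" "\<rho> 0 *\<^sub>R P 0 + \<rho> 1 *\<^sub>R P 1 = \<rho> 2 *\<^sub>R P 2 + \<rho> 3 *\<^sub>R P 3"
  shows "octahedral P"
proof (rule octahedralI)
  let ?\<alpha> = "\<lambda>m::nat. if m = 4 then g else (1::real)"
  have rel': "(\<Sum>b\<in>{4,5}. ?\<alpha> b *\<^sub>R P b) = (\<Sum>b\<in>{..<4}. \<sigma> b *\<^sub>R P b)" "sum ?\<alpha> {4,5} = sum \<sigma> {..<4}"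
    using rel \<sigma>(2) by simp_all
  have four: "{..<4::nat} = {0,1,2,3}" and six: "{..<6::nat} = {0,1,2,3,4,5}" by auto
  fix i j k :: nat assume ijk: "i \<in> {0,1}" "j \<in> {2,3}" "k \<in> {4,5}"
  define Q where "Q = P(4 := P k)"
  \<comment> \<open>The apexes have the indices 4 and 5, so \<open>k'\<close> is the apex other than
    \<open>k\<close>.\<close>
  define k' where "k' = 9 - k"
  have Q: "pyramidal Q" using P P' ijk(3) by (auto simp: Q_def)
  then have "exposed_set Q 5 {i,j,4}" using pyramidal_side ijk by blast
  note Qe = this
  define f where "f = exposing Q 5 {i,j,4}"
  note f = exposing[OF Qe, folded f_def]
  have fP: "0 \<le> f (P m)" "f (P m) = 0 \<longleftrightarrow> m \<in> {i,j}" if "m < 4" for m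
    using f(2)[of m] f(3)[of m] that by (simp_all add: Q_def)
  have fk: "f (P k) = 0" using f(3)[of 4] by (simp add: Q_def)
  have "(\<Sum>b\<in>{4,5}. ?\<alpha> b * f (P b)) = (\<Sum>b\<in>{..<4}. \<sigma> b * f (P b))"
    by (rule affine_fun_relation[OF f(1) rel'(2,1)])
  also have "\<dots> > 0"
  proof (rule sum_pos2[of _ "1 - i"])
    show "1 - i \<in> {..<4}" using ijk by auto
    have "1 - i \<notin> {i,j}" using ijk by auto
    then have "f (P (1 - i)) > 0" using fP[of "1 - i"] ijk by auto
    then show "0 < \<sigma> (1 - i) * f (P (1 - i))" using \<sigma>(1)[of "1 - i"] ijk by auto
  qed (use \<sigma>(1) fP in \<open>auto simp: less_imp_le\<close>)
  finally have "0 < g * f (P 4) + f (P 5)" by simp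
  then have fk': "0 < f (P k')" using fk ijk(3) g by (auto simp: k'_def zero_less_mult_iff)
  show "exposed_set P 6 {i,j,k}"
  proof (rule exposed_setI[OF _ f(1)])
    show "{i,j,k} \<subseteq> {..<6}" using ijk by auto
    fix m :: nat assume "m < 6"
    then have m: "m < 4 \<or> m = k \<or> m = k'" using ijk(3) by (auto simp: k'_def)
    show "0 \<le> f (P m)" using m fP(1) fk fk' by auto
    show "f (P m) = 0 \<longleftrightarrow> m \<in> {i,j,k}" using m
    proof (elim disjE)
      assume "m < 4" then show ?thesis using fP(2)[of m] ijk(3) by auto
    next
      assume "m = k" then show ?thesis using fk by simp
    next
      assume "m = k'"
      moreover have "k' \<notin> {i,j,k}" using ijk by (auto simp: k'_def)
      ultimately show ?thesis using fk' by auto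
    qed
  qed
next
  let ?\<alpha> = "\<lambda>m::nat. if m = 4 then g else (1::real)"
  have rel': "(\<Sum>b\<in>{4,5}. ?\<alpha> b *\<^sub>R P b) = (\<Sum>b\<in>{..<4}. \<sigma> b *\<^sub>R P b)" "sum ?\<alpha> {4,5} = sum \<sigma> {..<4}"
    using rel \<sigma>(2) by simp_all
  have four: "{..<4::nat} = {0,1,2,3}" and six: "{..<6::nat} = {0,1,2,3,4,5}" by auto
  fix F assume F: "F face_of convex hull (P ` {..<6})" and "P ` {0,1} \<subseteq> F \<or> P ` {2,3} \<subseteq> F \<or> P ` {4,5} \<subseteq> F"
  have inP: "P m \<in> convex hull (P ` {..<6})" if "m < 6" for m using that by (intro hull_inc) auto
  have dp: "0 < \<rho> 0" "0 < \<rho> 1" "0 < \<rho> 2" "0 < \<rho> 3" using diag(1) by simp_all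
  have d01: "P b \<in> F" if "P ` {0,1} \<subseteq> F" "b \<in> {2,3}" for b
    by (rule face_absorb_relation[where A = "{0,1}" and B = "{2,3}" and \<alpha> = \<rho> and \<beta> = \<rho>, OF F])
       (use that dp diag(2,3) inP in auto)
  have d23: "P b \<in> F" if "P ` {2,3} \<subseteq> F" "b \<in> {0,1}" for b
    by (rule face_absorb_relation[where A = "{2,3}" and B = "{0,1}" and \<alpha> = \<rho> and \<beta> = \<rho>, OF F])
       (use that dp diag(2,3) inP in auto)
  have s45: "P b \<in> F" if "P ` {4,5} \<subseteq> F" "b \<in> {..<4}" for b
    by (rule face_absorb_relation[where A = "{4,5}" and B = "{..<4}" and \<alpha> = ?\<alpha> and \<beta> = \<sigma>, OF F])
       (use that rel' \<sigma>(1) g inP in auto)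
  have s03: "P b \<in> F" if "P ` {..<4} \<subseteq> F" "b \<in> {4,5}" for b
    by (rule face_absorb_relation[where A = "{..<4}" and B = "{4,5}" and \<alpha> = \<sigma> and \<beta> = ?\<alpha>, OF F])
       (use that rel' \<sigma>(1) g inP in auto)
  have "P ` {..<4} \<subseteq> F"
    using \<open>P ` {0,1} \<subseteq> F \<or> P ` {2,3} \<subseteq> F \<or> P ` {4,5} \<subseteq> F\<close>
  proof (elim disjE)
    assume A: "P ` {0,1} \<subseteq> F" show ?thesis using A d01[OF A, of 2] d01[OF A, of 3] unfolding four by simp
  next
    assume A: "P ` {2,3} \<subseteq> F" show ?thesis using A d23[OF A, of 0] d23[OF A, of 1] unfolding four by simp
  next
    assume A: "P ` {4,5} \<subseteq> F" show ?thesis using s45[OF A] by (intro image_subsetI)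
  qed
  note A = this
  show "P ` {..<6} \<subseteq> F" using A s03[OF A, of 4] s03[OF A, of 5] unfolding four six by simp
qed

lemma convex_hull_image_comb:
  fixes P :: "nat \<Rightarrow> 'a::euclidean_space"
  assumes "x \<in> convex hull (P ` {..<n})"
  obtains u where "\<And>m. m < n \<Longrightarrow> 0 \<le> u m" "sum u {..<n} = 1" "x = (\<Sum>m<n. u m *\<^sub>R P m)"
proof -
  have "convex {y. \<exists>u. (\<forall>m<n. 0 \<le> u m) \<and> sum u {..<n} = 1 \<and> y = (\<Sum>m<n. u m *\<^sub>R P m)}" (is "convex ?C")
  proof (rule convexI)
    fix y z and a b :: real assume ab: "0 \<le> a" "0 \<le> b" "a + b = 1" and "y \<in> ?C" "z \<in> ?C"
    from \<open>y \<in> ?C\<close> obtain u where u: "\<forall>m<n. 0 \<le> u m" "sum u {..<n} = 1" "y = (\<Sum>m<n. u m *\<^sub>R P m)"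
      by (elim CollectE exE conjE) (rule that)
    from \<open>z \<in> ?C\<close> obtain w where w: "\<forall>m<n. 0 \<le> w m" "sum w {..<n} = 1" "z = (\<Sum>m<n. w m *\<^sub>R P m)"
      by (elim CollectE exE conjE) (rule that)
    let ?t = "\<lambda>m. a * u m + b * w m"
    have "\<forall>m<n. 0 \<le> ?t m" using u w ab by simp
    moreover have "sum ?t {..<n} = 1" using u w ab by (simp add: sum.distrib flip: sum_distrib_left)
    moreover have "a *\<^sub>R y + b *\<^sub>R z = (\<Sum>m<n. ?t m *\<^sub>R P m)"
      by (simp add: u w scaleR_sum_right scaleR_left_distrib sum.distrib)
    ultimately show "a *\<^sub>R y + b *\<^sub>R z \<in> ?C" by (intro CollectI exI[of _ ?t] conjI)
  qed
  moreover have "P ` {..<n} \<subseteq> ?C"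
  proof
    fix y assume "y \<in> P ` {..<n}"
    then obtain k where k: "k < n" "y = P k" by auto
    show "y \<in> ?C"
      using k by (intro CollectI exI[of _ "\<lambda>m. if m = k then 1 else 0"]) (simp add: if_distrib[of "\<lambda>c. c *\<^sub>R _"] cong: if_cong)
  qed
  ultimately have "x \<in> ?C" using assms hull_minimal[of "P ` {..<n}" ?C convex] by blast
  then obtain u where "\<forall>m<n. 0 \<le> u m" "sum u {..<n} = 1" "x = (\<Sum>m<n. u m *\<^sub>R P m)"
    by (elim CollectE exE conjE) (rule that)
  then show ?thesis using that[of u] by simp
qed

text \<open>The relation moves weight from both apexes to the base until one apex has weight 0;
  comparing \<open>g * u 5\<close> with \<open>u 4\<close> decides which one disappears.\<close>

lemma bipyramid_union:
  fixes P :: "nat \<Rightarrow> 'a::euclidean_space"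
  assumes g: "0 < g" and \<sigma>: "\<And>j. j < 4 \<Longrightarrow> 0 < \<sigma> j" "sum \<sigma> {..<4} = g + 1"
    and rel: "g *\<^sub>R P 4 + P 5 = (\<Sum>j<4. \<sigma> j *\<^sub>R P j)"
  shows "convex hull (P ` {..<6}) = convex hull (P ` {0,1,2,3,4}) \<union> convex hull (P ` {0,1,2,3,5})" (is "?O = ?A \<union> ?B")
proof
  have s6: "{..<6::nat} = insert 5 (insert 4 {..<4})" and s4: "{0,1,2,3} = {..<4::nat}" by auto
  have sA: "{0,1,2,3,4} = insert 4 {..<4::nat}" and sB: "{0,1,2,3,5} = insert 5 {..<4::nat}" by auto
  show "?A \<union> ?B \<subseteq> ?O" unfolding sA sB s6 by (intro Un_least hull_mono) auto
  show "?O \<subseteq> ?A \<union> ?B"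
  proof
    fix x assume "x \<in> ?O"
    then obtain u where u: "\<And>m. m < 6 \<Longrightarrow> 0 \<le> u m" "sum u {..<6} = 1" "x = (\<Sum>m<6. u m *\<^sub>R P m)"
      using convex_hull_image_comb by blast
    have u1: "u 4 + u 5 + sum u {..<4} = 1" using u(2) unfolding s6 by simp
    have x: "x = u 4 *\<^sub>R P 4 + u 5 *\<^sub>R P 5 + (\<Sum>m<4. u m *\<^sub>R P m)" using u(3) unfolding s6 by (simp add: add_ac)
    have P5: "P 5 = (\<Sum>j<4. \<sigma> j *\<^sub>R P j) - g *\<^sub>R P 4" using rel by (simp add: eq_diff_eq add.commute)
    have P4: "P 4 = (1/g) *\<^sub>R (\<Sum>j<4. \<sigma> j *\<^sub>R P j) - (1/g) *\<^sub>R P 5" using g unfolding P5 by (simp add: scaleR_diff_right)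
    show "x \<in> ?A \<union> ?B"
    proof (cases "g * u 5 \<le> u 4")
      case True
      define w where "w m = (if m = 4 then u 4 - g * u 5 else u m + u 5 * \<sigma> m)" for m
      have "x = (u 4 - g * u 5) *\<^sub>R P 4 + (\<Sum>m<4. (u m + u 5 * \<sigma> m) *\<^sub>R P m)"
        unfolding x P5 by (simp add: scaleR_diff_right scaleR_diff_left scaleR_sum_right scaleR_left_distrib sum.distrib mult.commute)
      then have xw: "x = (\<Sum>m\<in>insert 4 {..<4}. w m *\<^sub>R P m)" by (simp add: w_def)
      have "sum w (insert 4 {..<4}) = u 4 - g * u 5 + (sum u {..<4} + u 5 * sum \<sigma> {..<4})"
        by (simp add: w_def sum.distrib sum_distrib_left)
      then have sw: "sum w (insert 4 {..<4}) = 1" using u1 \<sigma>(2) by (simp add: algebra_simps)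
      have nn: "0 \<le> w m" if "m \<in> insert 4 {..<4}" for m
      proof (cases "m = 4")
        case False
        then have "m < 4" using that by simp
        then show ?thesis using u(1)[of m] u(1)[of 5] \<sigma>(1)[of m] by (simp add: w_def)
      qed (use True in \<open>simp add: w_def\<close>)
      have "x \<in> ?A" unfolding xw sA
        by (rule convex_sum[OF _ convex_convex_hull sw nn]) (auto simp: hull_inc)
      then show ?thesis by blast
    next
      case False
      define w where "w m = (if m = 5 then u 5 - u 4 / g else u m + u 4 / g * \<sigma> m)" for m
      have "x = (u 5 - u 4 / g) *\<^sub>R P 5 + (\<Sum>m<4. (u m + u 4 / g * \<sigma> m) *\<^sub>R P m)"
        unfolding x by (subst P4) (simp add: scaleR_diff_right scaleR_diff_left scaleR_sum_right scaleR_left_distrib sum.distrib)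
      then have xw: "x = (\<Sum>m\<in>insert 5 {..<4}. w m *\<^sub>R P m)" by (simp add: w_def)
      have "sum w (insert 5 {..<4}) = u 5 - u 4 / g + (sum u {..<4} + u 4 / g * sum \<sigma> {..<4})"
        by (simp add: w_def sum.distrib sum_distrib_left)
      also have "\<dots> = u 4 + u 5 + sum u {..<4}" using g \<sigma>(2) by (simp add: field_simps)
      finally have sw: "sum w (insert 5 {..<4}) = 1" using u1 by simp
      have nn: "0 \<le> w m" if "m \<in> insert 5 {..<4}" for m
      proof (cases "m = 5")
        case True
        then show ?thesis using False g by (simp add: w_def field_simps)
      next
        case False
        then have "m < 4" using that by simp
        then show ?thesis using u(1)[of m] u(1)[of 4] \<sigma>(1)[of m] g by (simp add: w_def)
      qed
      have "x \<in> ?B" unfolding xw sB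
        by (rule convex_sum[OF _ convex_convex_hull sw nn]) (auto simp: hull_inc)
      then show ?thesis by blast
    qed
  qed
qed

section \<open>The cells of a subdivided tetrahedron\<close>

lemma nth_image_set: "length xs = n \<Longrightarrow> (\<lambda>m. f (xs ! m)) ` {..<n} = f ` set xs"
  by (force simp: set_conv_nth)

lemma exposed_indices_subset: "set (exposed_indices M q) \<subseteq> {..<length (cells ! M)}"
  by (auto simp: exposed_indices_def)

context frame
begin

abbreviation vertex :: "nat \<Rightarrow> nat \<Rightarrow> real^3" where
  "vertex M m \<equiv> pt (cells ! M ! m)"

lemma K_vertex: "M < 14 \<Longrightarrow> K M = convex hull (vertex M ` {..<length (cells ! M)})"
  unfolding hull_cell_def by (subst nth_image_set) simp_all

lemma sep_vertex:
  assumes "M < 14" "q < 18" "m < length (cells ! M)"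
  shows "0 \<le> sep M q (vertex M m)" "sep M q (vertex M m) = 0 \<longleftrightarrow> m \<in> set (exposed_indices M q)"
  using sep_pt[OF assms(1,2) nth_mem[OF assms(3)]] assms(3) by (simp_all add: exposed_indices_def)

lemma exposed_set_indices:
  "M < 14 \<Longrightarrow> q < 18 \<Longrightarrow> exposed_set (vertex M) (length (cells ! M)) (set (exposed_indices M q))"
  using exposed_indices_subset sep_affine sep_vertex by (rule exposed_setI)

lemma octahedron_cell:
  assumes M: "M < 9" shows "octahedral (vertex M)"
proof (rule octahedralI)
  have M14: "M < 14" and len: "length (cells ! M) = 6" using M cell_length[of M] by simp_all
  fix i j k :: nat assume ijk: "i \<in> {0,1}" "j \<in> {2,3}" "k \<in> {4,5}"
  have "list_ex (\<lambda>q. exposed_indices M q = [i,j,k]) [0..<18]"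
    by (rule list_all_mem[OF list_all_mem[OF list_all_mem[OF list_all_upt[OF octahedron_exposed M]]]]) (use ijk in auto)
  then obtain q where "q < 18" "exposed_indices M q = [i,j,k]" using list_ex_upt by blast
  then show "exposed_set (vertex M) 6 {i,j,k}" using exposed_set_indices[OF M14, of q] len by simp
next
  have M14: "M < 14" and len: "length (cells ! M) = 6" using M cell_length[of M] by simp_all
  fix F assume F: "F face_of convex hull (vertex M ` {..<6})"
    and cl: "vertex M ` {0,1} \<subseteq> F \<or> vertex M ` {2,3} \<subseteq> F \<or> vertex M ` {4,5} \<subseteq> F"
  then obtain t where t: "t < 3" "vertex M (2*t) \<in> F" "vertex M (2*t+1) \<in> F"
  proof (elim disjE, goal_cases)
    case 1 then show ?case using that[of 0] by simp
  next
    case 2 then show ?case using that[of 1] by simp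
  next
    case 3 then show ?case using that[of 2] by simp
  qed
  define r where "r = relations ! M ! t"
  let ?A = "set [2*t, 2*t+1]" and ?B = "set (filter (\<lambda>m. m div 2 \<noteq> t) [0..<6])"
  have R: "list_all (\<lambda>m. 0 < r ! m) [0..<6]"
    "list_all (\<lambda>i. weighted_coord M r [2*t, 2*t+1] i = weighted_coord M r (filter (\<lambda>m. m div 2 \<noteq> t) [0..<6]) i) [0..<4]"
    using list_all_upt[OF list_all_upt[OF relations_octahedron M] t(1)] by (simp_all add: Let_def r_def)
  have "vertex M b \<in> F" if "b \<in> ?B" for b
  proof (rule relation_absorb[OF M14, where A = ?A and B = ?B and r = r])
    show "F face_of K M" using F len by (simp add: K_vertex[OF M14])
    show "?A \<subseteq> {..<length (cells ! M)}" using t(1) len by auto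
    show "?B \<subseteq> {..<length (cells ! M)}" using len by auto
    show "0 < r ! m" if "m \<in> ?A \<union> ?B" for m by (rule list_all_upt[OF R(1)]) (use that t(1) in auto)
    show "(\<Sum>m\<in>?A. r ! m * coords ! (cells ! M ! m) ! i) = (\<Sum>m\<in>?B. r ! m * coords ! (cells ! M ! m) ! i)" if "i < 4" for i
      using list_all_upt[OF R(2) that] by (subst (asm) (1 2) weighted_coord_sum) auto
    show "vertex M m \<in> F" if "m \<in> ?A" for m using that t by auto
  qed (use that in auto)
  moreover have "m \<in> ?A \<union> ?B" if "m < 6" for m
    using that by (auto simp: div_nat_eqI)
  moreover have "vertex M m \<in> F" if "m \<in> ?A" for m using that t by auto
  ultimately show "vertex M ` {..<6} \<subseteq> F" by blast
qed

lemma pyramid_cell: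
  assumes M: "9 \<le> M" "M < 14" shows "pyramidal (vertex M)"
proof -
  have len: "length (cells ! M) = 5" using M cell_length[of M] by simp
  have M': "M \<in> set [9..<14]" using M by auto
  show ?thesis
    unfolding pyramidal_def
  proof (intro conjI ballI allI impI)
    fix i j :: nat assume ij: "i \<in> {0,1}" "j \<in> {2,3}"
    have "list_ex (\<lambda>q. exposed_indices M q = [i,j,4]) [0..<18]"
      by (rule list_all_mem[OF list_all_mem[OF conjunct1[OF list_all_mem[OF pyramid_exposed M']]]]) (use ij in auto)
    then obtain q where "q < 18" "exposed_indices M q = [i,j,4]" using list_ex_upt by blast
    then show "exposed_set (vertex M) 5 {i,j,4}" using exposed_set_indices[OF M(2), of q] len by simp
  next
    have four: "{..<4::nat} = {0,1,2,3}" by auto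
    have "exposed_indices M 17 = [0,1,2,3]" by (rule conjunct2[OF list_all_mem[OF pyramid_exposed M']])
    then show "exposed_set (vertex M) 5 {..<4}" using exposed_set_indices[OF M(2), of 17] len by (simp add: four)
  next
    fix F assume F: "F face_of convex hull (vertex M ` {..<5})" and cl: "vertex M ` {0,1} \<subseteq> F \<or> vertex M ` {2,3} \<subseteq> F"
    define r where "r = relations ! M ! 0"
    have R: "list_all (\<lambda>m. 0 < r ! m) [0..<4]"
      "list_all (\<lambda>i. weighted_coord M r [0,1] i = weighted_coord M r [2,3] i) [0..<4]"
      using list_all_mem[OF relations_pyramid M'] by (simp_all add: Let_def r_def)
    have rel: "(\<Sum>m\<in>set [0,1]. r ! m * coords ! (cells ! M ! m) ! i) = (\<Sum>m\<in>set [2,3]. r ! m * coords ! (cells ! M ! m) ! i)" if "i < 4" for i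
      using list_all_upt[OF R(2) that] by (subst (asm) (1 2) weighted_coord_sum) auto
    have FK: "F face_of K M" using F len by (simp add: K_vertex[OF M(2)])
    have pos: "0 < r ! m" if "m < 4" for m by (rule list_all_upt[OF R(1) that])
    have four: "{..<4::nat} = {0,1,2,3}" by auto
    have "vertex M ` set [0,1] \<subseteq> F \<and> vertex M ` set [2,3] \<subseteq> F"
    proof (cases "vertex M ` {0,1} \<subseteq> F")
      case True
      have "vertex M b \<in> F" if "b \<in> set [2,3]" for b
        by (rule relation_absorb[OF M(2) FK, where A = "set [0,1]" and B = "set [2,3]" and r = r, OF _ _ _ _ rel])
           (use True that len pos in auto)
      then show ?thesis using True by auto
    next
      case False
      then have 23: "vertex M ` {2,3} \<subseteq> F" using cl by blast
      have "vertex M b \<in> F" if "b \<in> set [0,1]" for b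
        by (rule relation_absorb[OF M(2) FK, where A = "set [2,3]" and B = "set [0,1]" and r = r, OF _ _ _ _ rel[symmetric]])
           (use 23 that len pos in auto)
      then show ?thesis using 23 by auto
    qed
    then show "vertex M ` {..<4} \<subseteq> F" unfolding four by auto
  qed
qed

lemma K_octahedron: "M < 9 \<Longrightarrow> K M = convex hull (vertex M ` {..<6})"
  using K_vertex[of M] cell_length[of M] by simp

lemma K_pyramid: "9 \<le> M \<Longrightarrow> M < 14 \<Longrightarrow> K M = convex hull (vertex M ` {..<5})"
  using K_vertex[of M] cell_length[of M] by simp

lemma K_aff_dim: assumes "M < 14" shows "aff_dim (K M) = 3"
proof -
  have "3 \<le> aff_dim (K M)"
  proof (cases "M < 9")
    case True
    then show ?thesis using octahedral_aff_dim_ge[OF octahedron_cell] by (simp add: K_octahedron)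
  next
    case False
    then show ?thesis using assms pyramidal_aff_dim[OF pyramid_cell] by (simp add: K_pyramid)
  qed
  then show ?thesis using aff_dim_le_DIM[of "K M"] by simp
qed

lemma K_interior: assumes "M < 14" shows "interior (K M) \<noteq> {}"
proof -
  have "interior (K M) = rel_interior (K M)" using K_aff_dim[OF assms] by (simp add: interior_rel_interior_gen)
  moreover have "K M \<noteq> {}" using K_aff_dim[OF assms] by auto
  ultimately show ?thesis using rel_interior_eq_empty[of "K M"] polytope_imp_convex[OF K_polytope] by simp
qed

text \<open>The side condition discards functionals that vanish on the entire cell, such as
  \<open>sep M M\<close>; the remaining ones are positive in its interior.\<close>

lemma K_facet_functional:
  assumes M: "M < 14" and F: "F face_of K M" "F \<noteq> K M"
  shows "\<exists>q<18. set (exposed_indices M q) \<noteq> {..<length (cells ! M)} \<and> (\<forall>x\<in>F. sep M q x = 0)"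
proof -
  have *: ?thesis if A: "F = convex hull (vertex M ` A)" "A \<subseteq> set (exposed_indices M q)" "q < 18"
    "set (exposed_indices M q) \<noteq> {..<length (cells ! M)}" for A q
  proof (intro exI[of _ q] conjI ballI A)
    fix x assume x: "x \<in> F"
    show "sep M q x = 0"
    proof (rule affine_fun_zero_hull[OF sep_affine[OF A(3)] _ x[unfolded A(1)]])
      fix y assume "y \<in> vertex M ` A"
      then obtain m where m: "m \<in> set (exposed_indices M q)" "y = vertex M m" using A(2) by blast
      then have "m < length (cells ! M)" using exposed_indices_subset by blast
      then show "sep M q y = 0" using sep_vertex(2)[OF M A(3)] m by simp
    qed
  qed
  show ?thesis
  proof (cases "M < 9")
    case True
    have len: "length (cells ! M) = 6" using M True cell_length[of M] by simp
    have "F \<in> faces (convex hull (vertex M ` {..<6}))" using F(1) by (simp add: faces_def K_octahedron[OF True])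
    then obtain A where A: "A \<in> octahedron_sets" "F = convex hull (vertex M ` A)"
      using octahedral_faces(1)[OF octahedron_cell[OF True]] by auto
    have "A \<noteq> {..<6}" using F(2) A(2) K_octahedron[OF True] by auto
    then obtain m where m: "m < 6" "m \<notin> A" using A(1) unfolding octahedron_sets_def by blast
    obtain i j k where ijk: "i \<in> {0,1}" "j \<in> {2,3}" "k \<in> {4,5}" "A \<subseteq> {i,j,k}" "m \<notin> {i,j,k}"
      using octahedron_sets_avoid[OF A(1) m] by (elim bexE conjE) (rule that)
    have "list_ex (\<lambda>q. exposed_indices M q = [i,j,k]) [0..<18]"
      by (rule list_all_mem[OF list_all_mem[OF list_all_mem[OF list_all_upt[OF octahedron_exposed True]]]]) (use ijk in auto)
    then obtain q where q: "q < 18" "exposed_indices M q = [i,j,k]" using list_ex_upt by blast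
    have "set (exposed_indices M q) = {i,j,k}" using q(2) by simp
    moreover have "{i,j,k} \<noteq> {..<6}" using ijk(5) m(1) by blast
    ultimately show ?thesis using *[OF A(2) _ q(1)] ijk(4) len by simp
  next
    case False
    then have M9: "9 \<le> M" by simp
    have len: "length (cells ! M) = 5" using M False cell_length[of M] by simp
    have M': "M \<in> set [9..<14]" using M M9 by auto
    have F': "F face_of convex hull (vertex M ` {..<5})" using F(1) K_pyramid[OF M9 M] by simp
    show ?thesis
    proof (rule pyramidal_face_cases[OF pyramid_cell[OF M9 M] F'])
      assume "F = convex hull (vertex M ` {..<5})" then show ?thesis using F(2) K_pyramid[OF M9 M] by simp
    next
      assume A: "F = convex hull (vertex M ` {..<4})"
      have "exposed_indices M 17 = [0,1,2,3]" by (rule conjunct2[OF list_all_mem[OF pyramid_exposed M']])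
      then have E: "set (exposed_indices M 17) = {..<4}" by auto
      have "{..<4} \<noteq> {..<5::nat}" by simp
      then show ?thesis using *[OF A, of 17] E len by simp
    next
      fix i j A assume ij: "i \<in> {0,1::nat}" "j \<in> {2,3::nat}" "A \<subseteq> {i,j,4}" and A: "F = convex hull (vertex M ` A)"
      have "list_ex (\<lambda>q. exposed_indices M q = [i,j,4]) [0..<18]"
        by (rule list_all_mem[OF list_all_mem[OF conjunct1[OF list_all_mem[OF pyramid_exposed M']]]]) (use ij in auto)
      then obtain q where q: "q < 18" "exposed_indices M q = [i,j,4]" using list_ex_upt by blast
      have "1 - i \<in> {..<5}" "1 - i \<notin> {i,j,4}" using ij by auto
      then have "{i,j,4} \<noteq> {..<5}" by blast
      moreover have "set (exposed_indices M q) = {i,j,4}" using q(2) by simp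
      ultimately show ?thesis using *[OF A _ q(1)] ij(3) len by simp
    qed
  qed
qed

text \<open>A point lies in the cell whose row is minimal there: all row differences and all
  coordinates are then nonnegative, and every proper face of the cell is in the zero set of one of
  them, as \<open>polytope_eq_halfspaces\<close> requires.\<close>

lemma K_union: "(\<Union>M<14. K M) = convex hull (v ` {..<4})"
proof
  show "(\<Union>M<14. K M) \<subseteq> convex hull (v ` {..<4})" using K_subset by auto
  show "convex hull (v ` {..<4}) \<subseteq> (\<Union>M<14. K M)"
  proof
    fix x assume x: "x \<in> convex hull (v ` {..<4})"
    have "\<exists>M\<in>{..<14::nat}. \<forall>q\<in>{..<14}. lift M x \<le> lift q x"
    proof -
      let ?S = "(\<lambda>M. lift M x) ` {..<14::nat}"
      have "lift 0 x \<in> ?S" by simp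
      then have "Min ?S \<in> ?S" by (intro Min_in) blast+
      then obtain M where "M < 14" "lift M x = Min ?S" by auto
      then show ?thesis by (intro bexI[of _ M]) auto
    qed
    then obtain M where M: "M < 14" "\<And>q. q < 14 \<Longrightarrow> lift M x \<le> lift q x" by auto
    obtain c where c: "c \<in> interior (K M)" using K_interior[OF M(1)] by blast
    define Q where "Q = {q. q < 18 \<and> set (exposed_indices M q) \<noteq> {..<length (cells ! M)}}"
    have "x \<in> K M"
    proof (rule polytope_eq_halfspaces[OF K_polytope c, where \<F> = "sep M ` Q"])
      show "affine_fun f" if "f \<in> sep M ` Q" for f using that sep_affine by (auto simp: Q_def)
      show "0 < f c" if fQ: "f \<in> sep M ` Q" for f
      proof -
        obtain q where q: "q \<in> Q" "f = sep M q" using fQ by blast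
        then obtain m where m: "m < length (cells ! M)" "m \<notin> set (exposed_indices M q)"
          using exposed_indices_subset[of M q] by (auto simp: Q_def)
        have q18: "q < 18" using q by (simp add: Q_def)
        have "sep M q (vertex M m) \<noteq> 0" using sep_vertex[OF M(1) q18 m(1)] m(2) by simp
        moreover have "vertex M m \<in> K M" unfolding hull_cell_def using m(1) by (intro hull_inc imageI nth_mem)
        moreover have "0 \<le> sep M q y" if "y \<in> K M" for y
          by (rule affine_fun_hull_nonneg[where V = "pt ` set (cells ! M)", OF sep_affine[OF q18]])
             (use that M(1) q18 sep_pt in \<open>auto simp: hull_cell_def\<close>)
        ultimately show ?thesis unfolding q(2) using affine_fun_pos_interior[OF sep_affine[OF q18] _ _ _ c] by blast
      qed
      show "0 \<le> f x" if "f \<in> sep M ` Q" for f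
      proof -
        have "0 \<le> sep M q x" if "q < 18" for q
        proof (cases "q < 14")
          case True then show ?thesis using M(2)[OF True] by (simp add: sep_def)
        next
          case False
          then have "q - 14 < 4" using that by simp
          then show ?thesis using False x hull_iff_bary[of "{..<4}" x] by (simp add: sep_def)
        qed
        then show ?thesis using that by (auto simp: Q_def)
      qed
      show "\<exists>f\<in>sep M ` Q. \<forall>y\<in>F. f y = 0" if "F face_of K M" "F \<noteq> K M" for F
        using K_facet_functional[OF M(1) that] by (auto simp: Q_def)
    qed
    then show "x \<in> (\<Union>M<14. K M)" using M(1) by blast
  qed
qed

end

section \<open>Facets of a simplicial 3-polytope\<close>

text \<open>The bad directions form finitely many hyperplanes, a negligible set.\<close>

lemma exists_separating_direction:
  fixes V :: "'a::euclidean_space set"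
  assumes "finite V"
  shows "\<exists>u. \<forall>v\<in>V. \<forall>w\<in>V. v \<noteq> w \<longrightarrow> u \<bullet> v \<noteq> u \<bullet> w"
proof -
  define D where "D = (\<lambda>(v,w). v - w) ` {(v,w). v \<in> V \<and> w \<in> V \<and> v \<noteq> w}"
  have "finite D" unfolding D_def
    by (intro finite_imageI finite_subset[OF _ finite_cartesian_product[OF assms assms]]) auto
  moreover have "0 \<notin> D" by (auto simp: D_def)
  ultimately have "negligible (\<Union>((\<lambda>d. {u. d \<bullet> u = 0}) ` D))"
    by (intro negligible_Union) (auto intro!: negligible_hyperplane)
  then have "(\<Union>((\<lambda>d. {u. d \<bullet> u = 0}) ` D)) \<noteq> (UNIV :: 'a set)" using non_negligible_UNIV by metis
  then obtain u where u: "\<And>d. d \<in> D \<Longrightarrow> d \<bullet> u \<noteq> 0" by blast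
  have "u \<bullet> v \<noteq> u \<bullet> w" if "v \<in> V" "w \<in> V" "v \<noteq> w" for v w
  proof -
    have "v - w \<in> D" using that by (force simp: D_def)
    then have "(v - w) \<bullet> u \<noteq> 0" by (rule u)
    then show ?thesis by (simp add: inner_diff_left inner_commute[of u])
  qed
  then show ?thesis by blast
qed

lemma four_vectors_dependent:
  fixes n :: "nat \<Rightarrow> real^3"
  shows "\<exists>c. (\<exists>i<4. c i \<noteq> 0) \<and> (\<Sum>i<4. c i *\<^sub>R n i) = 0"
proof (cases "inj_on n {..<4}")
  case True
  have "dependent (n ` {..<4})"
    using independent_card_le[of "n ` {..<4}"] card_image[OF True] by auto
  then obtain u where u: "(\<Sum>w\<in>n ` {..<4}. u w *\<^sub>R w) = 0" "\<exists>w\<in>n ` {..<4}. u w \<noteq> 0"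
    using dependent_finite[of "n ` {..<4}"] by auto
  then show ?thesis using True by (intro exI[of _ "u \<circ> n"]) (auto simp: sum.reindex)
next
  case False
  then obtain i j where ij: "i < 4" "j < 4" "i \<noteq> j" "n i = n j" by (auto simp: inj_on_def)
  define c where "c k = (if k = i then 1 else if k = j then -1 else (0::real))" for k
  have "(\<Sum>k<4. c k *\<^sub>R n k) = (\<Sum>k\<in>{i,j}. c k *\<^sub>R n k)"
    using ij by (intro sum.mono_neutral_right) (auto simp: c_def)
  also have "\<dots> = 0" using ij by (simp add: c_def)
  finally show ?thesis using ij(1) by (intro exI[of _ c]) (auto simp: c_def)
qed

text \<open>Among three nonzero reals two have the same sign, and a vanishing coefficient can be
  paired with a nonvanishing one.\<close>

lemma same_sign_pair:
  fixes a b c x y z :: real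
  assumes "a * x + b * y + c * z = 0" "0 < x" "0 < y" "0 < z" "a \<noteq> 0 \<or> b \<noteq> 0 \<or> c \<noteq> 0"
  shows "0 \<le> b * c \<and> (b \<noteq> 0 \<or> c \<noteq> 0) \<or> 0 \<le> a * c \<and> (a \<noteq> 0 \<or> c \<noteq> 0) \<or> 0 \<le> a * b \<and> (a \<noteq> 0 \<or> b \<noteq> 0)"
proof (cases "a = 0 \<or> b = 0 \<or> c = 0")
  case True
  then show ?thesis using assms by (elim disjE) auto
next
  case False
  have "0 \<le> b * c \<or> 0 \<le> a * c \<or> 0 \<le> a * b" by (simp add: zero_le_mult_iff) linarith
  then show ?thesis using False by blast
qed

text \<open>Multiplication by \<open>b\<close> makes both summands nonnegative.\<close>

lemma same_sign_zero:
  fixes b c y z :: real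
  assumes "b * y + c * z = 0" "0 \<le> b * c" "0 \<le> y" "0 \<le> z" "b \<noteq> 0"
  shows "y = 0"
proof -
  have "b * (b * y + c * z) = b\<^sup>2 * y + (b * c) * z" by (simp add: algebra_simps power2_eq_square)
  then have e: "b\<^sup>2 * y + (b * c) * z = 0" using assms(1) by simp
  have "0 \<le> b\<^sup>2 * y" "0 \<le> (b * c) * z" using assms by simp_all
  then have "b\<^sup>2 * y = 0" using e by linarith
  then show ?thesis using assms(5) by simp
qed

text \<open>Three facet functionals through \<open>v\<close> are linearly dependent on \<open>S\<close>; up to a positive factor, one of them is a
  nonnegative combination of the other two, so its zeros are zeros of another one. Here \<open>u\<close> is either the direction
  of a common edge or the normal vector of a plane containing \<open>S\<close>.\<close>

lemma three_facets:
  fixes P :: "(real^3) set" and F :: "nat \<Rightarrow> (real^3) set"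
  assumes P: "polyhedron P" and F: "\<And>i. i < 3 \<Longrightarrow> F i facet_of P" and v: "\<And>i. i < 3 \<Longrightarrow> v \<in> F i"
    and u: "u \<noteq> 0" and S: "S \<subseteq> P" "\<And>y. y \<in> S \<Longrightarrow> u \<bullet> (y - v) = 0 \<or> (\<forall>i<3. \<forall>n k. F i = P \<inter> {x. n \<bullet> x = k} \<longrightarrow> n \<bullet> u = 0)"
    and m: "m \<in> S" "m \<in> interior P"
  shows "\<exists>j<3. \<exists>k<3. j \<noteq> k \<and> F j \<inter> S \<subseteq> F k"
proof -
  have "\<forall>i\<in>{..<3}. \<exists>n k. P \<subseteq> {x. n \<bullet> x \<le> k} \<and> F i = P \<inter> {x. n \<bullet> x = k}"
    using facet_of_polyhedron[OF P F] by (metis lessThan_iff)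
  then obtain n where "\<forall>i\<in>{..<3}. \<exists>k. P \<subseteq> {x. n i \<bullet> x \<le> k} \<and> F i = P \<inter> {x. n i \<bullet> x = k}" by metis
  then obtain k where nk: "\<And>i. i < 3 \<Longrightarrow> P \<subseteq> {x. n i \<bullet> x \<le> k i} \<and> F i = P \<inter> {x. n i \<bullet> x = k i}" by (metis lessThan_iff)
  define l where "l i y = k i - n i \<bullet> y" for i y
  have l0: "0 \<le> l i y" if "i < 3" "y \<in> P" for i y using nk[OF that(1)] that(2) by (auto simp: l_def)
  have lF: "y \<in> F i \<longleftrightarrow> l i y = 0" if "i < 3" "y \<in> P" for i y using nk[OF that(1)] that(2) by (auto simp: l_def)
  have vP: "v \<in> P" using facet_of_imp_subset[OF F[of 0]] v[of 0] by auto
  have lv: "l i y = n i \<bullet> (v - y)" if "i < 3" for i y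
    using lF[OF that vP] v[OF that] by (simp add: l_def inner_diff_right)
  have lm: "0 < l i m" if "i < 3" for i
  proof -
    have "F i \<noteq> P" using F[OF that] by (auto simp: facet_of_def)
    then have "m \<notin> F i" using m(2) face_of_disjoint_interior[OF facet_of_imp_face_of[OF F[OF that]]] by blast
    then have "l i m \<noteq> 0" using lF[OF that] m interior_subset by blast
    then show ?thesis using l0[OF that, of m] m(2) interior_subset by force
  qed
  obtain c where c: "\<exists>i<4. c i \<noteq> 0" "(\<Sum>i<4. c i *\<^sub>R (if i = 3 then u else n i)) = 0"
    using four_vectors_dependent[of "\<lambda>i. if i = 3 then u else n i"] by auto
  have s: "{..<4::nat} = {0,1,2,3}" by auto
  have c0: "c 0 *\<^sub>R n 0 + c 1 *\<^sub>R n 1 + c 2 *\<^sub>R n 2 + c 3 *\<^sub>R u = 0" using c(2) unfolding s by (simp add: add.assoc)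
  have nz: "c 0 \<noteq> 0 \<or> c 1 \<noteq> 0 \<or> c 2 \<noteq> 0"
  proof (rule ccontr)
    assume H: "\<not> ?thesis"
    then have "c 3 *\<^sub>R u = 0" using c0 by simp
    then have "c 3 = 0" using u by simp
    moreover have "\<exists>i\<in>{0,1,2,3}. c i \<noteq> 0" using c(1) unfolding s[symmetric] by auto
    ultimately show False using H by auto
  qed
  have rel: "c 0 * l 0 y + c 1 * l 1 y + c 2 * l 2 y = 0" if y: "y \<in> S" for y
  proof -
    have "0 = (c 0 *\<^sub>R n 0 + c 1 *\<^sub>R n 1 + c 2 *\<^sub>R n 2 + c 3 *\<^sub>R u) \<bullet> (v - y)" unfolding c0 by simp
    also have "\<dots> = c 0 * l 0 y + c 1 * l 1 y + c 2 * l 2 y + c 3 * (u \<bullet> (v - y))"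
      by (simp add: lv inner_add_left)
    finally have e: "c 0 * l 0 y + c 1 * l 1 y + c 2 * l 2 y + c 3 * (u \<bullet> (v - y)) = 0" by simp
    show ?thesis
    proof (cases "u \<bullet> (y - v) = 0")
      case True
      then have "u \<bullet> (v - y) = 0" by (simp add: inner_diff_right)
      then show ?thesis using e by simp
    next
      case False
      \<comment> \<open>In this case all three normals are orthogonal to \<open>u\<close>, so
        pairing the relation with \<open>u\<close> leaves only \<open>c 3\<close> times the squared
        norm of \<open>u\<close>.\<close>
      then have nu: "n i \<bullet> u = 0" if "i < 3" for i using S(2)[OF y] nk[OF that] that by blast
      have "0 = (c 0 *\<^sub>R n 0 + c 1 *\<^sub>R n 1 + c 2 *\<^sub>R n 2 + c 3 *\<^sub>R u) \<bullet> u" unfolding c0 by simp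
      also have "\<dots> = c 3 * (u \<bullet> u)" by (simp add: inner_add_left nu)
      finally have "c 3 = 0" using u by simp
      then show ?thesis using e by simp
    qed
  qed
  have sub: "F j \<inter> S \<subseteq> F k" if "j < 3" "k < 3" "\<And>y. y \<in> S \<Longrightarrow> l j y = 0 \<Longrightarrow> l k y = 0" for j k
    using that lF S(1) by blast
  have nn: "0 \<le> l 0 y" "0 \<le> l 1 y" "0 \<le> l 2 y" if "y \<in> S" for y using that l0 S(1) by auto
  consider (bc) "0 \<le> c 1 * c 2" "c 1 \<noteq> 0 \<or> c 2 \<noteq> 0" | (ac) "0 \<le> c 0 * c 2" "c 0 \<noteq> 0 \<or> c 2 \<noteq> 0" | (ab) "0 \<le> c 0 * c 1" "c 0 \<noteq> 0 \<or> c 1 \<noteq> 0"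
    using same_sign_pair[OF rel[OF m(1)] lm lm lm nz] by auto
  then show ?thesis
  proof cases
    case bc
    show ?thesis
    proof (cases "c 1 = 0")
      case False
      have "l 1 y = 0" if "y \<in> S" "l 0 y = 0" for y
        by (rule same_sign_zero[of "c 1" _ "c 2" "l 2 y"]) (use that False bc rel[OF that(1)] nn[OF that(1)] in simp_all)
      then have "F 0 \<inter> S \<subseteq> F 1" by (intro sub) simp_all
      then show ?thesis by (intro exI[of _ 0] conjI exI[of _ 1]) auto
    next
      case True
      have "l 2 y = 0" if "y \<in> S" "l 0 y = 0" for y
        using that True bc rel[OF that(1)] by simp
      then have "F 0 \<inter> S \<subseteq> F 2" by (intro sub) simp_all
      then show ?thesis by (intro exI[of _ 0] conjI exI[of _ 2]) auto
    qed
  next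
    case ac
    show ?thesis
    proof (cases "c 0 = 0")
      case False
      have "l 0 y = 0" if "y \<in> S" "l 1 y = 0" for y
        by (rule same_sign_zero[of "c 0" _ "c 2" "l 2 y"]) (use that False ac rel[OF that(1)] nn[OF that(1)] in simp_all)
      then have "F 1 \<inter> S \<subseteq> F 0" by (intro sub) simp_all
      then show ?thesis by (intro exI[of _ 1] conjI exI[of _ 0]) auto
    next
      case True
      have "l 2 y = 0" if "y \<in> S" "l 1 y = 0" for y
        using that True ac rel[OF that(1)] by simp
      then have "F 1 \<inter> S \<subseteq> F 2" by (intro sub) simp_all
      then show ?thesis by (intro exI[of _ 1] conjI exI[of _ 2]) auto
    qed
  next
    case ab
    show ?thesis
    proof (cases "c 0 = 0")
      case False
      have "l 0 y = 0" if "y \<in> S" "l 2 y = 0" for y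
        by (rule same_sign_zero[of "c 0" _ "c 1" "l 1 y"]) (use that False ab rel[OF that(1)] nn[OF that(1)] in simp_all)
      then have "F 2 \<inter> S \<subseteq> F 0" by (intro sub) simp_all
      then show ?thesis by (intro exI[of _ 2] conjI exI[of _ 0]) auto
    next
      case True
      have "l 1 y = 0" if "y \<in> S" "l 2 y = 0" for y
        using that True ab rel[OF that(1)] by simp
      then have "F 2 \<inter> S \<subseteq> F 1" by (intro sub) simp_all
      then show ?thesis by (intro exI[of _ 2] conjI exI[of _ 1]) auto
    qed
  qed
qed

lemma card_2_if_no_three:
  assumes "finite A" "a \<in> A" "b \<in> A" "a \<noteq> b" "\<And>f. (\<And>i. i < 3 \<Longrightarrow> f i \<in> A) \<Longrightarrow> \<not> inj_on f {..<3::nat}"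
  shows "card A = 2"
proof -
  have "2 \<le> card A" using card_mono[of A "{a,b}"] assms by simp
  moreover have "\<not> 3 \<le> card A"
  proof
    assume "3 \<le> card A"
    then obtain B where B: "B \<subseteq> A" "card B = 3" using obtain_subset_with_card_n by metis
    then have "finite B" using assms(1) finite_subset by blast
    then obtain f where f: "bij_betw f {0..<3::nat} B" using ex_bij_betw_nat_finite B(2) by metis
    have "inj_on f {..<3}" using f by (simp add: bij_betw_def atLeast0LessThan)
    moreover have "f i \<in> A" if "i < 3" for i using f B(1) that by (auto simp: bij_betw_def)
    ultimately show False using assms(5) by blast
  qed
  ultimately show ?thesis by simp
qed

definition vertices_of :: "'a::euclidean_space set \<Rightarrow> 'a set" where
  "vertices_of F = {v. v extreme_point_of F}"

locale simplicial3 =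
  fixes P :: "(real^3) set"
  assumes poly: "polytope P" and dim_P: "aff_dim P = 3"
    and simplicial: "\<And>F. F face_of P \<Longrightarrow> F \<noteq> P \<Longrightarrow> \<exists>n. n simplex F"
begin

lemma polyhedron_P: "polyhedron P" by (rule polytope_imp_polyhedron[OF poly])

lemma convex_P: "convex P" by (rule polytope_imp_convex[OF poly])

definition facets :: "(real^3) set set" where
  "facets = {F. F facet_of P}"

lemma finite_facets: "finite facets"
  unfolding facets_def by (rule finite_polyhedron_facets[OF polyhedron_P])

lemma facet_face: "F \<in> facets \<Longrightarrow> F face_of P"
  unfolding facets_def by (simp add: facet_of_imp_face_of)

lemma facet_ne: "F \<in> facets \<Longrightarrow> F \<noteq> P"
  unfolding facets_def by (auto simp: facet_of_def)

lemma facet_dim: "F \<in> facets \<Longrightarrow> aff_dim F = 2"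
  unfolding facets_def by (simp add: facet_of_def dim_P)

lemma facet_interior: "F \<in> facets \<Longrightarrow> F \<inter> interior P = {}"
  by (rule face_of_disjoint_interior[OF facet_face facet_ne])

lemma interior_nonempty: "interior P \<noteq> {}"
proof -
  have "P \<noteq> {}" using dim_P by auto
  then have "rel_interior P \<noteq> {}" using rel_interior_eq_empty[OF convex_P] by blast
  then show ?thesis using interior_rel_interior_gen[of P] dim_P by simp
qed

lemma frontier_facets: "frontier P = \<Union>facets"
  using rel_frontier_of_polyhedron[OF polyhedron_P] rel_frontier_nonempty_interior[OF interior_nonempty]
  unfolding facets_def by simp

lemma facet_simplex:
  assumes "F \<in> facets"
  shows "\<not> affine_dependent (vertices_of F)" "card (vertices_of F) = 3" "finite (vertices_of F)" "F = convex hull (vertices_of F)"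
proof -
  obtain n where "n simplex F" using simplicial[OF facet_face[OF assms] facet_ne[OF assms]] by blast
  then obtain C where C: "\<not> affine_dependent C" "int (card C) = n + 1" "F = convex hull C" unfolding simplex by blast
  have v: "vertices_of F = C"
    unfolding vertices_of_def C(3) using extreme_point_of_convex_hull_affine_independent[OF C(1)] by auto
  show "\<not> affine_dependent (vertices_of F)" "F = convex hull (vertices_of F)" using C v by simp_all
  have "aff_dim C = 2" using facet_dim[OF assms] C(3) by (simp add: aff_dim_convex_hull)
  then have "card C = 3" using aff_dim_affine_independent[OF C(1)] by simp
  then show "card (vertices_of F) = 3" "finite (vertices_of F)" using v by (simp_all add: card_ge_0_finite)
qed

lemma facet_vertices: "F \<in> facets \<Longrightarrow> vertices_of F = vertices_of P \<inter> F"
  unfolding vertices_of_def using extreme_point_of_face[OF facet_face] by blast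

lemma finite_vertices: "finite (vertices_of P)"
  unfolding vertices_of_def by (rule finite_polyhedron_extreme_points[OF polyhedron_P])

lemma facet_subset_eq:
  assumes "F \<in> facets" "F' \<in> facets" "F \<subseteq> F'" shows "F = F'"
proof (rule ccontr)
  assume "F \<noteq> F'"
  moreover have "F face_of F'" using facet_face[OF assms(1)] facet_face[OF assms(2)] assms(3) face_of_face by blast
  ultimately have "aff_dim F < aff_dim F'"
    using face_of_aff_dim_lt[OF face_of_imp_convex[OF facet_face[OF assms(2)]]] by blast
  then show False using facet_dim assms by simp
qed

lemma facet_eq_if_vertices:
  assumes "F \<in> facets" "F' \<in> facets" "vertices_of F \<subseteq> F'" shows "F = F'"
proof (rule facet_subset_eq[OF assms(1,2)])
  have "convex hull (vertices_of F) \<subseteq> F'"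
    by (rule hull_minimal) (use assms face_of_imp_convex facet_face in auto)
  then show "F \<subseteq> F'" using facet_simplex(4)[OF assms(1)] by simp
qed

lemma facet_face_of_vertices:
  assumes "F \<in> facets" "A \<subseteq> vertices_of F" shows "convex hull A face_of P"
proof -
  have "convex hull A face_of convex hull (vertices_of F)"
    unfolding face_of_convex_hull_affine_independent[OF facet_simplex(1)[OF assms(1)]] using assms(2) by blast
  then show ?thesis using facet_simplex(4)[OF assms(1)] facet_face[OF assms(1)] face_of_trans by metis
qed

text \<open>A proper face is the intersection of the facets containing it, so a single facet would
  make the edge two-dimensional. Three facets through the edge have normals orthogonal to it;
  \<open>three_facets\<close> with \<open>S = P\<close> then puts one of them inside
  another.\<close>

lemma two_facets_at_edge:
  assumes F: "F \<in> facets" and ab: "a \<in> vertices_of F" "b \<in> vertices_of F" "a \<noteq> b"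
  shows "card {G \<in> facets. a \<in> G \<and> b \<in> G} = 2"
proof -
  let ?R = "convex hull {a,b}" and ?A = "{G \<in> facets. a \<in> G \<and> b \<in> G}"
  have R: "?R face_of P" by (rule facet_face_of_vertices[OF F]) (use ab in auto)
  have dR: "aff_dim ?R = 1" using ab(3) by (simp add: aff_dim_convex_hull)
  have RP: "?R \<noteq> P" using dR dim_P by auto
  have sub: "?R \<subseteq> G \<longleftrightarrow> a \<in> G \<and> b \<in> G" if "G \<in> facets" for G
  proof
    assume "?R \<subseteq> G" then show "a \<in> G \<and> b \<in> G" using hull_subset[of "{a,b}" convex] by blast
  next
    assume "a \<in> G \<and> b \<in> G"
    then show "?R \<subseteq> G" using face_of_imp_convex[OF facet_face[OF that]] by (intro hull_minimal) auto
  qed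
  have "?R = \<Inter>{G. G facet_of P \<and> ?R \<subseteq> G}"
    by (rule face_of_polyhedron[OF polyhedron_P R _ RP]) simp
  also have "{G. G facet_of P \<and> ?R \<subseteq> G} = ?A" using sub by (auto simp: facets_def)
  finally have RA: "?R = \<Inter>?A" .
  have FA: "F \<in> ?A" using F ab by (auto simp: vertices_of_def extreme_point_of_def)
  have "?A \<noteq> {F}"
  proof
    assume A: "?A = {F}"
    have "?R = F" using RA unfolding A by simp
    then show False using dR facet_dim[OF F] by simp
  qed
  then obtain G where G: "G \<in> ?A" "G \<noteq> F" using FA by blast
  show ?thesis
  proof (rule card_2_if_no_three[OF _ FA G(1)])
    show "finite ?A" using finite_facets by simp
    show "F \<noteq> G" using G by simp
    fix f :: "nat \<Rightarrow> (real^3) set" assume f: "\<And>i. i < 3 \<Longrightarrow> f i \<in> ?A"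
    show "\<not> inj_on f {..<3}"
    proof
      assume inj: "inj_on f {..<3}"
      obtain m where m: "m \<in> interior P" using interior_nonempty by blast
      have "\<exists>j<3. \<exists>k<3. j \<noteq> k \<and> f j \<inter> P \<subseteq> f k"
      proof (rule three_facets[OF polyhedron_P, where v = a and u = "b - a" and m = m])
        show "f i facet_of P" "a \<in> f i" if "i < 3" for i using f[OF that] by (auto simp: facets_def)
        show "b - a \<noteq> 0" using ab by simp
        have "n \<bullet> (b - a) = 0" if "i < 3" "f i = P \<inter> {x. n \<bullet> x = k}" for i n k
        proof -
          have "a \<in> f i" "b \<in> f i" using f[OF that(1)] by auto
          then show ?thesis unfolding that(2) by (simp add: inner_diff_right)
        qed
        then show "(b - a) \<bullet> (y - a) = 0 \<or> (\<forall>i<3. \<forall>n k. f i = P \<inter> {x. n \<bullet> x = k} \<longrightarrow> n \<bullet> (b - a) = 0)" for y by blast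
      qed (use m interior_subset in auto)
      then obtain j k where jk: "j < 3" "k < 3" "j \<noteq> k" "f j \<inter> P \<subseteq> f k" by blast
      have "f j \<subseteq> P" using f[OF jk(1)] facet_face face_of_imp_subset by blast
      then have "f j = f k" using facet_subset_eq[of "f j" "f k"] f[OF jk(1)] f[OF jk(2)] jk(4) by auto
      then show False using inj jk by (auto dest: inj_onD)
    qed
  qed
qed

text \<open>Counting middle vertices with respect to a generic height function takes the place of Euler's formula: the edges at
  \<open>v\<close> of the polygon cut out at the height of \<open>v\<close> correspond to the facets with middle vertex \<open>v\<close>.\<close>

definition middle :: "real^3 \<Rightarrow> (real^3) set \<Rightarrow> real^3 \<Rightarrow> bool" where
  "middle u F v \<longleftrightarrow> v \<in> vertices_of F \<and> (\<exists>s\<in>vertices_of F. \<exists>t\<in>vertices_of F. u \<bullet> s < u \<bullet> v \<and> u \<bullet> v < u \<bullet> t)"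

lemma middle_unique:
  assumes u: "\<And>v w. v \<in> vertices_of P \<Longrightarrow> w \<in> vertices_of P \<Longrightarrow> v \<noteq> w \<Longrightarrow> u \<bullet> v \<noteq> u \<bullet> w" and F: "F \<in> facets"
  shows "\<exists>!v. middle u F v"
proof -
  obtain x y z where V: "vertices_of F = {x,y,z}" "x \<noteq> y" "x \<noteq> z" "y \<noteq> z"
    using facet_simplex(2)[OF F] card_3_iff by metis
  have ne: "u \<bullet> x \<noteq> u \<bullet> y" "u \<bullet> x \<noteq> u \<bullet> z" "u \<bullet> y \<noteq> u \<bullet> z"
    using u V facet_vertices[OF F] by auto
  have m: "middle u F v \<longleftrightarrow> v \<in> {x,y,z} \<and> (u \<bullet> x < u \<bullet> v \<or> u \<bullet> y < u \<bullet> v \<or> u \<bullet> z < u \<bullet> v) \<and>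
     (u \<bullet> v < u \<bullet> x \<or> u \<bullet> v < u \<bullet> y \<or> u \<bullet> v < u \<bullet> z)" for v
    unfolding middle_def V by auto
  consider "u \<bullet> x < u \<bullet> y \<and> u \<bullet> y < u \<bullet> z \<or> u \<bullet> z < u \<bullet> y \<and> u \<bullet> y < u \<bullet> x"
    | "u \<bullet> y < u \<bullet> x \<and> u \<bullet> x < u \<bullet> z \<or> u \<bullet> z < u \<bullet> x \<and> u \<bullet> x < u \<bullet> y"
    | "u \<bullet> x < u \<bullet> z \<and> u \<bullet> z < u \<bullet> y \<or> u \<bullet> y < u \<bullet> z \<and> u \<bullet> z < u \<bullet> x"
    using ne by linarith
  then show ?thesis
  proof cases
    case 1 then show ?thesis unfolding m by (intro ex1I[of _ y]) auto
  next
    case 2 then show ?thesis unfolding m by (intro ex1I[of _ x]) auto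
  next
    case 3 then show ?thesis unfolding m by (intro ex1I[of _ z]) auto
  qed
qed

text \<open>Such a vertex is the lowest or the highest of its facet, so the plane at its height
  supports the facet, and by genericity it contains no other vertex. The sign of \<open>c\<close>
  treats both cases at once.\<close>

lemma not_middle_slice:
  assumes u: "\<And>v w. v \<in> vertices_of P \<Longrightarrow> w \<in> vertices_of P \<Longrightarrow> v \<noteq> w \<Longrightarrow> u \<bullet> v \<noteq> u \<bullet> w" and F: "F \<in> facets"
    and v: "v \<in> vertices_of F" "\<not> middle u F v" and y: "y \<in> F" "u \<bullet> y = u \<bullet> v"
  shows "y = v"
proof -
  have uv: "u \<bullet> w = u \<bullet> v \<longleftrightarrow> w = v" if "w \<in> vertices_of F" for w
    using u[of w v] that v(1) facet_vertices[OF F] by auto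
  have "(\<forall>w\<in>vertices_of F. u \<bullet> v \<le> u \<bullet> w) \<or> (\<forall>w\<in>vertices_of F. u \<bullet> w \<le> u \<bullet> v)"
    using v unfolding middle_def by (meson not_le)
  then obtain c :: real where c: "c \<noteq> 0" "\<And>w. w \<in> vertices_of F \<Longrightarrow> 0 \<le> c * (u \<bullet> w - u \<bullet> v)"
  proof (elim disjE)
    assume "\<forall>w\<in>vertices_of F. u \<bullet> v \<le> u \<bullet> w" then show ?thesis using that[of 1] by simp
  next
    assume "\<forall>w\<in>vertices_of F. u \<bullet> w \<le> u \<bullet> v" then show ?thesis using that[of "-1"] by simp
  qed
  define f where "f x = c * (u \<bullet> x - u \<bullet> v)" for x
  have aff: "affine_fun f" by (rule affine_funI[where n = "c *\<^sub>R u" and k = "- c * (u \<bullet> v)"]) (simp add: f_def algebra_simps)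
  have "convex hull (vertices_of F) \<inter> {x. f x = 0} = convex hull {w \<in> vertices_of F. f w = 0}"
    by (rule exposed_hull_face(1)[OF facet_simplex(3)[OF F] aff]) (use c(2) in \<open>simp add: f_def\<close>)
  moreover have "{w \<in> vertices_of F. f w = 0} = {v}" using uv c(1) v(1) by (auto simp: f_def)
  moreover have "y \<in> convex hull (vertices_of F) \<inter> {x. f x = 0}"
    using y facet_simplex(4)[OF F] by (simp add: f_def)
  ultimately show ?thesis by simp
qed

text \<open>In the polygon \<open>Q\<close> at the height of \<open>v\<close>, the vertex
  \<open>v\<close> is the intersection of the edges through it, so there are at least two, and each
  comes from a facet with middle vertex \<open>v\<close>. Three such facets are excluded by
  \<open>three_facets\<close> with \<open>S = Q\<close>.\<close>

lemma two_facets_at_middle: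
  assumes u: "\<And>v w. v \<in> vertices_of P \<Longrightarrow> w \<in> vertices_of P \<Longrightarrow> v \<noteq> w \<Longrightarrow> u \<bullet> v \<noteq> u \<bullet> w"
    and v: "v \<in> vertices_of P" and w: "w1 \<in> P" "u \<bullet> w1 < u \<bullet> v" "w2 \<in> P" "u \<bullet> v < u \<bullet> w2"
  shows "card {F \<in> facets. middle u F v} = 2"
proof -
  let ?A = "{F \<in> facets. middle u F v}"
  define H where "H = {x. u \<bullet> x = u \<bullet> v}"
  have u0: "u \<noteq> 0" using w by auto
  obtain m where m: "m \<in> interior P" "m \<in> H"
  proof -
    obtain m0 where m0: "m0 \<in> interior P" using interior_nonempty by blast
    \<comment> \<open>An interior point off the plane is joined with a point of \<open>P\<close>
      beyond the plane; the open segment is interior to \<open>P\<close> and crosses the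
      plane.\<close>
    have cross: "\<exists>m. m \<in> interior P \<and> m \<in> H" if w': "w' \<in> P" "(u \<bullet> m0 - u \<bullet> v) * (u \<bullet> w' - u \<bullet> v) < 0" for w'
    proof -
      define a where "a = u \<bullet> m0 - u \<bullet> v"
      define b where "b = u \<bullet> w' - u \<bullet> v"
      have ab: "a * b < 0" using w'(2) by (simp add: a_def b_def)
      define t where "t = a / (a - b)"
      have t: "0 < t" "t < 1" using ab unfolding t_def by (auto simp: mult_less_0_iff field_simps)
      have "m0 \<noteq> w'" using ab by (auto simp: a_def b_def mult_less_0_iff)
      then have "(1 - t) *\<^sub>R m0 + t *\<^sub>R w' \<in> open_segment m0 w'" using t by (auto simp: in_segment)
      moreover have "open_segment m0 w' \<subseteq> interior P"
        using in_interior_closure_convex_segment[OF convex_P m0] w'(1) closure_subset by blast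
      moreover have "u \<bullet> ((1 - t) *\<^sub>R m0 + t *\<^sub>R w') = u \<bullet> v"
      proof -
        have "u \<bullet> ((1 - t) *\<^sub>R m0 + t *\<^sub>R w') - u \<bullet> v = (1 - t) * a + t * b"
          by (simp add: a_def b_def inner_add_right algebra_simps)
        also have "\<dots> = a - t * (a - b)" by (simp add: algebra_simps)
        also have "\<dots> = 0" using ab unfolding t_def by (auto simp: mult_less_0_iff)
        finally show ?thesis by simp
      qed
      ultimately show ?thesis unfolding H_def by blast
    qed
    consider "u \<bullet> m0 = u \<bullet> v" | "u \<bullet> m0 < u \<bullet> v" | "u \<bullet> m0 > u \<bullet> v" by linarith
    then have "\<exists>m. m \<in> interior P \<and> m \<in> H"
    proof cases
      case 1 then show ?thesis using m0 by (auto simp: H_def)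
    next
      case 2 show ?thesis by (rule cross[OF w(3)]) (use 2 w(4) in \<open>simp add: mult_neg_pos\<close>)
    next
      case 3 show ?thesis by (rule cross[OF w(1)]) (use 3 w(2) in \<open>simp add: mult_pos_neg\<close>)
    qed
    then show thesis using that by blast
  qed
  define Q where "Q = P \<inter> H"
  have Qpoly: "polytope Q" unfolding Q_def H_def by (rule polytope_Int_polyhedron[OF poly polyhedron_hyperplane])
  have cH: "convex H" unfolding H_def by (rule convex_hyperplane)
  have Qdim: "aff_dim Q = 2"
  proof -
    have "aff_dim (H \<inter> P) = aff_dim H" by (rule aff_dim_convex_Int_nonempty_interior[OF cH]) (use m in auto)
    then show ?thesis using u0 by (simp add: Q_def H_def Int_commute)
  qed
  have vP: "v \<in> P" "{v} face_of P" using v by (auto simp: vertices_of_def face_of_singleton extreme_point_of_def)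
  have vQ: "{v} face_of Q"
    using face_of_slice[OF vP(2) cH] by (simp add: Q_def H_def)
  have relQ: "x \<in> rel_interior Q" if "x \<in> interior P" "x \<in> H" for x
  proof -
    have aH: "affine hull Q \<subseteq> H" unfolding Q_def by (rule hull_minimal) (auto simp: H_def affine_hyperplane)
    show ?thesis unfolding mem_rel_interior
      by (rule exI[of _ "interior P"]) (use that aH interior_subset in \<open>auto simp: Q_def\<close>)
  qed
  have slice: "F \<inter> H face_of Q \<and> F \<inter> H \<noteq> Q" if "F \<in> facets" for F
    using face_of_slice[OF facet_face[OF that] cH] facet_interior[OF that] m interior_subset[of P] by (auto simp: Q_def)
  \<comment> \<open>A relative interior point of \<open>E\<close> lies on the frontier of
    \<open>P\<close>, hence in a facet \<open>F\<close>. A proper face of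
    \<open>F \<inter> H\<close> would have dimension less than 1, so \<open>E\<close> is all of
    \<open>F \<inter> H\<close>; if \<open>v\<close> were not the middle of \<open>F\<close>, this
    slice would be a single point.\<close>
  have from_edge: "\<exists>F\<in>?A. E = F \<inter> H" if E: "E facet_of Q" "v \<in> E" for E
  proof -
    have Ef: "E face_of Q" "E \<noteq> Q" using E(1) by (auto simp: facet_of_def)
    have "rel_interior E \<noteq> {}" using rel_interior_eq_empty[OF face_of_imp_convex[OF Ef(1)]] E(2) by blast
    then obtain x where x: "x \<in> rel_interior E" by blast
    have xE: "x \<in> E" using x rel_interior_subset by blast
    then have xQ: "x \<in> P" "x \<in> H" using face_of_imp_subset[OF Ef(1)] by (auto simp: Q_def)
    have "x \<notin> interior P" using relQ[OF _ xQ(2)] face_of_disjoint_rel_interior[OF Ef] xE by blast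
    then have "x \<in> frontier P" using xQ(1) closure_subset by (auto simp: frontier_def)
    then obtain F where F: "F \<in> facets" "x \<in> F" using frontier_facets by blast
    have "E \<subseteq> F \<inter> H"
      by (rule subset_of_face_of[OF conjunct1[OF slice[OF F(1)]] face_of_imp_subset[OF Ef(1)]]) (use x F(2) xQ in auto)
    moreover have "E = F \<inter> H"
    proof (rule ccontr)
      assume ne: "E \<noteq> F \<inter> H"
      have "E face_of F \<inter> H" using face_of_subset[OF Ef(1) \<open>E \<subseteq> F \<inter> H\<close>] slice[OF F(1)] face_of_imp_subset by blast
      then have "aff_dim E < aff_dim (F \<inter> H)"
        using ne face_of_imp_convex slice[OF F(1)] by (intro face_of_aff_dim_lt) blast+
      moreover have "aff_dim (F \<inter> H) < aff_dim Q"
        using slice[OF F(1)] polytope_imp_convex[OF Qpoly] by (intro face_of_aff_dim_lt) blast+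
      ultimately show False using E(1) by (simp add: facet_of_def)
    qed
    moreover have "middle u F v"
    proof (rule ccontr)
      assume nm: "\<not> middle u F v"
      have vF: "v \<in> vertices_of F" using E(2) v \<open>E \<subseteq> F \<inter> H\<close> facet_vertices[OF F(1)] by blast
      have "E \<subseteq> {v}"
      proof
        fix y assume "y \<in> E"
        then have "y \<in> F" "u \<bullet> y = u \<bullet> v" using \<open>E \<subseteq> F \<inter> H\<close> by (auto simp: H_def)
        then show "y \<in> {v}" using not_middle_slice[OF u F(1) vF nm] by blast
      qed
      then have "E = {v}" using E(2) by blast
      then show False using E(1) Qdim by (simp add: facet_of_def)
    qed
    ultimately show ?thesis using F(1) by blast
  qed
  have int: "{v} = \<Inter>{E. E facet_of Q \<and> {v} \<subseteq> E}"
    by (rule face_of_polyhedron[OF polytope_imp_polyhedron[OF Qpoly] vQ]) (use Qdim in auto)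
  have "{E. E facet_of Q \<and> {v} \<subseteq> E} \<noteq> {}"
  proof
    assume "{E. E facet_of Q \<and> {v} \<subseteq> E} = {}"
    then have "{v} = \<Inter>{}" using int by (metis (no_types, lifting))
    moreover have "w1 \<notin> {v}" using w by auto
    ultimately show False by blast
  qed
  then obtain E1 where E1: "E1 facet_of Q" "v \<in> E1" by blast
  have "\<exists>E2. E2 facet_of Q \<and> v \<in> E2 \<and> E2 \<noteq> E1"
  proof (rule ccontr)
    assume "\<not> ?thesis"
    then have "{E. E facet_of Q \<and> {v} \<subseteq> E} = {E1}" using E1 by blast
    then have "{v} = E1" using int by simp
    then show False using E1(1) Qdim by (auto simp: facet_of_def)
  qed
  then obtain E2 where E2: "E2 facet_of Q" "v \<in> E2" "E2 \<noteq> E1" by blast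
  obtain F1 F2 where F12: "F1 \<in> ?A" "F2 \<in> ?A" "E1 = F1 \<inter> H" "E2 = F2 \<inter> H" using from_edge[OF E1] from_edge[OF E2(1,2)] by blast
  show ?thesis
  proof (rule card_2_if_no_three[OF _ F12(1,2)])
    show "finite ?A" using finite_facets by simp
    show "F1 \<noteq> F2" using F12 E2(3) by blast
    fix f :: "nat \<Rightarrow> (real^3) set" assume f: "\<And>i. i < 3 \<Longrightarrow> f i \<in> ?A"
    show "\<not> inj_on f {..<3}"
    proof
      assume inj: "inj_on f {..<3}"
      have "\<exists>j<3. \<exists>k<3. j \<noteq> k \<and> f j \<inter> Q \<subseteq> f k"
      proof (rule three_facets[OF polyhedron_P, where v = v and u = u and m = m])
        show "f i facet_of P" if "i < 3" for i using f[OF that] by (auto simp: facets_def)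
        show "v \<in> f i" if "i < 3" for i using f[OF that] by (auto simp: middle_def vertices_of_def extreme_point_of_def)
        show "u \<bullet> (y - v) = 0 \<or> (\<forall>i<3. \<forall>n k. f i = P \<inter> {x. n \<bullet> x = k} \<longrightarrow> n \<bullet> u = 0)" if "y \<in> Q" for y
          using that by (simp add: Q_def H_def inner_diff_right)
      qed (use m interior_subset u0 in \<open>auto simp: Q_def\<close>)
      then obtain j k where jk: "j < 3" "k < 3" "j \<noteq> k" "f j \<inter> Q \<subseteq> f k" by blast
      have fj: "f j \<in> facets" "f k \<in> facets" "middle u (f j) v" "middle u (f k) v" using f jk by auto
      \<comment> \<open>The side of \<open>f j\<close> from \<open>s\<close> to \<open>t\<close>
        crosses the plane in a point of \<open>Q\<close>. Thus \<open>f k\<close> contains an inner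
        point of this side, hence \<open>s\<close> and \<open>t\<close>, and with \<open>v\<close>
        all vertices of \<open>f j\<close>.\<close>
      obtain s t where st: "s \<in> vertices_of (f j)" "t \<in> vertices_of (f j)" "u \<bullet> s < u \<bullet> v" "u \<bullet> v < u \<bullet> t"
        using fj(3) unfolding middle_def by blast
      have stP: "s \<in> P" "t \<in> P" "s \<in> f j" "t \<in> f j"
        using st facet_vertices[OF fj(1)] by (auto simp: vertices_of_def extreme_point_of_def)
      define a where "a = (u \<bullet> v - u \<bullet> s) / (u \<bullet> t - u \<bullet> s)"
      have a: "0 < a" "a < 1" using st unfolding a_def by (auto simp: field_simps)
      define x where "x = (1 - a) *\<^sub>R s + a *\<^sub>R t"
      have "s \<noteq> t" using st by auto
      then have xs: "x \<in> open_segment s t" using a by (auto simp: in_segment x_def)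
      have "u \<bullet> x = u \<bullet> s + a * (u \<bullet> t - u \<bullet> s)" by (simp add: x_def inner_add_right algebra_simps)
      also have "\<dots> = u \<bullet> v" using st by (simp add: a_def)
      finally have xH: "x \<in> H" by (simp add: H_def)
      have "x \<in> f j" using xs stP(3,4) face_of_imp_convex[OF facet_face[OF fj(1)]]
        by (meson convex_contains_open_segment subsetD)
      moreover from this have "x \<in> P" using face_of_imp_subset[OF facet_face[OF fj(1)]] by blast
      ultimately have "x \<in> f k" using jk(4) xH by (auto simp: Q_def)
      then have "s \<in> f k" "t \<in> f k" using face_ofD[OF facet_face[OF fj(2)] xs stP(1,2)] by auto
      moreover have "v \<in> f k" using fj(4) by (auto simp: middle_def vertices_of_def extreme_point_of_def)
      moreover have "vertices_of (f j) = {v,s,t}"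
      proof (rule sym, rule card_subset_eq[OF facet_simplex(3)[OF fj(1)]])
        show "{v,s,t} \<subseteq> vertices_of (f j)" using st fj(3) by (auto simp: middle_def)
        have "v \<noteq> s" "v \<noteq> t" "s \<noteq> t" using st by auto
        then show "card {v,s,t} = card (vertices_of (f j))" using facet_simplex(2)[OF fj(1)] by simp
      qed
      ultimately have "f j = f k" using facet_eq_if_vertices[OF fj(1,2)] by simp
      then show False using inj jk by (auto dest: inj_onD)
    qed
  qed
qed

text \<open>The highest and the lowest vertex are the middle of no facet, which accounts for the
  subtraction of 2.\<close>

lemma card_facets: "int (card facets) = 2 * (int (card (vertices_of P)) - 2)"
proof -
  let ?V = "vertices_of P"
  obtain u where u: "\<And>v w. v \<in> ?V \<Longrightarrow> w \<in> ?V \<Longrightarrow> v \<noteq> w \<Longrightarrow> u \<bullet> v \<noteq> u \<bullet> w"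
    using exists_separating_direction[OF finite_vertices] by blast
  obtain F0 where F0: "F0 \<in> facets" using polytope_facet_exists[OF poly] dim_P by (auto simp: facets_def)
  have V3: "3 \<le> card ?V"
    using card_mono[OF finite_vertices, of "vertices_of F0"] facet_simplex(2)[OF F0] facet_vertices[OF F0] by simp
  then have ne: "?V \<noteq> {}" by auto
  define t b where "t = arg_min_on (\<lambda>x. - (u \<bullet> x)) ?V" and "b = arg_min_on (\<lambda>x. u \<bullet> x) ?V"
  have t: "t \<in> ?V" "\<And>w. w \<in> ?V \<Longrightarrow> u \<bullet> w \<le> u \<bullet> t"
    using arg_min_if_finite[OF finite_vertices ne, of "\<lambda>x. - (u \<bullet> x)"] unfolding t_def by (auto simp: not_less)
  have b: "b \<in> ?V" "\<And>w. w \<in> ?V \<Longrightarrow> u \<bullet> b \<le> u \<bullet> w"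
    using arg_min_if_finite[OF finite_vertices ne, of "\<lambda>x. u \<bullet> x"] unfolding b_def by (auto simp: not_less)
  have tb: "t \<noteq> b"
  proof
    assume "t = b"
    then have "w = t" if "w \<in> ?V" for w using u[OF that t(1)] t(2)[OF that] b(2)[OF that] by force
    then have "?V \<subseteq> {t}" by blast
    then have "card ?V \<le> 1" using card_mono[of "{t}" ?V] by simp
    then show False using V3 by simp
  qed
  define V' where "V' = ?V - {t,b}"
  define mid where "mid F = (THE v. middle u F v)" for F
  have mid: "middle u F v \<longleftrightarrow> mid F = v" if "F \<in> facets" for F v
    using middle_unique[OF u that] unfolding mid_def by (metis the1_equality theI')
  have "mid ` facets \<subseteq> V'"
  proof
    fix v assume "v \<in> mid ` facets"
    then obtain F where F: "F \<in> facets" "middle u F v" using mid by auto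
    then obtain x y where xy: "x \<in> ?V" "y \<in> ?V" "u \<bullet> x < u \<bullet> v" "u \<bullet> v < u \<bullet> y" "v \<in> ?V"
      using facet_vertices[OF F(1)] unfolding middle_def by blast
    then have "v \<noteq> t" "v \<noteq> b" using t(2)[of y] b(2)[of x] by auto
    then show "v \<in> V'" using xy by (simp add: V'_def)
  qed
  then have "(\<Sum>v\<in>V'. \<Sum>F\<in>{F \<in> facets. mid F = v}. 1) = (\<Sum>F\<in>facets. (1::nat))"
    using finite_vertices finite_facets by (intro sum.group) (auto simp: V'_def)
  then have "card facets = (\<Sum>v\<in>V'. card {F \<in> facets. mid F = v})" by simp
  also have "\<dots> = (\<Sum>v\<in>V'. 2)"
  proof (rule sum.cong[OF refl])
    fix v assume v: "v \<in> V'"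
    have lt: "u \<bullet> b < u \<bullet> v" "u \<bullet> v < u \<bullet> t"
      using v b(2)[of v] t(2)[of v] u[of v b] u[of v t] b(1) t(1) unfolding V'_def by force+
    have "{F \<in> facets. mid F = v} = {F \<in> facets. middle u F v}" using mid by auto
    then show "card {F \<in> facets. mid F = v} = 2"
      using two_facets_at_middle[OF u _ _ lt(1) _ lt(2)] v t(1) b(1)
      by (auto simp: V'_def vertices_of_def extreme_point_of_def)
  qed
  also have "\<dots> = 2 * card V'" by simp
  also have "card V' = card ?V - 2" using tb t(1) b(1) finite_vertices by (simp add: V'_def card_Diff_subset)
  finally show ?thesis using V3 by simp
qed

end

section \<open>The fan of tetrahedra over the facets\<close>

text \<open>If \<open>s < s'\<close>, then \<open>f'\<close> lies strictly between \<open>p\<close>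
  and \<open>f\<close>, and such points are interior to \<open>P\<close>.\<close>

lemma ray_meets_frontier_once:
  fixes P :: "'a::euclidean_space set"
  assumes P: "convex P" and p: "p \<in> interior P" and f: "f \<in> P" "f' \<in> P" "f' \<notin> interior P"
    and s: "0 < s" "s \<le> s'" and eq: "s *\<^sub>R (f - p) = s' *\<^sub>R (f' - p)"
  shows "s = s' \<and> f = f'"
proof (cases "s = s'")
  case True
  then show ?thesis using eq s(1) by simp
next
  case False
  have s': "0 < s'" using s by simp
  have "f' - p = (s / s') *\<^sub>R (f - p)"
  proof -
    have "(s / s') *\<^sub>R (f - p) = (1 / s') *\<^sub>R (s *\<^sub>R (f - p))" by simp
    also have "\<dots> = f' - p" unfolding eq using s' by simp
    finally show ?thesis by simp
  qed
  then have f': "f' = (1 - s / s') *\<^sub>R p + (s / s') *\<^sub>R f" by (simp add: algebra_simps)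
  have "0 < s / s'" "s / s' < 1" using s s' False by simp_all
  moreover have "p \<noteq> f"
  proof
    assume "p = f"
    then have "f' = p" using f' by (simp add: algebra_simps)
    then show False using p f(3) by simp
  qed
  ultimately have "f' \<in> open_segment p f" unfolding in_segment f' by blast
  moreover have "open_segment p f \<subseteq> interior P"
    using in_interior_closure_convex_segment[OF P p] f(1) closure_subset by blast
  ultimately show ?thesis using f(3) by blast
qed

locale balanced3 = simplicial3 +
  fixes col :: "real^3 \<Rightarrow> nat" and p :: "real^3"
  assumes col_lt: "\<And>v. v \<in> vertices_of P \<Longrightarrow> col v < 3"
    and col_edge: "\<And>v w. closed_segment v w edge_of P \<Longrightarrow> col v \<noteq> col w"
    and p_in: "p \<in> interior P"
begin

text \<open>Any two vertices of a facet span an edge of \<open>P\<close>, because the facet is a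
  simplex; so its vertices have three different colours.\<close>

lemma col_bij: assumes "F \<in> facets" shows "bij_betw col (vertices_of F) {..<3}"
proof -
  have inj: "inj_on col (vertices_of F)"
  proof (rule inj_onI, rule ccontr)
    fix v w assume vw: "v \<in> vertices_of F" "w \<in> vertices_of F" "col v = col w" "v \<noteq> w"
    have "convex hull {v,w} face_of P" by (rule facet_face_of_vertices[OF assms]) (use vw in auto)
    moreover have "aff_dim (convex hull {v,w}) = 1" using vw(4) by (simp add: aff_dim_convex_hull)
    ultimately have "closed_segment v w edge_of P" by (simp add: edge_of_def segment_convex_hull)
    then show False using col_edge vw(3) by blast
  qed
  have "col ` vertices_of F \<subseteq> {..<3}" using col_lt facet_vertices[OF assms] by auto
  moreover have "card (col ` vertices_of F) = card {..<3::nat}" using card_image[OF inj] facet_simplex(2)[OF assms] by simp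
  ultimately have "col ` vertices_of F = {..<3}" by (intro card_subset_eq) auto
  then show ?thesis using inj by (simp add: bij_betw_def)
qed

text \<open>Index 0 is the cone point, and \<open>i > 0\<close> is the vertex of colour
  \<open>i - 1\<close>. Indexing by colour gives a common vertex of two facets the same index in
  both.\<close>

definition corner :: "(real^3) set \<Rightarrow> nat \<Rightarrow> real^3" where
  "corner F i = (if i = 0 then p else the_inv_into (vertices_of F) col (i - 1))"

lemma corner_zero [simp]: "corner F 0 = p" by (simp add: corner_def)

lemma corner_Suc:
  assumes "F \<in> facets" "i < 3"
  shows "corner F (Suc i) \<in> vertices_of F" "col (corner F (Suc i)) = i"
proof -
  have "bij_betw col (vertices_of F) {..<3}" by (rule col_bij[OF assms(1)])
  then have "inj_on col (vertices_of F)" "i \<in> col ` vertices_of F" using assms(2) by (auto simp: bij_betw_def)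
  then show "corner F (Suc i) \<in> vertices_of F" "col (corner F (Suc i)) = i"
    unfolding corner_def using the_inv_into_into[of col "vertices_of F" i] f_the_inv_into_f[of col "vertices_of F" i] by auto
qed

lemma corner_col:
  assumes "F \<in> facets" "w \<in> vertices_of F" shows "corner F (Suc (col w)) = w" "col w < 3"
proof -
  have "bij_betw col (vertices_of F) {..<3}" by (rule col_bij[OF assms(1)])
  then show "corner F (Suc (col w)) = w" "col w < 3" unfolding corner_def using assms(2)
    by (auto simp: bij_betw_def the_inv_into_f_f)
qed

lemma corner_image:
  assumes F: "F \<in> facets" shows "corner F ` {1,2,3} = vertices_of F" "corner F ` {..<4} = insert p (vertices_of F)"
proof -
  have s: "{1,2,3} = Suc ` {..<3}" by (auto simp: image_iff)
  show 1: "corner F ` {1,2,3} = vertices_of F"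
    unfolding s image_image using corner_Suc[OF F] corner_col[OF F] by (auto simp: image_iff) (metis lessThan_iff)
  have "{..<4::nat} = insert 0 {1,2,3}" by auto
  then show "corner F ` {..<4} = insert p (vertices_of F)" using 1 by simp
qed

lemma facet_eq_corner_hull: "F \<in> facets \<Longrightarrow> F = convex hull (corner F ` {1,2,3})"
  using facet_simplex(4) corner_image(1) by metis

lemma p_notin_hull: assumes "F \<in> facets" shows "p \<notin> affine hull F"
proof -
  have "affine hull F \<inter> rel_interior P = {}"
    by (rule affine_hull_face_of_disjoint_rel_interior[OF convex_P facet_face[OF assms] facet_ne[OF assms]])
  then show ?thesis using p_in interior_subset_rel_interior by blast
qed

lemma corner_independent:
  assumes F: "F \<in> facets"
  shows "inj_on (corner F) {..<4}" "\<not> affine_dependent (corner F ` {..<4})"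
proof -
  have ph: "p \<notin> affine hull (vertices_of F)"
    using p_notin_hull[OF F] facet_simplex(4)[OF F] affine_hull_convex_hull by metis
  have pn: "p \<notin> vertices_of F" using ph hull_inc by metis
  have card: "card (corner F ` {..<4}) = 4" unfolding corner_image(2)[OF F] using pn facet_simplex[OF F] by simp
  then show "inj_on (corner F) {..<4}" by (intro eq_card_imp_inj_on) auto
  have "aff_dim (vertices_of F) = 2" using aff_dim_affine_independent[OF facet_simplex(1)[OF F]] facet_simplex(2)[OF F] by simp
  then have "aff_dim (insert p (vertices_of F)) = 3" using ph by (simp add: aff_dim_insert)
  then show "\<not> affine_dependent (corner F ` {..<4})"
    unfolding affine_independent_iff_card using card facet_simplex(3)[OF F] by (simp add: corner_image(2)[OF F])
qed

definition tetra :: "(real^3) set \<Rightarrow> (real^3) set" where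
  "tetra F = convex hull (corner F ` {..<4})"

definition shared :: "(real^3) set \<Rightarrow> (real^3) set \<Rightarrow> nat set" where
  "shared F G = {i. i < 4 \<and> corner F i = corner G i}"

lemma tetra_point:
  assumes F: "F \<in> facets" and x: "x \<in> tetra F" "x \<noteq> p"
  obtains s f where "0 < s" "s \<le> 1" "f \<in> F" "x - p = s *\<^sub>R (f - p)"
proof -
  have "vertices_of F \<noteq> {}" using facet_simplex(2)[OF F] by auto
  then obtain a s f where s: "0 \<le> a" "0 \<le> s" "a + s = 1" "f \<in> convex hull (vertices_of F)" "x = a *\<^sub>R p + s *\<^sub>R f"
    using x(1) unfolding tetra_def corner_image(2)[OF F] by (auto simp: convex_hull_insert)
  have a: "a = 1 - s" using s(3) by simp
  have xp: "x - p = s *\<^sub>R (f - p)" unfolding s(5) a by (simp add: algebra_simps)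
  then have "s \<noteq> 0" using x(2) by auto
  then show thesis using that[OF _ _ _ xp] s facet_simplex(4)[OF F] by auto
qed

text \<open>The intersection of two facets is a face of both, spanned by common vertices, and equal
  colours make these shared corners.\<close>

lemma shared_hull_facets:
  assumes F: "F \<in> facets" "G \<in> facets" and f: "f \<in> F" "f \<in> G"
  shows "f \<in> convex hull (corner F ` shared F G)"
proof -
  have "(F \<inter> G) face_of P" by (rule face_of_Int[OF facet_face[OF F(1)] facet_face[OF F(2)]])
  then have "(F \<inter> G) face_of F" using face_of_face[OF facet_face[OF F(1)]] by blast
  then obtain C where C: "C \<subseteq> vertices_of F" "F \<inter> G = convex hull C"
    using face_of_convex_hull_affine_independent[OF facet_simplex(1)[OF F(1)]] facet_simplex(4)[OF F(1)] by metis
  have "C \<subseteq> corner F ` shared F G"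
  proof
    fix w assume w: "w \<in> C"
    then have wF: "w \<in> vertices_of F" and "w \<in> G" using C hull_inc[of w C convex] by auto
    then have wG: "w \<in> vertices_of G" using facet_vertices F by blast
    have "corner F (Suc (col w)) = w" "corner G (Suc (col w)) = w" "col w < 3"
      using corner_col[OF F(1) wF] corner_col[OF F(2) wG] by auto
    then show "w \<in> corner F ` shared F G" by (intro image_eqI[of _ _ "Suc (col w)"]) (auto simp: shared_def)
  qed
  then show ?thesis using C(2) f hull_mono by blast
qed

text \<open>A point other than \<open>p\<close> lies on a ray from \<open>p\<close> to a point of
  each facet. The ray meets the frontier of \<open>P\<close> only once, so the two points agree and
  lie in both facets.\<close>

lemma tetra_Int:
  assumes F: "F \<in> facets" "G \<in> facets"
  shows "tetra F \<inter> tetra G = convex hull (corner F ` shared F G)"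
proof
  have sh: "corner F ` shared F G = corner G ` shared F G" by (auto simp: shared_def)
  have "convex hull (corner F ` shared F G) \<subseteq> tetra F" unfolding tetra_def by (intro hull_mono image_mono) (auto simp: shared_def)
  moreover have "convex hull (corner F ` shared F G) \<subseteq> tetra G"
    unfolding tetra_def sh by (intro hull_mono image_mono) (auto simp: shared_def)
  ultimately show "convex hull (corner F ` shared F G) \<subseteq> tetra F \<inter> tetra G" by blast
  show "tetra F \<inter> tetra G \<subseteq> convex hull (corner F ` shared F G)"
  proof
    fix x assume x: "x \<in> tetra F \<inter> tetra G"
    have p0: "p \<in> convex hull (corner F ` shared F G)"
      by (intro hull_inc image_eqI[of _ _ 0]) (auto simp: shared_def)
    show "x \<in> convex hull (corner F ` shared F G)"
    proof (cases "x = p")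
      case False
      obtain s f where s: "0 < s" "s \<le> 1" "f \<in> F" "x - p = s *\<^sub>R (f - p)" using tetra_point[OF F(1) _ False] x by blast
      obtain t g where t: "0 < t" "t \<le> 1" "g \<in> G" "x - p = t *\<^sub>R (g - p)" using tetra_point[OF F(2) _ False] x by blast
      have fg: "f \<in> P" "g \<in> P" "f \<notin> interior P" "g \<notin> interior P"
        using s(3) t(3) facet_interior F facet_face face_of_imp_subset by blast+
      have eq: "s *\<^sub>R (f - p) = t *\<^sub>R (g - p)" using s(4) t(4) by simp
      have "f = g"
      proof (cases "s \<le> t")
        case True
        then show ?thesis using ray_meets_frontier_once[OF convex_P p_in fg(1,2,4) s(1) True eq] by simp
      next
        case False
        then have "t \<le> s" by simp
        then show ?thesis using ray_meets_frontier_once[OF convex_P p_in fg(2,1,3) t(1) _ eq[symmetric]] by simp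
      qed
      then have fh: "f \<in> convex hull (corner F ` shared F G)" using shared_hull_facets[OF F s(3)] t(3) by simp
      have "x = (1 - s) *\<^sub>R p + s *\<^sub>R f" using s(4) by (simp add: algebra_simps eq_diff_eq)
      then show ?thesis using convexD_alt[OF convex_convex_hull p0 fh, of s] s by simp
    qed (use p0 in simp)
  qed
qed

lemma tetra_subset: assumes "F \<in> facets" shows "tetra F \<subseteq> P"
  unfolding tetra_def corner_image(2)[OF assms]
proof (rule hull_minimal)
  show "convex P" by (rule convex_P)
  show "insert p (vertices_of F) \<subseteq> P"
    using p_in interior_subset facet_vertices[OF assms] by (auto simp: vertices_of_def extreme_point_of_def)
qed

lemma facets_nonempty: "facets \<noteq> {}"
  using polytope_facet_exists[OF poly] dim_P by (auto simp: facets_def)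

lemma tetra_union: "(\<Union>F\<in>facets. tetra F) = P"
proof
  show "(\<Union>F\<in>facets. tetra F) \<subseteq> P" using tetra_subset by blast
  show "P \<subseteq> (\<Union>F\<in>facets. tetra F)"
  proof
    fix x assume x: "x \<in> P"
    have pT: "p \<in> tetra F" for F unfolding tetra_def by (intro hull_inc image_eqI[of _ _ 0]) auto
    show "x \<in> (\<Union>F\<in>facets. tetra F)"
    proof (cases "x = p")
      case True then show ?thesis using pT facets_nonempty by blast
    next
      case False
      obtain d where d: "0 < d" "p + d *\<^sub>R (x - p) \<in> frontier P"
        by (rule ray_to_frontier[OF polytope_imp_bounded[OF poly] p_in, of "x - p"]) (use False in auto)
      define y where "y = p + d *\<^sub>R (x - p)"
      have d1: "1 \<le> d"
      proof (rule ccontr)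
        assume "\<not> 1 \<le> d"
        moreover have "y = (1 - d) *\<^sub>R p + d *\<^sub>R x" by (simp add: y_def algebra_simps)
        ultimately have "y \<in> open_segment p x" using d(1) False by (auto simp: in_segment)
        moreover have "open_segment p x \<subseteq> interior P"
          using in_interior_closure_convex_segment[OF convex_P p_in] x closure_subset by blast
        ultimately show False using d(2) by (auto simp: frontier_def y_def)
      qed
      obtain F where F: "F \<in> facets" "y \<in> F" using d(2) frontier_facets y_def by auto
      have "F \<subseteq> tetra F" unfolding tetra_def corner_image(2)[OF F(1)]
        using facet_simplex(4)[OF F(1)] hull_mono[of "vertices_of F" "insert p (vertices_of F)" convex] by auto
      then have yT: "y \<in> tetra F" using F(2) by blast
      have "x = (1 - 1/d) *\<^sub>R p + (1/d) *\<^sub>R y" using d(1) by (simp add: y_def algebra_simps)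
      moreover have "convex (tetra F)" unfolding tetra_def by simp
      ultimately have "x \<in> tetra F" using convexD_alt[OF _ pT yT, of "1/d"] d1 by simp
      then show ?thesis using F(1) by blast
    qed
  qed
qed

lemma corner_in_facet: "F \<in> facets \<Longrightarrow> 0 < i \<Longrightarrow> i < 4 \<Longrightarrow> corner F i \<in> vertices_of F"
  using corner_Suc(1)[of F "i - 1"] by simp

lemma corner_eq_iff:
  assumes F: "F \<in> facets" "G \<in> facets" and i: "0 < i" "i < 4"
  shows "corner F i \<in> G \<longleftrightarrow> corner G i = corner F i"
proof
  assume "corner F i \<in> G"
  then have w: "corner F i \<in> vertices_of G" using corner_in_facet[OF F(1) i] facet_vertices F by blast
  have "col (corner F i) = i - 1" using corner_Suc(2)[OF F(1), of "i - 1"] i by simp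
  then show "corner G i = corner F i" using corner_col(1)[OF F(2) w] i by simp
next
  assume "corner G i = corner F i"
  then show "corner F i \<in> G" using corner_in_facet[OF F(2) i] facet_vertices[OF F(2)] by simp
qed

lemma facet_eq_if_shared:
  assumes F: "F \<in> facets" "G \<in> facets" and s: "{1,2,3} \<subseteq> shared F G"
  shows "F = G"
proof -
  have "corner F ` {1,2,3} = corner G ` {1,2,3}" using s by (auto simp: shared_def)
  then show ?thesis using facet_eq_corner_hull F by metis
qed

definition mate :: "(real^3) set \<Rightarrow> (real^3) set" where
  "mate F = (THE G. G \<in> facets \<and> G \<noteq> F \<and> corner G 1 = corner F 1 \<and> corner G 2 = corner F 2)"

text \<open>The edge with colours 0 and 1 is in exactly two facets by
  \<open>two_facets_at_edge\<close>, and its ends are corners 1 and 2 of both.\<close>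

lemma mate_pair:
  assumes F: "F \<in> facets"
  shows "{G \<in> facets. corner G 1 = corner F 1 \<and> corner G 2 = corner F 2} = {F, mate F}" "mate F \<noteq> F"
proof -
  let ?A = "{G \<in> facets. corner G 1 = corner F 1 \<and> corner G 2 = corner F 2}"
  have "?A = {G \<in> facets. corner F 1 \<in> G \<and> corner F 2 \<in> G}"
    using corner_eq_iff[OF F, of _ 1] corner_eq_iff[OF F, of _ 2] by auto
  moreover have "card {G \<in> facets. corner F 1 \<in> G \<and> corner F 2 \<in> G} = 2"
  proof (rule two_facets_at_edge[OF F])
    show "corner F 1 \<in> vertices_of F" "corner F 2 \<in> vertices_of F" using corner_in_facet[OF F] by auto
    show "corner F 1 \<noteq> corner F 2" using inj_onD[OF corner_independent(1)[OF F], of 1 2] by auto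
  qed
  ultimately have c: "card ?A = 2" by simp
  have "F \<in> ?A" using F by simp
  then obtain G where G: "?A = {F, G}" "G \<noteq> F" using c by (metis (no_types, lifting) card_2_iff doubleton_eq_iff insertE singletonD)
  have "mate F = G" unfolding mate_def by (rule the_equality) (use G in auto)
  then show "?A = {F, mate F}" "mate F \<noteq> F" using G by auto
qed

lemma mate_facet:
  assumes "F \<in> facets" shows "mate F \<in> facets" "corner (mate F) 1 = corner F 1" "corner (mate F) 2 = corner F 2"
  using mate_pair(1)[OF assms] by blast+

lemma mate_mate: assumes F: "F \<in> facets" shows "mate (mate F) = F"
proof -
  have "F \<in> {G \<in> facets. corner G 1 = corner (mate F) 1 \<and> corner G 2 = corner (mate F) 2}"
    using F mate_facet[OF F] by simp
  then have "F \<in> {mate F, mate (mate F)}" unfolding mate_pair(1)[OF mate_facet(1)[OF F]] .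
  then show ?thesis using mate_pair(2)[OF F] by auto
qed

lemma mate_cases:
  assumes "F \<in> facets" "G \<in> facets" "corner G 1 = corner F 1" "corner G 2 = corner F 2"
  shows "G = F \<or> G = mate F"
  using mate_pair(1)[OF assms(1)] assms by blast

lemma shared_mate: assumes F: "F \<in> facets" shows "shared F (mate F) = {..<3}"
proof -
  have "3 \<notin> shared F (mate F)"
  proof
    assume "3 \<in> shared F (mate F)"
    then have "{1,2,3} \<subseteq> shared F (mate F)" using mate_facet[OF F] by (auto simp: shared_def)
    then show False using facet_eq_if_shared[OF F mate_facet(1)[OF F]] mate_pair(2)[OF F] by simp
  qed
  moreover have "{0,1,2} \<subseteq> shared F (mate F)" using mate_facet[OF F] by (auto simp: shared_def)
  moreover have "shared F (mate F) \<subseteq> {0,1,2,3}" by (auto simp: shared_def)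
  moreover have "{..<3::nat} = {0,1,2}" by auto
  ultimately show ?thesis by auto
qed

lemma frame_corner: "0 < e \<Longrightarrow> F \<in> facets \<Longrightarrow> frame (corner F) e"
  using corner_independent by (simp add: frame_def)

text \<open>Otherwise the tetrahedra overlap: the centre of the wall, displaced slightly towards
  \<open>d\<close>, has nonnegative coordinates in both, although they meet only in the
  wall.\<close>

lemma mate_opposite_side:
  fixes e :: real
  assumes F: "F \<in> facets" and e: "0 < e"
  shows "frame.bary (corner F) 3 (corner (mate F) 3) < 0"
proof -
  let ?G = "mate F"
  have G: "?G \<in> facets" by (rule mate_facet(1)[OF F])
  interpret A: frame "corner F" e by (rule frame_corner[OF e F])
  interpret B: frame "corner ?G" e by (rule frame_corner[OF e G])
  define d where "d = corner ?G 3"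
  have sh: "corner ?G i = corner F i" if "i < 3" for i
  proof -
    have "i \<in> shared F ?G" unfolding shared_mate[OF F] using that by simp
    then show ?thesis by (simp add: shared_def)
  qed
  show ?thesis
  proof (rule ccontr)
    assume "\<not> ?thesis"
    then have g: "0 \<le> A.bary 3 d" by (simp add: d_def)
    define D where "D = 1 + (\<Sum>i<3. \<bar>A.bary i d\<bar>)"
    have D: "1 \<le> D" "\<And>i. i < 3 \<Longrightarrow> \<bar>A.bary i d\<bar> \<le> D"
    proof -
      show "1 \<le> D" unfolding D_def by (simp add: sum_nonneg)
      fix i :: nat assume "i < 3"
      then have "\<bar>A.bary i d\<bar> \<le> (\<Sum>i<3. \<bar>A.bary i d\<bar>)" by (intro member_le_sum) auto
      then show "\<bar>A.bary i d\<bar> \<le> D" unfolding D_def by simp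
    qed
    \<comment> \<open>With this \<open>t\<close>, the coordinates of \<open>d\<close> with index
      below 3 contribute at most 1/6 in absolute value, which the share \<open>(1 - t) / 3\<close>
      of the wall corners outweighs.\<close>
    define t where "t = 1 / (6 * D)"
    have t: "0 < t" "t \<le> 1/6" using D(1) by (auto simp: t_def field_simps)
    define m where "m i = (if i = 3 then t else (1 - t) / 3)" for i :: nat
    define x where "x = (\<Sum>i<4. m i *\<^sub>R corner ?G i)"
    have four: "{..<4::nat} = insert 3 {..<3}" by auto
    have sm: "sum m {..<4} = 1" unfolding four by (simp add: m_def diff_divide_distrib)
    have bB: "B.bary i x = m i" if "i < 4" for i unfolding x_def by (rule B.bary_comb[OF sm that])
    have xG: "x \<in> tetra ?G" unfolding tetra_def
      using B.hull_iff_bary[of "{..<4}" x] bB t by (simp add: m_def)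
    have bA: "A.bary i x = (\<Sum>j<4. m j * A.bary i (corner ?G j))" if "i < 4" for i
      unfolding x_def by (rule affine_fun_comb[OF A.bary_affine[OF that] sm])
    have bA': "A.bary i x = t * A.bary i d + (if i < 3 then (1 - t) / 3 else 0)" if "i < 4" for i
    proof -
      have "(\<Sum>j<3. m j * A.bary i (corner ?G j)) = (\<Sum>j<3. if j = i then (1 - t) / 3 else 0)"
        using that by (intro sum.cong) (auto simp: sh m_def A.bary_vertex)
      then show ?thesis unfolding bA[OF that] four by (simp add: m_def d_def)
    qed
    have "0 \<le> A.bary i x" if "i < 4" for i
    proof (cases "i < 3")
      case True
      have "t * \<bar>A.bary i d\<bar> \<le> t * D" using D(2)[OF True] t(1) by (intro mult_left_mono) auto
      also have "t * D = 1/6" using D(1) by (simp add: t_def)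
      finally have "t * \<bar>A.bary i d\<bar> \<le> 1/6" .
      then have "\<bar>t * A.bary i d\<bar> \<le> 1/6" using t(1) unfolding abs_mult by simp
      then have "- (1/6) \<le> t * A.bary i d" by linarith
      moreover have "1/6 \<le> (1 - t) / 3" using t(2) by (simp add: field_simps)
      ultimately have "0 \<le> t * A.bary i d + (1 - t) / 3" by linarith
      then show ?thesis using bA'[OF that] True by simp
    next
      case False
      then have "i = 3" using that by simp
      then show ?thesis using bA'[of 3] g t(1) by simp
    qed
    then have "x \<in> tetra F" unfolding tetra_def using A.hull_iff_bary[of "{..<4}" x] by simp
    then have "x \<in> tetra F \<inter> tetra ?G" using xG by simp
    then have "x \<in> convex hull (corner F ` {..<3})" unfolding tetra_Int[OF F G] shared_mate[OF F] .
    moreover have "corner F ` {..<3} = corner ?G ` {..<3}"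
      by (rule image_cong[OF refl]) (use sh in \<open>simp only: lessThan_iff\<close>)
    ultimately have "x \<in> convex hull (corner ?G ` {..<3})" by simp
    then have "B.bary 3 x = 0" using B.hull_iff_bary[of "{..<3}" x] by simp
    then show False using bB[of 3] t(1) by (simp add: m_def)
  qed
qed

end

section \<open>Gluing pyramids across a wall\<close>

lemma node_scaled: "0 < e \<Longrightarrow> l < 18 \<Longrightarrow> node_total e l *\<^sub>R node v e l = (\<Sum>i<4. node_weight e l i *\<^sub>R v i)"
  using node_sum[of e "{0::nat}" "\<lambda>_. l" "\<lambda>_. 1" v] by simp

lemma node_cong:
  assumes "l \<in> face_labels J" "\<And>i. i \<in> J \<Longrightarrow> i < 4 \<Longrightarrow> v i = w i"
  shows "node v e l = node w e l"
  unfolding node_def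
proof (rule sum.cong[OF refl])
  fix i :: nat assume "i \<in> {..<4}"
  then show "(node_weight e l i / node_total e l) *\<^sub>R v i = (node_weight e l i / node_total e l) *\<^sub>R w i"
    using assms by (cases "i \<in> J") (auto simp: face_labels_def node_weight_def)
qed

text \<open>Up to positive normalization, the weight of base corner \<open>j\<close> at the point
  where the line through the two apexes meets the wall plane. The first summand is the projection of
  the apex to the wall; the second, of order \<open>e\<close>, carries the position of the opposite
  vertex, whose coordinates are \<open>\<delta>\<close>.\<close>

definition cross_coeff :: "(nat \<Rightarrow> real) \<Rightarrow> real \<Rightarrow> nat \<Rightarrow> nat \<Rightarrow> real" where
  "cross_coeff \<delta> e M j =
     (1 - \<delta> 3) * of_int (apex_coeffs ! (M - 9) ! j) / of_int (apex_coeffs ! (M - 9) ! 4) +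
     e * of_int (coords ! (cells ! M ! 4) ! 3) *
       (\<Sum>k<3. \<delta> k * of_int (corner_coeffs ! (M - 9) ! k ! j)) / of_int (corner_denom ! (M - 9))"

lemma apex_facts:
  assumes "9 \<le> M" "M < 14"
  shows "m < 5 \<Longrightarrow> 0 < apex_coeffs ! (M - 9) ! m" "0 < coords ! (cells ! M ! 4) ! 3"
    "m < 4 \<Longrightarrow> coords ! (cells ! M ! m) ! 3 = 0"
    "i < 3 \<Longrightarrow> apex_coeffs ! (M - 9) ! 4 * coords ! (cells ! M ! 4) ! i = (\<Sum>m<4. apex_coeffs ! (M - 9) ! m * coords ! (cells ! M ! m) ! i)"
proof -
  have M': "M \<in> set [9..<14]" using assms by auto
  define r where "r = apex_coeffs ! (M - 9)"
  have A: "list_all (\<lambda>m. 0 < r ! m) [0..<5]" "0 < coords ! (cells ! M ! 4) ! 3"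
     "list_all (\<lambda>m. coords ! (cells ! M ! m) ! 3 = 0) [0..<4]"
     "list_all (\<lambda>i. r ! 4 * coords ! (cells ! M ! 4) ! i = weighted_coord M r [0..<4] i) [0..<3]"
    using list_all_mem[OF apex_relation M'] by (simp_all add: Let_def r_def)
  show "m < 5 \<Longrightarrow> 0 < apex_coeffs ! (M - 9) ! m" using list_all_upt[OF A(1)] r_def by simp
  show "0 < coords ! (cells ! M ! 4) ! 3" by (rule A(2))
  show "m < 4 \<Longrightarrow> coords ! (cells ! M ! m) ! 3 = 0" by (rule list_all_upt[OF A(3)])
  show "i < 3 \<Longrightarrow> apex_coeffs ! (M - 9) ! 4 * coords ! (cells ! M ! 4) ! i = (\<Sum>m<4. apex_coeffs ! (M - 9) ! m * coords ! (cells ! M ! m) ! i)"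
    using list_all_upt[OF A(4)] by (subst (asm) weighted_coord_sum) (auto simp: r_def atLeast0LessThan)
qed

lemma corner_facts:
  assumes "9 \<le> M" "M < 14"
  shows "0 < corner_denom ! (M - 9)"
    "k < 3 \<Longrightarrow> i < 3 \<Longrightarrow> (\<Sum>m<4. corner_coeffs ! (M - 9) ! k ! m * coords ! (cells ! M ! m) ! i) = (if i = k then corner_denom ! (M - 9) else 0)"
proof -
  have M': "M \<in> set [9..<14]" using assms by auto
  have A: "0 < corner_denom ! (M - 9)" "list_all (\<lambda>k.
     list_all (\<lambda>i. weighted_coord M (corner_coeffs ! (M - 9) ! k) [0..<4] i = (if i = k then corner_denom ! (M - 9) else 0)) [0..<3]) [0..<3]"
    using list_all_mem[OF corner_relation M'] by simp_all
  show "0 < corner_denom ! (M - 9)" by (rule A(1))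
  show "k < 3 \<Longrightarrow> i < 3 \<Longrightarrow> (\<Sum>m<4. corner_coeffs ! (M - 9) ! k ! m * coords ! (cells ! M ! m) ! i) = (if i = k then corner_denom ! (M - 9) else 0)"
    using list_all_upt[OF list_all_upt[OF A(2)]] by (subst (asm) weighted_coord_sum) (auto simp: atLeast0LessThan)
qed

lemma cross_coeff_sum:
  assumes M: "9 \<le> M" "M < 14" and i: "i < 3"
  shows "(\<Sum>j<4. cross_coeff \<delta> e M j * of_int (coords ! (cells ! M ! j) ! i)) =
     (1 - \<delta> 3) * of_int (coords ! (cells ! M ! 4) ! i) + e * of_int (coords ! (cells ! M ! 4) ! 3) * \<delta> i"
proof -
  let ?X = "\<lambda>j. real_of_int (coords ! (cells ! M ! j) ! i)" and ?\<kappa> = "real_of_int (apex_coeffs ! (M - 9) ! 4)"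
  let ?\<beta> = "\<lambda>j. real_of_int (apex_coeffs ! (M - 9) ! j)" and ?D = "real_of_int (corner_denom ! (M - 9))"
  let ?\<eta> = "\<lambda>k j. real_of_int (corner_coeffs ! (M - 9) ! k ! j)" and ?m = "e * real_of_int (coords ! (cells ! M ! 4) ! 3)"
  have k: "?\<kappa> > 0" and D: "?D > 0" using apex_facts(1)[OF M, of 4] corner_facts(1)[OF M] by simp_all
  have a: "(\<Sum>j<4. ?\<beta> j * ?X j) = ?\<kappa> * ?X 4"
    using arg_cong[OF apex_facts(4)[OF M i], of real_of_int] by simp
  have b: "(\<Sum>j<4. ?\<eta> k j * ?X j) = (if i = k then ?D else 0)" if "k < 3" for k
    using arg_cong[OF corner_facts(2)[OF M that i], of real_of_int] by simp
  have "(\<Sum>j<4. cross_coeff \<delta> e M j * ?X j) =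
      (\<Sum>j<4. ((1 - \<delta> 3) / ?\<kappa>) * (?\<beta> j * ?X j)) + (\<Sum>j<4. ?m / ?D * (\<Sum>k<3. \<delta> k * (?\<eta> k j * ?X j)))"
    unfolding sum.distrib[symmetric]
  proof (rule sum.cong[OF refl])
    fix j :: nat
    have S: "(\<Sum>k<3. \<delta> k * (?\<eta> k j * ?X j)) = (\<Sum>k<3. \<delta> k * ?\<eta> k j) * ?X j"
      by (simp add: sum_distrib_right mult.assoc)
    show "cross_coeff \<delta> e M j * ?X j = (1 - \<delta> 3) / ?\<kappa> * (?\<beta> j * ?X j) + ?m / ?D * (\<Sum>k<3. \<delta> k * (?\<eta> k j * ?X j))"
      unfolding S cross_coeff_def by (simp add: distrib_left mult_ac)
  qed
  also have "\<dots> = ((1 - \<delta> 3) / ?\<kappa>) * (\<Sum>j<4. ?\<beta> j * ?X j) + ?m / ?D * (\<Sum>k<3. \<delta> k * (\<Sum>j<4. ?\<eta> k j * ?X j))"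
    unfolding sum_distrib_left[symmetric] by (subst sum.swap) (simp add: sum_distrib_left)
  also have "(\<Sum>k<3. \<delta> k * (\<Sum>j<4. ?\<eta> k j * ?X j)) = (\<Sum>k<3. if k = i then \<delta> i * ?D else 0)"
    by (intro sum.cong) (auto simp: b)
  also have "\<dots> = \<delta> i * ?D" using i by simp
  finally show ?thesis unfolding a using k D by simp
qed

text \<open>As \<open>e\<close> tends to 0, only the projection of the apex survives, and it is in
  the interior of the base since the \<open>apex_coeffs\<close> are positive.\<close>

lemma cross_coeff_eventually_pos:
  assumes M: "9 \<le> M" "M < 14" and j: "j < 4" and \<delta>: "\<delta> 3 < 1"
  shows "eventually (\<lambda>e. 0 < cross_coeff \<delta> e M j) (at_right 0)"
proof -
  let ?c = "(1 - \<delta> 3) * of_int (apex_coeffs ! (M - 9) ! j) / of_int (apex_coeffs ! (M - 9) ! 4)"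
  have "0 < ?c" using apex_facts(1)[OF M, of 4] apex_facts(1)[OF M, of j] j \<delta> by simp
  moreover have "((\<lambda>e. cross_coeff \<delta> e M j) \<longlongrightarrow> cross_coeff \<delta> 0 M j) (at_right 0)"
    unfolding cross_coeff_def by (intro tendsto_intros) (use corner_facts(1)[OF M] in auto)
  moreover have "cross_coeff \<delta> 0 M j = ?c" by (simp add: cross_coeff_def)
  ultimately show ?thesis by (metis order_tendstoD(1))
qed

lemma pyramidal_cong:
  assumes "\<And>m. m < 5 \<Longrightarrow> P m = Q m" shows "pyramidal P = pyramidal Q"
proof -
  have "P ` {..<5} = Q ` {..<5}" "P ` {0,1} = Q ` {0,1}" "P ` {2,3} = Q ` {2,3}" "P ` {..<4} = Q ` {..<4}"
    using assms by (intro image_cong; force)+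
  moreover have "exposed_set P 5 A = exposed_set Q 5 A" for A by (rule exposed_set_cong[OF assms])
  ultimately show ?thesis unfolding pyramidal_def by (simp only:)
qed

text \<open>The common base corners are 0 to 3 and the apexes on the two sides are 4 and 5, matching
  the antipodal pairs of \<open>octahedral\<close>.\<close>

definition straddle :: "(nat \<Rightarrow> real^3) \<Rightarrow> (nat \<Rightarrow> real^3) \<Rightarrow> real \<Rightarrow> nat \<Rightarrow> nat \<Rightarrow> real^3" where
  "straddle v w e M m = (if m < 5 then node v e (cells ! M ! m) else node w e (cells ! M ! 4))"

text \<open>Weighting the apex on the side of \<open>v\<close> by \<open>g\<close>, the negative of
  coordinate 3 of \<open>w 3\<close>, cancels the corner \<open>v 3\<close> and leaves a point of
  the wall. Its expression by \<open>cross_coeff\<close> is the positive relation needed for a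
  bipyramid.\<close>

lemma straddle_octahedral:
  assumes v: "frame v e" and w: "frame w e" and vw: "\<And>i. i < 3 \<Longrightarrow> v i = w i"
    and M: "9 \<le> M" "M < 14" and neg: "frame.bary v 3 (w 3) < 0"
    and pos: "\<And>j. j < 4 \<Longrightarrow> 0 < cross_coeff (\<lambda>i. frame.bary v i (w 3)) e M j"
  shows "octahedral (straddle v w e M)"
    and "convex hull (straddle v w e M ` {..<6}) = hull_cell v e M \<union> hull_cell w e M"
proof -
  interpret A: frame v e by (rule v)
  interpret B: frame w e by (rule w)
  let ?P = "straddle v w e M" and ?l = "\<lambda>m. cells ! M ! m"
  define \<delta> where "\<delta> i = A.bary i (w 3)" for i
  define g where "g = - \<delta> 3"
  have g: "0 < g" using neg by (simp add: g_def \<delta>_def)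
  have len: "length (cells ! M) = 5" using cell_length[OF M(2)] M(1) by simp
  have lab: "?l m < 18" if "m < 5" for m using cell_label[OF M(2) nth_mem] that len by simp
  have base: "?l m \<in> face_labels {..<3}" if "m < 4" for m
  proof -
    have "coords ! ?l m ! i = 0" if "i < 4" "i \<notin> {..<3}" for i :: nat
    proof -
      have "i = 3" using that by simp
      then show ?thesis using apex_facts(3)[OF M \<open>m < 4\<close>] by simp
    qed
    then show ?thesis using lab[of m] that unfolding face_labels_def by simp
  qed
  have nodes: "node w e (?l m) = node v e (?l m)" if "m < 4" for m
    by (rule node_cong[OF base[OF that]]) (use vw in auto)
  have P: "?P m = node v e (?l m)" if "m < 5" for m using that by (simp add: straddle_def)
  have P5: "?P 5 = node w e (?l 4)" by (simp add: straddle_def)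
  have P': "(?P(4 := ?P 5)) m = node w e (?l m)" if "m < 5" for m
    using that nodes[of m] by (cases "m = 4") (auto simp: straddle_def)
  have pyr: "pyramidal ?P" using pyramidal_cong[of ?P "A.vertex M"] P A.pyramid_cell[OF M] by simp
  have pyr': "pyramidal (?P(4 := ?P 5))" using pyramidal_cong[of "?P(4 := ?P 5)" "B.vertex M"] P' B.pyramid_cell[OF M] by simp
  have four: "{..<4::nat} = insert 3 {..<3}" by auto
  let ?t = "?l 4"
  define N where "N = node_total e ?t"
  have N: "0 < N" unfolding N_def by (rule node_total_pos[OF A.e_pos lab]) simp
  define c where "c j = cross_coeff \<delta> e M j" for j
  have cpos: "0 < c j" if "j < 4" for j
  proof -
    have "\<delta> = (\<lambda>i. A.bary i (w 3))" by (simp add: \<delta>_def fun_eq_iff)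
    then show ?thesis using pos[OF that] by (simp add: c_def)
  qed
  have w3: "node_weight e (?l m) 3 = 0" if "m < 4" for m using apex_facts(3)[OF M that] by (simp add: node_weight_def)
  have cs: "(\<Sum>j<4. c j * node_weight e (?l j) i) = (if i < 3 then (1 + g) * node_weight e ?t i + node_weight e ?t 3 * \<delta> i else 0)" if "i < 4" for i
  proof (cases "i < 3")
    case True
    have "(\<Sum>j<4. c j * node_weight e (?l j) i) = (\<Sum>j<4. c j * of_int (coords ! ?l j ! i))"
      using True by (intro sum.cong) (auto simp: node_weight_def)
    then show ?thesis using cross_coeff_sum[OF M True, of \<delta> e] True by (simp add: c_def node_weight_def g_def)
  next
    case False
    then have "i = 3" using that by simp
    then show ?thesis using w3 by simp
  qed
  have d1: "(\<Sum>i<3. \<delta> i) = 1 + g" using A.bary_expand(1)[of "w 3"] unfolding four by (simp add: \<delta>_def g_def)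
  have "(\<Sum>i<3. \<delta> i *\<^sub>R v i) - g *\<^sub>R v 3 = w 3"
    using A.bary_expand(2)[of "w 3"] unfolding four by (simp add: \<delta>_def g_def add.commute)
  note d2 = this[symmetric]
  have Nv: "N *\<^sub>R node v e ?t = (\<Sum>i<3. node_weight e ?t i *\<^sub>R v i) + node_weight e ?t 3 *\<^sub>R v 3"
    unfolding N_def node_scaled[OF A.e_pos lab[of 4, simplified]] four by simp
  have Nw: "N *\<^sub>R node w e ?t = (\<Sum>i<3. node_weight e ?t i *\<^sub>R v i) + node_weight e ?t 3 *\<^sub>R w 3"
    unfolding N_def node_scaled[OF A.e_pos lab[of 4, simplified]] four using vw by simp
  have N3: "N = (\<Sum>i<3. node_weight e ?t i) + node_weight e ?t 3" unfolding N_def node_total_def four by simp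
  have vec: "(\<Sum>j<4. (c j * node_total e (?l j)) *\<^sub>R node v e (?l j)) = g *\<^sub>R (N *\<^sub>R node v e ?t) + N *\<^sub>R node w e ?t"
  proof -
    have "(\<Sum>j<4. (c j * node_total e (?l j)) *\<^sub>R node v e (?l j)) = (\<Sum>i<4. (\<Sum>j<4. c j * node_weight e (?l j) i) *\<^sub>R v i)"
      by (rule node_sum[OF A.e_pos]) (use lab in auto)
    also have "\<dots> = (\<Sum>i<4. (if i < 3 then (1 + g) * node_weight e ?t i + node_weight e ?t 3 * \<delta> i else 0) *\<^sub>R v i)"
      by (intro sum.cong refl) (simp add: cs)
    also have "\<dots> = (\<Sum>i<3. ((1 + g) * node_weight e ?t i + node_weight e ?t 3 * \<delta> i) *\<^sub>R v i)" unfolding four by simp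
    also have "\<dots> = (1 + g) *\<^sub>R (\<Sum>i<3. node_weight e ?t i *\<^sub>R v i) + node_weight e ?t 3 *\<^sub>R (\<Sum>i<3. \<delta> i *\<^sub>R v i)"
      by (simp add: scaleR_sum_right sum.distrib scaleR_left_distrib)
    also have "\<dots> = g *\<^sub>R (N *\<^sub>R node v e ?t) + N *\<^sub>R node w e ?t"
      unfolding Nv Nw by (subst d2) (simp add: scaleR_left_distrib scaleR_right_distrib scaleR_diff_right mult.commute)
    finally show ?thesis .
  qed
  have tot: "(\<Sum>j<4. c j * node_total e (?l j)) = (1 + g) * N"
  proof -
    have "(\<Sum>j<4. c j * node_total e (?l j)) = (\<Sum>i<4. (if i < 3 then (1 + g) * node_weight e ?t i + node_weight e ?t 3 * \<delta> i else 0))"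
      unfolding node_total_sum by (intro sum.cong refl) (simp add: cs)
    also have "\<dots> = (\<Sum>i<3. (1 + g) * node_weight e ?t i + node_weight e ?t 3 * \<delta> i)" unfolding four by simp
    also have "\<dots> = (1 + g) * (\<Sum>i<3. node_weight e ?t i) + node_weight e ?t 3 * (\<Sum>i<3. \<delta> i)"
      by (simp add: sum.distrib sum_distrib_left)
    also have "\<dots> = (1 + g) * N" unfolding N3 d1 by (simp add: algebra_simps)
    finally show ?thesis .
  qed
  define \<sigma> where "\<sigma> j = c j * node_total e (?l j) / N" for j
  have s1: "0 < \<sigma> j" if "j < 4" for j
    unfolding \<sigma>_def using cpos[OF that] N node_total_pos[OF A.e_pos lab, of j] that by simp
  have s2: "sum \<sigma> {..<4} = g + 1" unfolding \<sigma>_def using tot N by (simp add: sum_divide_distrib[symmetric])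
  have s3: "g *\<^sub>R ?P 4 + ?P 5 = (\<Sum>j<4. \<sigma> j *\<^sub>R ?P j)"
  proof -
    have "(\<Sum>j<4. \<sigma> j *\<^sub>R ?P j) = (1 / N) *\<^sub>R (\<Sum>j<4. (c j * node_total e (?l j)) *\<^sub>R node v e (?l j))"
      unfolding scaleR_sum_right by (intro sum.cong) (auto simp: \<sigma>_def P)
    also have "\<dots> = g *\<^sub>R ?P 4 + ?P 5" unfolding vec using N by (simp add: P P5 scaleR_right_distrib)
    finally show ?thesis by simp
  qed
  define r where "r = relations ! M ! 0"
  have M': "M \<in> set [9..<14]" using M by auto
  have R: "list_all (\<lambda>m. 0 < r ! m) [0..<4]"
    "list_all (\<lambda>i. weighted_coord M r [0,1] i = weighted_coord M r [2,3] i) [0..<4]"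
    using list_all_mem[OF relations_pyramid M'] by (simp_all add: Let_def r_def)
  have rel: "(\<Sum>m\<in>{0,1}. of_int (r ! m) * node_weight e (?l m) i) = (\<Sum>m\<in>{2,3}. of_int (r ! m) * node_weight e (?l m) i)" if "i < 4" for i
  proof -
    have "(\<Sum>m\<in>{0,1}. r ! m * coords ! (?l m) ! i) = (\<Sum>m\<in>{2,3}. r ! m * coords ! (?l m) ! i)"
      using list_all_upt[OF R(2) that] by (subst (asm) (1 2) weighted_coord_sum) auto
    note r = arg_cong[OF this, of real_of_int]
    show ?thesis
    proof (cases "i = 3")
      case True then show ?thesis using w3 by simp
    next
      case False then show ?thesis using r by (simp add: node_weight_def)
    qed
  qed
  define \<rho> where "\<rho> m = of_int (r ! m) * node_total e (?l m)" for m
  have r1: "0 < \<rho> m" if "m < 4" for m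
    unfolding \<rho>_def using list_all_upt[OF R(1) that] node_total_pos[OF A.e_pos lab, of m] that by simp
  have r2: "\<rho> 0 + \<rho> 1 = \<rho> 2 + \<rho> 3"
  proof -
    have "(\<Sum>m\<in>{0,1}. of_int (r ! m) * node_total e (?l m)) = (\<Sum>m\<in>{2,3}. of_int (r ! m) * node_total e (?l m))"
      unfolding node_total_sum by (intro sum.cong refl rel) simp
    then show ?thesis by (simp add: \<rho>_def)
  qed
  have r3: "\<rho> 0 *\<^sub>R ?P 0 + \<rho> 1 *\<^sub>R ?P 1 = \<rho> 2 *\<^sub>R ?P 2 + \<rho> 3 *\<^sub>R ?P 3"
  proof -
    have "(\<Sum>m\<in>S. (of_int (r ! m) * node_total e (?l m)) *\<^sub>R node v e (?l m)) = (\<Sum>i<4. (\<Sum>m\<in>S. of_int (r ! m) * node_weight e (?l m) i) *\<^sub>R v i)"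
      if "S \<subseteq> {..<4}" for S
    proof (rule node_sum[OF A.e_pos])
      show "finite S" by (rule finite_subset[OF that]) simp
      fix m assume "m \<in> S"
      then have "m < 4" using that by blast
      then show "?l m < 18" by (intro lab) simp
    qed
    note * = this
    have "(\<Sum>m\<in>{0,1}. (of_int (r ! m) * node_total e (?l m)) *\<^sub>R node v e (?l m)) =
        (\<Sum>i<4. (\<Sum>m\<in>{0,1}. of_int (r ! m) * node_weight e (?l m) i) *\<^sub>R v i)"
      by (rule *) simp
    also have "\<dots> = (\<Sum>i<4. (\<Sum>m\<in>{2,3}. of_int (r ! m) * node_weight e (?l m) i) *\<^sub>R v i)"
      by (intro sum.cong refl arg_cong2[where f = scaleR] rel) simp
    also have "\<dots> = (\<Sum>m\<in>{2,3}. (of_int (r ! m) * node_total e (?l m)) *\<^sub>R node v e (?l m))"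
      by (rule *[symmetric]) simp
    finally have "(\<Sum>m\<in>{0,1}. (of_int (r ! m) * node_total e (?l m)) *\<^sub>R node v e (?l m)) =
        (\<Sum>m\<in>{2,3}. (of_int (r ! m) * node_total e (?l m)) *\<^sub>R node v e (?l m))" .
    then show ?thesis by (simp add: \<rho>_def P)
  qed
  show "octahedral ?P" by (rule bipyramid_octahedral[OF pyr pyr' g s1 s2 s3 r1 r2 r3])
  have "convex hull (?P ` {0,1,2,3,4}) = hull_cell v e M"
  proof -
    have "{0,1,2,3,4} = {..<5::nat}" by auto
    then have "?P ` {0,1,2,3,4} = A.vertex M ` {..<5}" using P by (auto intro!: image_cong)
    then show ?thesis using A.K_pyramid[OF M] by simp
  qed
  moreover have "convex hull (?P ` {0,1,2,3,5}) = hull_cell w e M"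
  proof -
    have "?P ` {0,1,2,3,5} = (?P(4 := ?P 5)) ` {0,1,2,3,4}" by simp
    also have "{0,1,2,3,4} = {..<5::nat}" by auto
    also have "(?P(4 := ?P 5)) ` {..<5} = B.vertex M ` {..<5}" using P' by (auto intro!: image_cong)
    finally show ?thesis using B.K_pyramid[OF M] by simp
  qed
  ultimately show "convex hull (?P ` {..<6}) = hull_cell v e M \<union> hull_cell w e M"
    using bipyramid_union[OF g s1 s2 s3] by simp
qed

section \<open>Polytopal complexes\<close>

definition cells_of :: "'a::euclidean_space set set \<Rightarrow> 'a set set" where
  "cells_of \<K> = {C. \<exists>K\<in>\<K>. C face_of K}"

lemma cells_of_self: "K \<in> \<K> \<Longrightarrow> convex K \<Longrightarrow> K \<in> cells_of \<K>"
  unfolding cells_of_def using face_of_refl by blast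

lemma cells_of_face: "C \<in> cells_of \<K> \<Longrightarrow> F face_of C \<Longrightarrow> F \<in> cells_of \<K>"
  unfolding cells_of_def using face_of_trans by blast

lemma cells_of_finite:
  assumes "finite \<K>" "\<And>K. K \<in> \<K> \<Longrightarrow> polytope K" shows "finite (cells_of \<K>)"
proof -
  have "cells_of \<K> = (\<Union>K\<in>\<K>. {C. C face_of K})" by (auto simp: cells_of_def)
  then show ?thesis using assms finite_polyhedron_faces polytope_imp_polyhedron by auto
qed

lemma cells_of_polytope:
  assumes "\<And>K. K \<in> \<K> \<Longrightarrow> polytope K" "C \<in> cells_of \<K>" shows "polytope C"
  using assms face_of_polytope_polytope unfolding cells_of_def by blast

lemma cells_of_Union: "(\<And>K. K \<in> \<K> \<Longrightarrow> convex K) \<Longrightarrow> \<Union>(cells_of \<K>) = \<Union>\<K>"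
  unfolding cells_of_def using face_of_refl face_of_imp_subset by blast

lemma polytopal_complex_cells_of:
  assumes "finite \<K>" "\<And>K. K \<in> \<K> \<Longrightarrow> polytope K"
    and "\<And>K L. K \<in> \<K> \<Longrightarrow> L \<in> \<K> \<Longrightarrow> (K \<inter> L) face_of K"
  shows "polytopal_complex (cells_of \<K>)"
  unfolding polytopal_complex_def
proof (intro conjI ballI allI impI)
  show "finite (cells_of \<K>)" by (rule cells_of_finite[OF assms(1,2)])
  show "polytope C" if "C \<in> cells_of \<K>" for C using cells_of_polytope[OF assms(2) that] .
  show "F \<in> cells_of \<K>" if "C \<in> cells_of \<K>" "F face_of C" for C F using cells_of_face that .
  fix C D assume "C \<in> cells_of \<K>" "D \<in> cells_of \<K>"
  then obtain K L where "K \<in> \<K>" "C face_of K" "L \<in> \<K>" "D face_of L" by (auto simp: cells_of_def)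
  then have "(C \<inter> D) face_of C \<and> (C \<inter> D) face_of D"
    using assms(3)[of K L] assms(3)[of L K] by (intro face_of_Int_subface[of K L C D]) (auto simp: Int_commute)
  then show "(C \<inter> D) face_of C" "(C \<inter> D) face_of D" by blast+
qed

lemma polytopal_complex_rel_interior:
  assumes "polytopal_complex \<Delta>" "C \<in> \<Delta>" "D \<in> \<Delta>" "x \<in> rel_interior C" "x \<in> rel_interior D"
  shows "C = D"
proof -
  have f: "(C \<inter> D) face_of C" "(C \<inter> D) face_of D" using assms unfolding polytopal_complex_def by blast+
  have x: "x \<in> C \<inter> D" using assms(4,5) rel_interior_subset by blast
  have "C \<subseteq> C \<inter> D" by (rule subset_of_face_of[OF f(1) order_refl]) (use x assms(4) in blast)
  moreover have "D \<subseteq> C \<inter> D" by (rule subset_of_face_of[OF f(2) order_refl]) (use x assms(5) in blast)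
  ultimately show ?thesis by blast
qed

text \<open>The smallest face containing \<open>x\<close> works: a facet of it through
  \<open>x\<close> would be smaller.\<close>

lemma rel_interior_face_exists:
  fixes C :: "'a::euclidean_space set"
  assumes "polytope C" "x \<in> C"
  obtains F where "F face_of C" "x \<in> rel_interior F"
proof -
  define F where "F = \<Inter>{G. G face_of C \<and> x \<in> G}"
  have CC: "C face_of C" by (rule face_of_refl[OF polytope_imp_convex[OF assms(1)]])
  have F: "F face_of C" unfolding F_def using assms(2) CC by (intro face_of_Inter) auto
  have xF: "x \<in> F" by (auto simp: F_def)
  have "polyhedron F" by (rule face_of_polyhedron_polyhedron[OF polytope_imp_polyhedron[OF assms(1)] F])
  then have r: "rel_interior F = F - \<Union>{G. G facet_of F}" by (rule rel_interior_of_polyhedron)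
  have "x \<in> rel_interior F"
  proof (rule ccontr)
    assume "x \<notin> rel_interior F"
    then obtain G where G: "G facet_of F" "x \<in> G" using r xF by blast
    have "G face_of C" using facet_of_imp_face_of[OF G(1)] F face_of_trans by blast
    then have "F \<subseteq> G" using G(2) by (auto simp: F_def)
    then have "G = F" using facet_of_imp_subset[OF G(1)] by blast
    then show False using G(1) by simp
  qed
  then show thesis using that F by blast
qed

text \<open>A relative interior point of \<open>C \<inter> D\<close> is in the relative interior of
  a face of \<open>C\<close> and of a face of \<open>D\<close>. These coincide by
  \<open>disj\<close>, and a face that meets the relative interior of a subset contains the subset,
  so \<open>C \<inter> D\<close> is this common face.\<close>

lemma polytopal_complex_if_rel_interiors_disjoint:
  assumes fin: "finite \<Delta>" and poly: "\<And>C. C \<in> \<Delta> \<Longrightarrow> polytope C"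
    and cl: "\<And>C F. C \<in> \<Delta> \<Longrightarrow> F face_of C \<Longrightarrow> F \<in> \<Delta>"
    and disj: "\<And>C D x. C \<in> \<Delta> \<Longrightarrow> D \<in> \<Delta> \<Longrightarrow> x \<in> rel_interior C \<Longrightarrow> x \<in> rel_interior D \<Longrightarrow> C = D"
  shows "polytopal_complex \<Delta>"
proof -
  have "(C \<inter> D) face_of C \<and> (C \<inter> D) face_of D" if CD: "C \<in> \<Delta>" "D \<in> \<Delta>" for C D
  proof (cases "C \<inter> D = {}")
    case False
    have conv: "convex (C \<inter> D)" by (intro convex_Int polytope_imp_convex poly CD)
    then have "rel_interior (C \<inter> D) \<noteq> {}" using False rel_interior_eq_empty[OF conv] by simp
    then obtain x where x: "x \<in> rel_interior (C \<inter> D)" by blast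
    then have xCD: "x \<in> C" "x \<in> D" using rel_interior_subset by blast+
    obtain F where F: "F face_of C" "x \<in> rel_interior F" using rel_interior_face_exists[OF poly[OF CD(1)] xCD(1)] .
    obtain G where G: "G face_of D" "x \<in> rel_interior G" using rel_interior_face_exists[OF poly[OF CD(2)] xCD(2)] .
    have FG: "F = G" by (rule disj[OF cl[OF CD(1) F(1)] cl[OF CD(2) G(1)] F(2) G(2)])
    have "x \<in> F" using F(2) rel_interior_subset by blast
    then have "C \<inter> D \<subseteq> F" by (intro subset_of_face_of[OF F(1)]) (use x in auto)
    moreover have "F \<subseteq> C \<inter> D" using face_of_imp_subset F(1) G(1) FG by blast
    ultimately have "C \<inter> D = F" by blast
    then show ?thesis using F(1) G(1) FG by simp
  qed simp
  then show ?thesis unfolding polytopal_complex_def using fin poly cl by simp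
qed

lemma face_aff_dim_eq:
  assumes "convex K" "C face_of K" "aff_dim C = aff_dim K" shows "C = K"
  using face_of_aff_dim_lt[OF assms(1,2)] assms(3) by force

lemma maximal_cells_cells_of:
  assumes K: "\<And>K. K \<in> \<K> \<Longrightarrow> polytope K" "\<And>K. K \<in> \<K> \<Longrightarrow> aff_dim K = d"
    and C: "polytopal_complex (cells_of \<K>)"
  shows "maximal_cells (cells_of \<K>) = \<K>" "{C \<in> cells_of \<K>. aff_dim C = d} = \<K>"
proof -
  have conv: "convex K" if "K \<in> \<K>" for K using polytope_imp_convex[OF K(1)[OF that]] .
  show e: "{C \<in> cells_of \<K>. aff_dim C = d} = \<K>"
  proof
    show "{C \<in> cells_of \<K>. aff_dim C = d} \<subseteq> \<K>"
      using face_aff_dim_eq[OF conv] K(2) by (auto simp: cells_of_def)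
    show "\<K> \<subseteq> {C \<in> cells_of \<K>. aff_dim C = d}" using cells_of_self conv K(2) by blast
  qed
  show "maximal_cells (cells_of \<K>) = \<K>"
  proof
    show "maximal_cells (cells_of \<K>) \<subseteq> \<K>"
    proof
      fix C assume C: "C \<in> maximal_cells (cells_of \<K>)"
      then obtain K where K': "K \<in> \<K>" "C face_of K" by (auto simp: maximal_cells_def cells_of_def)
      then have "K = C" using C cells_of_self[OF K'(1) conv[OF K'(1)]] face_of_imp_subset[OF K'(2)]
        unfolding maximal_cells_def by blast
      then show "C \<in> \<K>" using K'(1) by simp
    qed
    show "\<K> \<subseteq> maximal_cells (cells_of \<K>)"
    proof
      fix M assume M: "M \<in> \<K>"
      then have MC: "M \<in> cells_of \<K>" using cells_of_self conv by blast
      have "D = M" if D: "D \<in> cells_of \<K>" "M \<subseteq> D" for D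
      proof -
        have "(M \<inter> D) face_of D" using C MC D(1) unfolding polytopal_complex_def by blast
        then have "M face_of D" using D(2) by (simp add: Int_absorb2)
        moreover obtain L where L: "L \<in> \<K>" "D face_of L" using D(1) by (auto simp: cells_of_def)
        ultimately have "M face_of L" using face_of_trans by blast
        then have "M = L" using face_aff_dim_eq[OF conv[OF L(1)]] K(2)[OF M] K(2)[OF L(1)] by simp
        then show ?thesis using D(2) face_of_imp_subset[OF L(2)] by blast
      qed
      then show "M \<in> maximal_cells (cells_of \<K>)" using MC by (auto simp: maximal_cells_def)
    qed
  qed
qed

text \<open>A short move from \<open>x\<close> along the outer normal of \<open>K\<close> at
  \<open>G\<close> leaves \<open>K\<close> but not \<open>P\<close> and reaches only cells
  containing \<open>x\<close>. A cell containing a relative interior point of \<open>G\<close> has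
  \<open>G\<close> as a face.\<close>

lemma interior_wall_two_cells:
  fixes P :: "'a::euclidean_space set"
  assumes fin: "finite \<K>" and poly: "\<And>K. K \<in> \<K> \<Longrightarrow> polytope K" "\<And>K. K \<in> \<K> \<Longrightarrow> aff_dim K = DIM('a)"
    and un: "\<Union>\<K> = P" and C: "polytopal_complex (cells_of \<K>)"
    and G: "K \<in> \<K>" "G face_of K" "aff_dim G = DIM('a) - 1" and x: "x \<in> rel_interior G" "x \<in> interior P"
  shows "\<exists>L\<in>\<K>. L \<noteq> K \<and> G face_of L"
proof -
  have Kp: "polyhedron K" by (rule polytope_imp_polyhedron[OF poly(1)[OF G(1)]])
  have Gf: "G facet_of K" using G poly(2)[OF G(1)] x(1) by (auto simp: facet_of_def)
  obtain n k where n: "n \<noteq> 0" "K \<subseteq> {y. n \<bullet> y \<le> k}" "G = K \<inter> {y. n \<bullet> y = k}"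
    using facet_of_polyhedron[OF Kp Gf] .
  have xG: "x \<in> G" using x(1) rel_interior_subset by blast
  define U where "U = \<Union>{L \<in> \<K>. x \<notin> L}"
  have "closed U" unfolding U_def using fin poly(1) polytope_imp_closed by (intro closed_Union) auto
  moreover have "x \<notin> U" by (auto simp: U_def)
  ultimately have "open (interior P - U)" "x \<in> interior P - U" using x(2) by auto
  then obtain r where r: "0 < r" "ball x r \<subseteq> interior P - U" using open_contains_ball by blast
  define t where "t = r / (2 * norm n)"
  have t: "0 < t" using r n(1) by (simp add: t_def)
  define y where "y = x + t *\<^sub>R n"
  have "dist x y = r / 2" using n(1) r(1) by (simp add: y_def dist_norm t_def)
  then have "y \<in> interior P - U" using r by (metis half_gt_zero_iff in_mono mem_ball field_sum_of_halves less_add_same_cancel1)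
  then have yP: "y \<in> P" "y \<notin> U" using interior_subset by blast+
  obtain L where L: "L \<in> \<K>" "y \<in> L" using yP(1) un by blast
  have xL: "x \<in> L" using yP(2) L by (auto simp: U_def)
  have "n \<bullet> y = k + t * (n \<bullet> n)" using xG n(3) by (simp add: y_def inner_add_right)
  moreover have "0 < t * (n \<bullet> n)" using t n(1) by simp
  ultimately have "n \<bullet> y > k" by linarith
  then have "L \<noteq> K" using L(2) n(2) by force
  moreover have "G face_of L"
  proof -
    have GC: "G \<in> cells_of \<K>" "L \<in> cells_of \<K>"
      using G(1,2) cells_of_self[OF L(1) polytope_imp_convex[OF poly(1)[OF L(1)]]] by (auto simp: cells_of_def)
    then have f: "(G \<inter> L) face_of G" "(G \<inter> L) face_of L" using C unfolding polytopal_complex_def by blast+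
    have "G \<subseteq> G \<inter> L" by (rule subset_of_face_of[OF f(1) order_refl]) (use x(1) xG xL in blast)
    then have "G \<inter> L = G" by blast
    then show ?thesis using f(2) by simp
  qed
  ultimately show ?thesis using L(1) by blast
qed

section \<open>The subdivision\<close>

locale subdivided = balanced3 +
  fixes e :: real
  assumes e_pos: "0 < e"
    and crossing: "\<And>F M j. F \<in> facets \<Longrightarrow> 9 \<le> M \<Longrightarrow> M < 14 \<Longrightarrow> j < 4 \<Longrightarrow>
      0 < cross_coeff (\<lambda>i. frame.bary (corner F) i (corner (mate F) 3)) e M j"
begin

lemma frame_F: "F \<in> facets \<Longrightarrow> frame (corner F) e"
  by (rule frame_corner[OF e_pos])

abbreviation nd :: "(real^3) set \<Rightarrow> nat \<Rightarrow> real^3" where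
  "nd F \<equiv> node (corner F) e"

abbreviation Kc :: "(real^3) set \<Rightarrow> nat \<Rightarrow> (real^3) set" where
  "Kc F \<equiv> hull_cell (corner F) e"

lemma nd_shared: "l \<in> face_labels (shared F G) \<Longrightarrow> nd F l = nd G l"
  by (rule node_cong) (auto simp: shared_def)

lemma Kc_subset_tetra: "F \<in> facets \<Longrightarrow> M < 14 \<Longrightarrow> Kc F M \<subseteq> tetra F"
  unfolding tetra_def by (rule frame.K_subset[OF frame_F])

text \<open>The intersection lies in the common face of the tetrahedra, where the nodes of
  \<open>F\<close> and \<open>G\<close> agree. There the cell of \<open>G\<close> can be replaced by
  the cell of \<open>F\<close> with the same number, which reduces the claim to one
  tetrahedron.\<close>

lemma Kc_Int:
  assumes F: "F \<in> facets" "G \<in> facets" and M: "M < 14" "M' < 14"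
  shows "Kc F M \<inter> Kc G M' = convex hull (nd F ` (set (cells ! M) \<inter> set (cells ! M') \<inter> face_labels (shared F G)))"
    and "(Kc F M \<inter> Kc G M') face_of Kc F M"
proof -
  let ?J = "shared F G"
  have J: "?J \<subseteq> {..<4}" by (auto simp: shared_def)
  have cJ: "corner F ` ?J = corner G ` ?J" by (rule image_cong) (auto simp: shared_def)
  note A = frame.K_Int_face[OF frame_F[OF F(1)] _ _ J]
  note B = frame.K_Int_face[OF frame_F[OF F(2)] _ _ J]
  have "Kc F M \<inter> Kc G M' \<subseteq> tetra F \<inter> tetra G" using Kc_subset_tetra F M by blast
  then have sub: "Kc F M \<inter> Kc G M' \<subseteq> convex hull (corner F ` ?J)" unfolding tetra_Int[OF F] .
  have "nd F ` (set (cells ! M') \<inter> face_labels ?J) = nd G ` (set (cells ! M') \<inter> face_labels ?J)"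
    by (rule image_cong) (auto intro: nd_shared)
  then have "Kc F M' \<inter> convex hull (corner F ` ?J) = Kc G M' \<inter> convex hull (corner F ` ?J)"
    using A(1)[OF M(2) M(2)] B(1)[OF M(2) M(2)] cJ by simp
  then have "Kc F M \<inter> Kc G M' = Kc F M \<inter> Kc F M' \<inter> convex hull (corner F ` ?J)" using sub by blast
  then show "Kc F M \<inter> Kc G M' = convex hull (nd F ` (set (cells ! M) \<inter> set (cells ! M') \<inter> face_labels ?J))"
    using A(1)[OF M] by simp
  then show "(Kc F M \<inter> Kc G M') face_of Kc F M" using A(2)[OF M] by simp
qed

section \<open>The bases of the pyramids\<close>

definition base :: "(real^3) set \<Rightarrow> nat \<Rightarrow> (real^3) set" where
  "base F M = convex hull ((\<lambda>m. nd F (cells ! M ! m)) ` {..<4})"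

lemma base_label: "9 \<le> M \<Longrightarrow> M < 14 \<Longrightarrow> m < 4 \<Longrightarrow> cells ! M ! m \<in> set (cells ! M)"
  by (rule cell_nth) auto

lemma base_face: "F \<in> facets \<Longrightarrow> 9 \<le> M \<Longrightarrow> M < 14 \<Longrightarrow> base F M face_of Kc F M"
  using exposed_set_face(1)[OF pyramidal_base[OF frame.pyramid_cell[OF frame_F]]] frame.K_pyramid[OF frame_F]
  by (simp add: base_def)

lemma base_mate: assumes "F \<in> facets" "9 \<le> M" "M < 14" shows "base (mate F) M = base F M"
proof -
  have "nd (mate F) (cells ! M ! m) = nd F (cells ! M ! m)" if "m < 4" for m
  proof -
    have c0: "coords ! (cells ! M ! m) ! 3 = 0" by (rule apex_facts(3)[OF assms(2,3) that])
    have "coords ! (cells ! M ! m) ! i = 0" if "i < 4" "i \<notin> {..<3}" for i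
    proof -
      have "i = 3" using that by simp
      then show ?thesis using c0 by simp
    qed
    then have "cells ! M ! m \<in> face_labels (shared F (mate F))"
      unfolding shared_mate[OF assms(1)] face_labels_def using cell_label[OF assms(3) base_label[OF assms(2,3) that]] by simp
    then show ?thesis using nd_shared by simp
  qed
  then have "(\<lambda>m. nd (mate F) (cells ! M ! m)) ` {..<4} = (\<lambda>m. nd F (cells ! M ! m)) ` {..<4}"
    by (intro image_cong) simp_all
  then show ?thesis by (simp add: base_def)
qed

text \<open>By \<open>base_support\<close> the corners of a base involve all of \<open>p\<close>,
  \<open>a\<close>, \<open>b\<close>, so the tetrahedron of \<open>F\<close> shares the wall and
  \<open>F\<close> is \<open>G\<close> or its mate; \<open>base_unique\<close> then determines the
  cell.\<close>

lemma base_subset_cell: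
  assumes G: "G \<in> facets" "9 \<le> M'" "M' < 14" and F: "F \<in> facets" "M < 14" and sub: "base G M' \<subseteq> Kc F M"
  shows "M = M' \<and> (F = G \<or> F = mate G)"
proof -
  let ?J = "shared G F"
  have J: "?J \<subseteq> {..<4}" by (auto simp: shared_def)
  interpret A: frame "corner G" e by (rule frame_F[OF G(1)])
  have M'set: "M' \<in> set [9..<14]" using G by auto
  have y: "nd G (cells ! M' ! m) \<in> Kc F M" "cells ! M' ! m \<in> face_labels ?J" if m: "m < 4" for m
  proof -
    have l: "cells ! M' ! m < 18" by (rule cell_label[OF G(3) base_label[OF G(2,3) m]])
    have b: "nd G (cells ! M' ! m) \<in> base G M'" unfolding base_def using m by (intro hull_inc) auto
    then show yF: "nd G (cells ! M' ! m) \<in> Kc F M" using sub by blast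
    have "nd G (cells ! M' ! m) \<in> Kc G M'" using b base_face[OF G] face_of_imp_subset by blast
    then have "nd G (cells ! M' ! m) \<in> tetra G \<inter> tetra F"
      using yF Kc_subset_tetra[OF F] Kc_subset_tetra[OF G(1,3)] by blast
    then have h: "nd G (cells ! M' ! m) \<in> convex hull (corner G ` ?J)" unfolding tetra_Int[OF G(1) F(1)] .
    have "coords ! (cells ! M' ! m) ! i = 0" if i: "i < 4" "i \<notin> ?J" for i
    proof -
      have "A.bary i (nd G (cells ! M' ! m)) = 0" using h A.hull_iff_bary[OF J] i by simp
      then have "node_weight e (cells ! M' ! m) i = 0"
        using A.bary_pt[OF l i(1)] node_total_pos[OF e_pos l] by simp
      then show ?thesis using node_weight_0_iff[OF e_pos] by simp
    qed
    then show "cells ! M' ! m \<in> face_labels ?J" unfolding face_labels_def using l by simp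
  qed
  have sh: "i \<in> ?J" if i: "i < 3" for i
  proof (rule ccontr)
    assume "i \<notin> ?J"
    obtain m where m: "m < 4" "0 < coords ! (cells ! M' ! m) ! i"
      using list_ex_upt[OF list_all_upt[OF list_all_mem[OF base_support M'set] i]] by blast
    then show False using y(2)[OF m(1)] i \<open>i \<notin> ?J\<close> by (auto simp: face_labels_def)
  qed
  have "F = G \<or> F = mate G" using mate_cases[OF G(1) F(1)] sh[of 1] sh[of 2] by (auto simp: shared_def)
  moreover have "cells ! M' ! m \<in> set (cells ! M)" if m: "m < 4" for m
  proof -
    have "nd F (cells ! M' ! m) = nd G (cells ! M' ! m)" using nd_shared[OF y(2)[OF m]] by simp
    then show ?thesis
      using frame.pt_in_K[OF frame_F[OF F(1)] cell_label[OF G(3) base_label[OF G(2,3) m]] F(2)] y(1)[OF m] by simp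
  qed
  then have "list_all (\<lambda>l. l \<in> set (cells ! M)) (take 4 (cells ! M'))"
    unfolding list_all_length by simp
  then have "M = M'" using list_all_upt[OF list_all_mem[OF base_unique M'set] F(2)] by simp
  ultimately show ?thesis by simp
qed

section \<open>The glued octahedra\<close>

abbreviation strad :: "(real^3) set \<Rightarrow> nat \<Rightarrow> nat \<Rightarrow> real^3" where
  "strad F \<equiv> straddle (corner F) (corner (mate F)) e"

definition oct :: "(real^3) set \<Rightarrow> nat \<Rightarrow> (real^3) set" where
  "oct F M = convex hull (strad F M ` {..<6})"

lemma oct_props:
  assumes "F \<in> facets" "9 \<le> M" "M < 14"
  shows "octahedral (strad F M)" "oct F M = Kc F M \<union> Kc (mate F) M"
proof -
  have s: "corner F i = corner (mate F) i" if "i < 3" for i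
  proof -
    have "i \<in> shared F (mate F)" unfolding shared_mate[OF assms(1)] using that by simp
    then show ?thesis by (simp add: shared_def)
  qed
  note S = straddle_octahedral[OF frame_F[OF assms(1)] frame_F[OF mate_facet(1)[OF assms(1)]] s assms(2,3)
      mate_opposite_side[OF assms(1) e_pos] crossing[OF assms]]
  show "octahedral (strad F M)" "oct F M = Kc F M \<union> Kc (mate F) M" unfolding oct_def using S by simp_all
qed

lemma oct_mate: "F \<in> facets \<Longrightarrow> 9 \<le> M \<Longrightarrow> M < 14 \<Longrightarrow> oct (mate F) M = oct F M"
  using oct_props(2)[of F M] oct_props(2)[of "mate F" M] mate_facet(1)[of F] mate_mate[of F] by auto

lemma strad_vertex: "m < 5 \<Longrightarrow> strad F M m = nd F (cells ! M ! m)"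
  by (simp add: straddle_def)

text \<open>Every other face of the pyramid lies in a side triangle, which is still a proper face of
  the glued octahedron and misses its relative interior.\<close>

lemma oct_rel_interior_aux:
  assumes F: "F \<in> facets" "9 \<le> M" "M < 14" and x: "x \<in> rel_interior (oct F M)" "x \<in> Kc F M"
  shows "x \<in> rel_interior (Kc F M) \<or> x \<in> rel_interior (base F M)"
proof -
  interpret A: frame "corner F" e by (rule frame_F[OF F(1)])
  obtain G where G: "G face_of Kc F M" "x \<in> rel_interior G"
    using rel_interior_face_exists[OF A.K_polytope x(2)] .
  have G': "G face_of convex hull (A.vertex M ` {..<5})" using G(1) A.K_pyramid[OF F(2,3)] by simp
  show ?thesis
  proof (rule pyramidal_face_cases[OF A.pyramid_cell[OF F(2,3)] G'])
    assume "G = convex hull (A.vertex M ` {..<5})"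
    then show ?thesis using G(2) A.K_pyramid[OF F(2,3)] by simp
  next
    assume "G = convex hull (A.vertex M ` {..<4})"
    then show ?thesis using G(2) by (simp add: base_def)
  next
    fix i j A assume ij: "i \<in> {0,1::nat}" "j \<in> {2,3::nat}" "A \<subseteq> {i,j,4}" and A: "G = convex hull (A.vertex M ` A)"
    let ?T = "convex hull (strad F M ` {i,j,4})"
    have s: "{i,j,4} \<in> octahedron_sets" using ij by (auto simp: octahedron_sets_def)
    have "?T \<in> faces (convex hull (strad F M ` {..<6}))"
      using octahedral_faces(1)[OF oct_props(1)[OF F]] s by blast
    then have T: "?T face_of oct F M" by (simp add: faces_def oct_def)
    have l: "(5::nat) \<in> {..<6}" "5 \<notin> {i,j,4}" using ij by auto
    then have "{i,j,4} \<noteq> {..<6}" by blast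
    then have "\<not> {..<6} \<subseteq> {i,j,4}" using ij by auto
    then have "?T \<noteq> oct F M"
      using octahedral_hull_subset_iff[OF oct_props(1)[OF F] _ s, of "{..<6}"] by (auto simp: octahedron_sets_def oct_def)
    then have dis: "?T \<inter> rel_interior (oct F M) = {}" by (rule face_of_disjoint_rel_interior[OF T])
    have "A.vertex M ` A \<subseteq> strad F M ` {i,j,4}"
    proof
      fix y assume "y \<in> A.vertex M ` A"
      then obtain m where m: "m \<in> A" "y = A.vertex M m" by blast
      then have "m \<in> {i,j,4}" using ij by blast
      moreover have "m < 5" using calculation ij by auto
      ultimately show "y \<in> strad F M ` {i,j,4}" using strad_vertex[of m F M] m(2) by (metis image_eqI)
    qed
    then have "G \<subseteq> ?T" unfolding A by (rule hull_mono)
    then have "x \<in> ?T" using G(2) rel_interior_subset by blast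
    then show ?thesis using dis x(1) by blast
  qed
qed

lemma oct_rel_interior:
  assumes F: "F \<in> facets" "9 \<le> M" "M < 14" and x: "x \<in> rel_interior (oct F M)"
  obtains R where "R \<in> {Kc F M, Kc (mate F) M, base F M}" "x \<in> rel_interior R"
proof (cases "x \<in> Kc F M")
  case True
  then show thesis using oct_rel_interior_aux[OF F x] that by blast
next
  case False
  then have "x \<in> Kc (mate F) M" using x rel_interior_subset oct_props(2)[OF F] by blast
  moreover have "x \<in> rel_interior (oct (mate F) M)" using x oct_mate[OF F] by simp
  ultimately have "x \<in> rel_interior (Kc (mate F) M) \<or> x \<in> rel_interior (base F M)"
    using oct_rel_interior_aux[OF mate_facet(1)[OF F(1)] F(2,3)] base_mate[OF F] by simp
  then show thesis using that by blast
qed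

text \<open>A proper face omits one of the two antipodal apexes, so it lies in one pyramid; it
  contains no diagonal of the base, hence not the base.\<close>

lemma oct_proper_face:
  assumes F: "F \<in> facets" "9 \<le> M" "M < 14" and C: "C face_of oct F M" "C \<noteq> oct F M"
  shows "C face_of Kc F M \<or> C face_of Kc (mate F) M" "\<not> base F M \<subseteq> C"
proof -
  have "C \<in> faces (convex hull (strad F M ` {..<6}))" using C(1) by (simp add: faces_def oct_def)
  then obtain A where A: "A \<in> octahedron_sets" "C = convex hull (strad F M ` A)"
    using octahedral_faces(1)[OF oct_props(1)[OF F]] by auto
  have "A \<noteq> {..<6}" using C(2) A(2) by (auto simp: oct_def)
  then have A': "A \<subseteq> {..<6}" "\<not> {4,5} \<subseteq> A" using A(1) by (auto simp: octahedron_sets_def)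
  have mem: "strad F M m \<in> Kc F M" if "m < 5" for m
    unfolding strad_vertex[OF that] hull_cell_def using cell_nth[OF F(3), of m] that F(2) by (intro hull_inc imageI) auto
  have mem': "strad F M m \<in> Kc (mate F) M" if "m < 6" "m \<noteq> 4" for m
  proof (cases "m = 5")
    case True
    have "strad F M m = nd (mate F) (cells ! M ! 4)" using True by (simp add: straddle_def)
    then show ?thesis unfolding hull_cell_def using cell_nth[OF F(3), of 4] F(2) by (auto intro!: hull_inc)
  next
    case False
    then have m: "m < 4" using that by simp
    have "strad F M m \<in> base F M" unfolding base_def using m strad_vertex[of m F M] by (intro hull_inc image_eqI[of _ _ m]) auto
    then show ?thesis using base_mate[OF F] base_face[OF mate_facet(1)[OF F(1)] F(2,3)] face_of_imp_subset by blast
  qed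
  have conv: "convex (Kc G M)" for G unfolding hull_cell_def by simp
  have "C \<subseteq> Kc F M \<or> C \<subseteq> Kc (mate F) M"
  proof (cases "5 \<in> A")
    case True
    then have "4 \<notin> A" using A'(2) by simp
    then have "strad F M ` A \<subseteq> Kc (mate F) M" using A'(1) mem' by blast
    then show ?thesis unfolding A(2) using hull_minimal[of _ _ convex] conv by blast
  next
    case False
    have "m < 5" if "m \<in> A" for m
    proof -
      have "m < 6" "m \<noteq> 5" using A'(1) that False by auto
      then show ?thesis by simp
    qed
    then have "strad F M ` A \<subseteq> Kc F M" using mem by blast
    then show ?thesis unfolding A(2) using hull_minimal[of _ _ convex] conv by blast
  qed
  then show "C face_of Kc F M \<or> C face_of Kc (mate F) M"
    using face_of_subset[OF C(1)] oct_props(2)[OF F] by blast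
  show "\<not> base F M \<subseteq> C"
  proof
    assume b: "base F M \<subseteq> C"
    have "strad F M m \<in> base F M" if "m < 4" for m
      unfolding base_def using that strad_vertex[of m F M] by (intro hull_inc image_eqI[of _ _ m]) auto
    from this[of 0] this[of 1] have "strad F M ` {0,1} \<subseteq> C" using b by auto
    then have "C = oct F M" using octahedral_closure[OF oct_props(1)[OF F]] C(1) unfolding oct_def by blast
    then show False using C(2) by simp
  qed
qed

text \<open>The refinement before gluing, with the pyramids as cells. That relative interiors are
  disjoint is known here and carried over to the final complex.\<close>

definition small_cells :: "(real^3) set set" where
  "small_cells = {Kc F M | F M. F \<in> facets \<and> M < 14}"

definition octs :: "(real^3) set set" where
  "octs = {Kc F M | F M. F \<in> facets \<and> M < 9} \<union> {oct F M | F M. F \<in> facets \<and> 9 \<le> M \<and> M < 14}"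

lemma Kc_polytope: "polytope (Kc F M)"
  unfolding hull_cell_def by (rule polytope_convex_hull) simp

lemma small_complex: "polytopal_complex (cells_of small_cells)"
proof (rule polytopal_complex_cells_of)
  have "small_cells = (\<lambda>(F,M). Kc F M) ` (facets \<times> {..<14})" by (force simp: small_cells_def)
  then show "finite small_cells" using finite_facets by simp
  show "polytope K" if "K \<in> small_cells" for K using that Kc_polytope by (auto simp: small_cells_def)
  show "(K \<inter> L) face_of K" if "K \<in> small_cells" "L \<in> small_cells" for K L
    using that Kc_Int(2) by (auto simp: small_cells_def)
qed

lemma Kc_small: "F \<in> facets \<Longrightarrow> M < 14 \<Longrightarrow> Kc F M \<in> cells_of small_cells"
  by (rule cells_of_self[OF _ polytope_imp_convex[OF Kc_polytope]]) (unfold small_cells_def, blast)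

lemma octs_finite: "finite octs"
proof -
  have "octs \<subseteq> (\<lambda>(F,M). Kc F M) ` (facets \<times> {..<9}) \<union> (\<lambda>(F,M). oct F M) ` (facets \<times> {..<14})"
    by (auto simp: octs_def)
  then show ?thesis by (rule finite_subset) (use finite_facets in simp)
qed

lemma octs_octahedral:
  assumes "K \<in> octs" obtains Q where "octahedral Q" "K = convex hull (Q ` {..<6})"
proof -
  have "(\<exists>F M. F \<in> facets \<and> M < 9 \<and> K = Kc F M) \<or> (\<exists>F M. F \<in> facets \<and> 9 \<le> M \<and> M < 14 \<and> K = oct F M)"
    using assms by (auto simp: octs_def)
  then show thesis
  proof (elim disjE exE conjE)
    fix F M assume F: "F \<in> facets" "M < 9" "K = Kc F M"
    show thesis
      by (rule that[OF frame.octahedron_cell[OF frame_F[OF F(1)] F(2)]]) (simp add: F(3) frame.K_octahedron[OF frame_F[OF F(1)] F(2)])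
  next
    fix F M assume F: "F \<in> facets" "9 \<le> M" "M < 14" "K = oct F M"
    show thesis by (rule that[OF oct_props(1)[OF F(1-3)]]) (simp add: F(4) oct_def)
  qed
qed

lemma octs_polytope: "K \<in> octs \<Longrightarrow> polytope K"
  by (erule octs_octahedral) (simp add: polytope_convex_hull)

lemma octs_aff_dim: "K \<in> octs \<Longrightarrow> aff_dim K = 3"
  by (erule octs_octahedral) (simp add: octahedral_aff_dim)

lemma octs_cross_polytope: "K \<in> octs \<Longrightarrow> cross_polytope K"
  by (erule octs_octahedral) (simp add: octahedral_cross_polytope)

text \<open>Gluing removes the pyramids and their bases from the refinement, which are exactly the
  cells that contain a base.\<close>

definition free_of_bases :: "(real^3) set \<Rightarrow> bool" where
  "free_of_bases C \<longleftrightarrow> (\<forall>G\<in>facets. \<forall>M. 9 \<le> M \<longrightarrow> M < 14 \<longrightarrow> \<not> base G M \<subseteq> C)"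

lemma octs_cell_cases:
  assumes "C \<in> cells_of octs"
  shows "(\<exists>F\<in>facets. \<exists>M. 9 \<le> M \<and> M < 14 \<and> C = oct F M) \<or> C \<in> cells_of small_cells \<and> free_of_bases C"
proof -
  have "(\<exists>F M. F \<in> facets \<and> M < 9 \<and> C face_of Kc F M) \<or> (\<exists>F M. F \<in> facets \<and> 9 \<le> M \<and> M < 14 \<and> C face_of oct F M)"
    using assms by (auto simp: octs_def cells_of_def)
  then show ?thesis
  proof (elim disjE exE conjE)
    fix F M assume F: "F \<in> facets" "M < 9" "C face_of Kc F M"
    have M14: "M < 14" using F by simp
    have "C \<in> cells_of small_cells" using cells_of_face[OF Kc_small[OF F(1) M14] F(3)] .
    moreover have "\<not> base G M' \<subseteq> C" if "G \<in> facets" "9 \<le> M'" "M' < 14" for G M'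
    proof
      assume "base G M' \<subseteq> C"
      then have "base G M' \<subseteq> Kc F M" using face_of_imp_subset[OF F(3)] by blast
      then show False using base_subset_cell[OF that F(1) M14] F(2) that(2) by simp
    qed
    ultimately show ?thesis by (auto simp: free_of_bases_def)
  next
    fix F M assume F: "F \<in> facets" "9 \<le> M" "M < 14" "C face_of oct F M"
    show ?thesis
    proof (cases "C = oct F M")
      case False
      note P = oct_proper_face[OF F False]
      obtain F' where F': "F' \<in> facets" "F' = F \<or> F' = mate F" "C face_of Kc F' M" using P(1) F(1) mate_facet(1)[OF F(1)] by blast
      have "C \<in> cells_of small_cells" using cells_of_face[OF Kc_small[OF F'(1) F(3)] F'(3)] .
      moreover have "\<not> base G M' \<subseteq> C" if G: "G \<in> facets" "9 \<le> M'" "M' < 14" for G M'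
      proof
        assume b: "base G M' \<subseteq> C"
        then have "base G M' \<subseteq> Kc F' M" using face_of_imp_subset[OF F'(3)] by blast
        then have e: "M = M'" "F' = G \<or> F' = mate G" using base_subset_cell[OF G F'(1) F(3)] by auto
        have "base G M' = base F' M" using e base_mate[OF G] by auto
        also have "\<dots> = base F M" using F'(2) base_mate[OF F(1-3)] by auto
        finally show False using P(2) b by simp
      qed
      ultimately show ?thesis by (auto simp: free_of_bases_def)
    qed (use F in blast)
  qed
qed

lemma piece_props:
  assumes F: "F \<in> facets" "9 \<le> M" "M < 14" and R: "R \<in> {Kc F M, Kc (mate F) M, base F M}"
  shows "R \<in> cells_of small_cells" "base F M \<subseteq> R" "\<exists>F'\<in>facets. (F' = F \<or> F' = mate F) \<and> R \<subseteq> Kc F' M"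
proof -
  have b: "base F M \<subseteq> Kc F M" "base F M \<subseteq> Kc (mate F) M"
    using base_face[OF F] base_face[OF mate_facet(1)[OF F(1)] F(2,3)] base_mate[OF F] face_of_imp_subset by auto
  have "base F M \<in> cells_of small_cells" by (rule cells_of_face[OF Kc_small[OF F(1,3)] base_face[OF F]])
  then show "R \<in> cells_of small_cells" using R Kc_small[OF F(1,3)] Kc_small[OF mate_facet(1)[OF F(1)] F(3)] by blast
  show "base F M \<subseteq> R" using R b by blast
  show "\<exists>F'\<in>facets. (F' = F \<or> F' = mate F) \<and> R \<subseteq> Kc F' M"
    using R b(1) F(1) mate_facet(1)[OF F(1)] by blast
qed

text \<open>The pieces of the two octahedra with \<open>x\<close> in their relative interiors
  coincide in the refinement. Hence the base of one octahedron lies in a pyramid of the other, and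
  \<open>base_subset_cell\<close> applies.\<close>

lemma oct_common_point:
  assumes F: "F \<in> facets" "9 \<le> M" "M < 14" and G: "G \<in> facets" "9 \<le> M'" "M' < 14"
    and x: "x \<in> rel_interior (oct F M)" "x \<in> rel_interior (oct G M')"
  shows "M = M' \<and> (G = F \<or> G = mate F)"
proof -
  obtain R where R: "R \<in> {Kc F M, Kc (mate F) M, base F M}" "x \<in> rel_interior R" using oct_rel_interior[OF F x(1)] .
  obtain R' where R': "R' \<in> {Kc G M', Kc (mate G) M', base G M'}" "x \<in> rel_interior R'" using oct_rel_interior[OF G x(2)] .
  have "R = R'"
    by (rule polytopal_complex_rel_interior[OF small_complex piece_props(1)[OF F R(1)] piece_props(1)[OF G R'(1)] R(2) R'(2)])
  moreover obtain G' where G': "G' \<in> facets" "G' = G \<or> G' = mate G" "R' \<subseteq> Kc G' M'" using piece_props(3)[OF G R'(1)] by blast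
  ultimately have "base F M \<subseteq> Kc G' M'" using piece_props(2)[OF F R(1)] by blast
  then have e: "M' = M" "G' = F \<or> G' = mate F" using base_subset_cell[OF F G'(1) G(3)] by auto
  have "G = F \<or> G = mate F" using e(2) G'(2) mate_mate[OF G(1)] mate_mate[OF F(1)] by metis
  then show ?thesis using e(1) by simp
qed

text \<open>A glued octahedron and a surviving small cell have disjoint relative interiors: the
  piece at a common point would equal the small cell, yet every piece contains a base. The other
  cases are \<open>oct_common_point\<close> and the refinement itself.\<close>

lemma octs_complex: "polytopal_complex (cells_of octs)"
proof (rule polytopal_complex_if_rel_interiors_disjoint)
  show "finite (cells_of octs)" by (rule cells_of_finite[OF octs_finite octs_polytope])
  show "polytope C" if "C \<in> cells_of octs" for C by (rule cells_of_polytope[OF octs_polytope that])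
  show "F \<in> cells_of octs" if "C \<in> cells_of octs" "F face_of C" for C F by (rule cells_of_face[OF that])
  have mixed: False if F: "F \<in> facets" "9 \<le> M" "M < 14" and x: "x \<in> rel_interior (oct F M)" "x \<in> rel_interior D"
    and D: "D \<in> cells_of small_cells" "free_of_bases D" for F M D x
  proof -
    obtain R where R: "R \<in> {Kc F M, Kc (mate F) M, base F M}" "x \<in> rel_interior R" using oct_rel_interior[OF F x(1)] .
    have "R = D" by (rule polytopal_complex_rel_interior[OF small_complex piece_props(1)[OF F R(1)] D(1) R(2) x(2)])
    then show False using piece_props(2)[OF F R(1)] D(2) F by (auto simp: free_of_bases_def)
  qed
  fix C D x assume C: "C \<in> cells_of octs" "x \<in> rel_interior C" and D: "D \<in> cells_of octs" "x \<in> rel_interior D"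
  from octs_cell_cases[OF C(1)] octs_cell_cases[OF D(1)] show "C = D"
  proof (elim disjE bexE exE conjE)
    fix F M G M' assume F: "F \<in> facets" "9 \<le> M" "M < 14" "C = oct F M" and G: "G \<in> facets" "9 \<le> M'" "M' < 14" "D = oct G M'"
    have "M = M' \<and> (G = F \<or> G = mate F)" using oct_common_point[OF F(1-3) G(1-3)] C(2) D(2) F(4) G(4) by simp
    then show "C = D" using F G oct_mate[OF F(1-3)] by auto
  next
    fix F M assume "F \<in> facets" "9 \<le> M" "M < 14" "C = oct F M" "D \<in> cells_of small_cells" "free_of_bases D"
    then show "C = D" using mixed[of F M x D] C(2) D(2) by blast
  next
    fix F M assume "F \<in> facets" "9 \<le> M" "M < 14" "D = oct F M" "C \<in> cells_of small_cells" "free_of_bases C"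
    then show "C = D" using mixed[of F M x C] C(2) D(2) by blast
  next
    assume "C \<in> cells_of small_cells" "D \<in> cells_of small_cells"
    then show "C = D" using polytopal_complex_rel_interior[OF small_complex _ _ C(2) D(2)] by blast
  qed
qed

lemma octs_maximal: "maximal_cells (cells_of octs) = octs" "{C \<in> cells_of octs. aff_dim C = 3} = octs"
  using maximal_cells_cells_of[OF octs_polytope octs_aff_dim octs_complex] by simp_all

lemma octs_Union: "\<Union>octs = P"
proof
  show "\<Union>octs \<subseteq> P"
  proof (rule Union_least)
    fix K assume "K \<in> octs"
    then have "(\<exists>F M. F \<in> facets \<and> M < 9 \<and> K = Kc F M) \<or> (\<exists>F M. F \<in> facets \<and> 9 \<le> M \<and> M < 14 \<and> K = oct F M)"
      by (auto simp: octs_def)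
    then show "K \<subseteq> P"
    proof (elim disjE exE conjE)
      fix F M assume F: "F \<in> facets" "M < 9" "K = Kc F M"
      then show "K \<subseteq> P" using Kc_subset_tetra[OF F(1), of M] tetra_subset[OF F(1)] by auto
    next
      fix F M assume F: "F \<in> facets" "9 \<le> M" "M < 14" "K = oct F M"
      then show "K \<subseteq> P" unfolding F(4) oct_props(2)[OF F(1-3)]
        using Kc_subset_tetra[OF F(1,3)] tetra_subset[OF F(1)] Kc_subset_tetra[OF mate_facet(1)[OF F(1)] F(3)]
          tetra_subset[OF mate_facet(1)[OF F(1)]] by blast
    qed
  qed
  show "P \<subseteq> \<Union>octs"
  proof
    fix x assume "x \<in> P"
    then obtain F where F: "F \<in> facets" "x \<in> tetra F" using tetra_union by blast
    then obtain M where M: "M < 14" "x \<in> Kc F M"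
      using frame.K_union[OF frame_F[OF F(1)]] unfolding tetra_def by blast
    show "x \<in> \<Union>octs"
    proof (cases "M < 9")
      case True then show ?thesis using F(1) M unfolding octs_def by blast
    next
      case False
      then have "x \<in> oct F M" "9 \<le> M" using oct_props(2)[OF F(1) _ M(1)] M(2) by auto
      then show ?thesis using F(1) M(1) unfolding octs_def by blast
    qed
  qed
qed

text \<open>For different facets the tetrahedra meet in the hull of at most three corners, too thin
  for a three-dimensional cell.\<close>

lemma Kc_subset_imp:
  assumes F: "F \<in> facets" "M < 14" and G: "G \<in> facets" "M' < 14" and s: "Kc F M \<subseteq> Kc G M'"
  shows "F = G \<and> M = M'"
proof -
  interpret A: frame "corner F" e by (rule frame_F[OF F(1)])
  have "F = G"
  proof (rule ccontr)
    assume "F \<noteq> G"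
    then have "\<not> {1,2,3} \<subseteq> shared F G" using facet_eq_if_shared[OF F(1) G(1)] by blast
    then have c: "card (shared F G) \<le> 3"
    proof -
      have "shared F G \<noteq> {..<4}"
      proof
        assume "shared F G = {..<4}"
        then have "{1,2,3} \<subseteq> shared F G" by simp
        then show False using \<open>\<not> {1,2,3} \<subseteq> shared F G\<close> by simp
      qed
      moreover have "shared F G \<subseteq> {..<4}" by (auto simp: shared_def)
      ultimately have "shared F G \<subset> {..<4}" by (rule psubsetI[rotated])
      then have "card (shared F G) < card {..<4::nat}" by (intro psubset_card_mono) auto
      then show ?thesis by simp
    qed
    have "finite (shared F G)" by (rule finite_subset[of _ "{..<4}"]) (auto simp: shared_def)
    then have "card (corner F ` shared F G) \<le> 3" using card_image_le c le_trans by blast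
    then have "aff_dim (corner F ` shared F G) \<le> 2"
      using aff_dim_le_card[of "corner F ` shared F G"] \<open>finite (shared F G)\<close> by simp
    moreover have "Kc F M \<subseteq> convex hull (corner F ` shared F G)"
      using s Kc_subset_tetra[OF F] Kc_subset_tetra[OF G] tetra_Int[OF F(1) G(1)] by blast
    ultimately have "aff_dim (Kc F M) \<le> 2"
      using aff_dim_subset[of "Kc F M" "convex hull (corner F ` shared F G)"] by (simp add: aff_dim_convex_hull)
    then show False using A.K_aff_dim[OF F(2)] by simp
  qed
  moreover have "l \<in> set (cells ! M')" if l: "l \<in> set (cells ! M)" for l
  proof (rule A.pt_in_K[OF cell_label[OF F(2) l] G(2)])
    have "nd F l \<in> Kc F M" unfolding hull_cell_def using l by (intro hull_inc) auto
    then show "nd F l \<in> Kc F M'" using s \<open>F = G\<close> by blast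
  qed
  then have "list_all (\<lambda>l. l \<in> set (cells ! M')) (cells ! M)" by (simp add: list_all_iff)
  then have "M' = M" using list_all_upt[OF list_all_upt[OF cells_antichain F(2)] G(2)] by simp
  ultimately show ?thesis by simp
qed

text \<open>Each facet has nine octahedra of its own, while the five glued ones are counted once for
  \<open>F\<close> and once for \<open>mate F\<close>; thus 23 = 2 * 9 + 5 after doubling.\<close>

lemma card_octs: "2 * card octs = 23 * card facets"
proof -
  let ?A = "(\<lambda>(F,M). Kc F M) ` (facets \<times> {..<9})" and ?X = "facets \<times> {9..<14::nat}"
  let ?f = "\<lambda>(F,M). oct F M"
  have oct: "octs = ?A \<union> ?f ` ?X" unfolding octs_def by force
  have "inj_on (\<lambda>(F,M). Kc F M) (facets \<times> {..<9})"
  proof (rule inj_onI)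
    fix x y assume "x \<in> facets \<times> {..<9::nat}" "y \<in> facets \<times> {..<9::nat}" and eq: "(\<lambda>(F,M). Kc F M) x = (\<lambda>(F,M). Kc F M) y"
    then obtain F M G M' where F: "x = (F,M)" "F \<in> facets" "M < 9" and G: "y = (G,M')" "G \<in> facets" "M' < 9" by auto
    then show "x = y" using Kc_subset_imp[of F M G M'] eq by simp
  qed
  then have A: "card ?A = 9 * card facets" by (simp add: card_image card_cartesian_product)
  have ri: "rel_interior (oct F M) \<noteq> {}" if "F \<in> facets" "9 \<le> M" "M < 14" for F M
  proof -
    have "oct F M \<in> octs" using that unfolding octs_def by blast
    then have "oct F M \<noteq> {}" "convex (oct F M)" using octs_aff_dim octs_polytope polytope_imp_convex by force+
    then show ?thesis using rel_interior_eq_empty by blast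
  qed
  have eqv: "oct F M = oct G M' \<longleftrightarrow> M = M' \<and> (G = F \<or> G = mate F)"
    if F: "F \<in> facets" "9 \<le> M" "M < 14" and G: "G \<in> facets" "9 \<le> M'" "M' < 14" for F M G M'
  proof
    assume eq: "oct F M = oct G M'"
    obtain x where "x \<in> rel_interior (oct F M)" using ri[OF F] by blast
    then show "M = M' \<and> (G = F \<or> G = mate F)" using oct_common_point[OF F G] eq by simp
  next
    assume "M = M' \<and> (G = F \<or> G = mate F)"
    then show "oct F M = oct G M'" using oct_mate[OF F] by (elim conjE disjE) simp_all
  qed
  have fib: "card {y \<in> ?X. ?f y = z} = 2" if z: "z \<in> ?f ` ?X" for z
  proof -
    obtain F M where F: "F \<in> facets" "9 \<le> M" "M < 14" "z = oct F M" using z by auto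
    have "{y \<in> ?X. ?f y = z} = {(F,M), (mate F, M)}"
    proof (intro equalityI subsetI)
      fix y assume y: "y \<in> {y \<in> ?X. ?f y = z}"
      then obtain G M' where G: "y = (G,M')" "G \<in> facets" "9 \<le> M'" "M' < 14" "oct G M' = z" by auto
      have "M = M' \<and> (G = F \<or> G = mate F)" using eqv[OF F(1-3) G(2-4)] F(4) G(5) by simp
      then show "y \<in> {(F,M), (mate F, M)}" using G(1) by blast
    next
      fix y assume "y \<in> {(F,M), (mate F, M)}"
      then show "y \<in> {y \<in> ?X. ?f y = z}" using F oct_mate[OF F(1-3)] mate_facet(1)[OF F(1)] by auto
    qed
    then show ?thesis using mate_pair(2)[OF F(1)] by simp
  qed
  have "card ?X = (\<Sum>z\<in>?f ` ?X. card {y \<in> ?X. ?f y = z})"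
  proof -
    have "(\<Sum>z\<in>?f ` ?X. \<Sum>y\<in>{y \<in> ?X. ?f y = z}. 1) = (\<Sum>y\<in>?X. (1::nat))"
      by (rule sum.group) (use finite_facets in auto)
    then show ?thesis by simp
  qed
  also have "\<dots> = 2 * card (?f ` ?X)" using fib by simp
  finally have B: "2 * card (?f ` ?X) = 5 * card facets" by (simp add: card_cartesian_product)
  have "?A \<inter> ?f ` ?X = {}"
  proof (rule ccontr)
    assume "?A \<inter> ?f ` ?X \<noteq> {}"
    then obtain F M G M' where F: "F \<in> facets" "M < 9" and G: "G \<in> facets" "9 \<le> M'" "M' < 14" and eq: "Kc F M = oct G M'" by auto
    have "Kc G M' \<subseteq> Kc F M" using eq oct_props(2)[OF G] by blast
    then show False using Kc_subset_imp[of G M' F M] F G by auto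
  qed
  then have "card octs = card ?A + card (?f ` ?X)" unfolding oct using finite_facets by (intro card_Un_disjoint) auto
  then show ?thesis using A B by simp
qed

section \<open>The boundary of the subdivision\<close>

lemma facet_face_of_cell: assumes F: "F \<in> facets" shows "F face_of Kc F 0"
proof -
  interpret A: frame "corner F" e by (rule frame_F[OF F])
  have J: "{1,2,3} \<subseteq> {..<4::nat}" by auto
  have "list_all (\<lambda>l. l \<in> set (cells ! 0)) [1,2,3]" using list_all_upt[OF outer_unique, of 0] by simp
  then have m: "i \<in> set (cells ! 0)" if "i \<in> {1,2,3}" for i using that by auto
  have n: "corner F i = nd F i" if "i \<in> {1,2,3}" for i using node_unit[OF e_pos, of i "corner F"] that by auto
  have "corner F ` {1,2,3} \<subseteq> Kc F 0"
  proof
    fix y assume "y \<in> corner F ` {1,2,3}"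
    then obtain i where i: "i \<in> {1,2,3}" "y = corner F i" by blast
    then have "y \<in> nd F ` set (cells ! 0)" using m[OF i(1)] n[OF i(1)] by blast
    then show "y \<in> Kc F 0" unfolding hull_cell_def by (rule hull_inc)
  qed
  then have "convex hull (corner F ` {1,2,3}) \<subseteq> Kc F 0"
    by (rule hull_minimal) (simp add: hull_cell_def)
  then have "Kc F 0 \<inter> Kc F 0 \<inter> convex hull (corner F ` {1,2,3}) = F" using facet_eq_corner_hull[OF F] by blast
  then show ?thesis using A.K_Int_face[of 0 0, OF _ _ J] by simp
qed

lemma facet_subset_cell:
  assumes F: "F \<in> facets" and G: "G \<in> facets" "M < 14" and s: "F \<subseteq> Kc G M"
  shows "G = F \<and> M = 0"
proof -
  interpret A: frame "corner F" e by (rule frame_F[OF F])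
  have J: "shared F G \<subseteq> {..<4}" by (auto simp: shared_def)
  have i: "corner F i \<in> Kc G M \<and> i \<in> shared F G" if i: "0 < i" "i < 4" for i
  proof -
    have "corner F i \<in> F" using corner_in_facet[OF F i] facet_vertices[OF F] by blast
    then have c: "corner F i \<in> Kc G M" using s by blast
    have "corner F i \<in> tetra F" unfolding tetra_def using i by (intro hull_inc) auto
    then have "corner F i \<in> tetra F \<inter> tetra G" using c Kc_subset_tetra[OF G] by blast
    then have "corner F i \<in> convex hull (corner F ` shared F G)" unfolding tetra_Int[OF F G(1)] .
    then have "i \<notin> shared F G \<longrightarrow> A.bary i (corner F i) = 0" using A.hull_iff_bary[OF J] i by blast
    then have "i \<in> shared F G" using A.bary_vertex[OF i(2) i(2)] by auto
    then show ?thesis using c by blast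
  qed
  then have "{1,2,3} \<subseteq> shared F G" by auto
  then have FG: "F = G" by (rule facet_eq_if_shared[OF F G(1)])
  have "i \<in> set (cells ! M)" if "0 < i" "i < 4" for i
  proof (rule A.pt_in_K[OF _ G(2)])
    show "i < 18" using that by simp
    show "nd F i \<in> Kc F M" using i[OF that] FG node_unit[OF e_pos that(2), of "corner F"] by simp
  qed
  then have "list_all (\<lambda>l. l \<in> set (cells ! M)) [1,2,3]" by simp
  then have "M = 0" using list_all_upt[OF outer_unique G(2)] by simp
  then show ?thesis using FG by simp
qed

text \<open>If \<open>F\<close> were a face of a glued octahedron, a relative interior point of
  \<open>F\<close> would be in one of its pyramids, which would then contain \<open>F\<close>; but
  \<open>F\<close> fits only into cell 0.\<close>

lemma facet_unique_cell:
  assumes F: "F \<in> facets" and K: "K \<in> octs" "F face_of K" shows "K = Kc F 0"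
proof -
  have "(\<exists>G M. G \<in> facets \<and> M < 9 \<and> K = Kc G M) \<or> (\<exists>G M. G \<in> facets \<and> 9 \<le> M \<and> M < 14 \<and> K = oct G M)"
    using K(1) by (auto simp: octs_def)
  then show ?thesis
  proof (elim disjE exE conjE)
    fix G M assume G: "G \<in> facets" "M < 9" "K = Kc G M"
    then have "F \<subseteq> Kc G M" using face_of_imp_subset[OF K(2)] by simp
    then show ?thesis using facet_subset_cell[OF F G(1), of M] G by simp
  next
    fix G M assume G: "G \<in> facets" "9 \<le> M" "M < 14" "K = oct G M"
    have FC: "F \<in> cells_of small_cells" by (rule cells_of_face[OF Kc_small[OF F] facet_face_of_cell[OF F]]) simp
    have "rel_interior F \<noteq> {}" using facet_dim[OF F] rel_interior_eq_empty[OF face_of_imp_convex[OF facet_face[OF F]]] by auto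
    then obtain x where x: "x \<in> rel_interior F" by blast
    then have "x \<in> F" using rel_interior_subset by blast
    then have "x \<in> Kc G M \<union> Kc (mate G) M" using face_of_imp_subset[OF K(2)] oct_props(2)[OF G(1-3)] G(4) by blast
    then obtain G' where G': "G' \<in> facets" "x \<in> Kc G' M" using G(1) mate_facet(1)[OF G(1)] by blast
    have "(F \<inter> Kc G' M) face_of F"
      using small_complex FC Kc_small[OF G'(1) G(3)] unfolding polytopal_complex_def by blast
    then have "F \<subseteq> F \<inter> Kc G' M" by (rule subset_of_face_of[OF _ order_refl]) (use x G'(2) \<open>x \<in> F\<close> in blast)
    then have "F \<subseteq> Kc G' M" by blast
    then show ?thesis using facet_subset_cell[OF F G'(1) G(3)] G(2) by simp
  qed
qed

lemma Kc0_octs: "F \<in> facets \<Longrightarrow> Kc F 0 \<in> octs"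
  unfolding octs_def by (rule UnI1, rule CollectI, rule exI[of _ F], rule exI[of _ 0]) simp

text \<open>The families are equal because facets are not subdivided. A wall whose relative interior
  meets the interior of \<open>P\<close> has a second cell by
  \<open>interior_wall_two_cells\<close>; a wall of only one cell therefore lies in a facet and
  equals it by dimension.\<close>

lemma boundary_eq: "complex_boundary (cells_of octs) = boundary_complex P"
proof
  show "complex_boundary (cells_of octs) \<subseteq> boundary_complex P"
  proof
    fix X assume "X \<in> complex_boundary (cells_of octs)"
    then obtain G where G: "G \<in> cells_of octs" "aff_dim G = 2" "\<exists>!C. C \<in> octs \<and> G face_of C" "X face_of G"
      by (auto simp: complex_boundary_def octs_maximal(1))
    obtain K where K: "K \<in> octs" "G face_of K" using G(3) by blast
    have Gp: "polytope G" by (rule cells_of_polytope[OF octs_polytope G(1)])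
    have "rel_interior G \<noteq> {}" using G(2) rel_interior_eq_empty[OF polytope_imp_convex[OF Gp]] by auto
    then obtain x where x: "x \<in> rel_interior G" by blast
    have xG: "x \<in> G" using x rel_interior_subset by blast
    have GP: "G \<subseteq> P" using face_of_imp_subset[OF K(2)] K(1) octs_Union by blast
    have "x \<notin> interior P"
    proof
      assume "x \<in> interior P"
      then have "\<exists>L\<in>octs. L \<noteq> K \<and> G face_of L"
        using interior_wall_two_cells[OF octs_finite octs_polytope _ octs_Union octs_complex K _ x] octs_aff_dim G(2) by simp
      then show False using G(3) K by blast
    qed
    then have "x \<in> frontier P" using xG GP closure_subset by (auto simp: frontier_def)
    then obtain F where F: "F \<in> facets" "x \<in> F" using frontier_facets by blast
    have "G \<subseteq> F" by (rule subset_of_face_of[OF facet_face[OF F(1)] GP]) (use x F(2) in blast)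
    moreover have FC: "F \<in> cells_of octs" using facet_face_of_cell[OF F(1)] Kc0_octs[OF F(1)] by (auto simp: cells_of_def)
    then have "(G \<inter> F) face_of F" using octs_complex G(1) unfolding polytopal_complex_def by blast
    then have "G face_of F" using \<open>G \<subseteq> F\<close> by (simp add: Int_absorb2)
    then have "G = F" using face_aff_dim_eq[of F G] face_of_imp_convex[OF facet_face[OF F(1)]] facet_dim[OF F(1)] G(2) by simp
    then have "X face_of P" using G(4) facet_face[OF F(1)] face_of_trans by blast
    moreover have "X \<noteq> P"
    proof
      assume "X = P"
      then have "P \<subseteq> F" using face_of_imp_subset[OF G(4)] \<open>G = F\<close> by simp
      then show False using face_of_imp_subset[OF facet_face[OF F(1)]] facet_ne[OF F(1)] by blast
    qed
    ultimately show "X \<in> boundary_complex P" by (simp add: boundary_complex_def)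
  qed
  show "boundary_complex P \<subseteq> complex_boundary (cells_of octs)"
  proof
    fix X assume "X \<in> boundary_complex P"
    then have X: "X face_of P" "X \<noteq> P" by (auto simp: boundary_complex_def)
    obtain F where F: "F \<in> facets" "X \<subseteq> F"
    proof (cases "X = {}")
      case True then show thesis using that facets_nonempty by blast
    next
      case False
      then show thesis using face_of_polyhedron_subset_facet[OF polyhedron_P X(1) False X(2)] that by (auto simp: facets_def)
    qed
    have XF: "X face_of F" using face_of_face[OF facet_face[OF F(1)]] X(1) F(2) by blast
    have FC: "F \<in> cells_of octs" using facet_face_of_cell[OF F(1)] Kc0_octs[OF F(1)] by (auto simp: cells_of_def)
    have "\<exists>!C. C \<in> octs \<and> F face_of C"
      using facet_unique_cell[OF F(1)] Kc0_octs[OF F(1)] facet_face_of_cell[OF F(1)] by blast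
    then show "X \<in> complex_boundary (cells_of octs)"
      using FC facet_dim[OF F(1)] XF by (auto simp: complex_boundary_def octs_maximal(1))
  qed
qed

lemma proper_subdivision: "proper_cross_polytopal_subdivision (cells_of octs) P"
proof -
  have "cross_polytopal_complex (cells_of octs)"
    unfolding cross_polytopal_complex_def pure_complex_def octs_maximal(1)
    using octs_complex octs_aff_dim octs_cross_polytope by blast
  moreover have "\<Union>(cells_of octs) = P"
    by (rule trans[OF cells_of_Union octs_Union]) (rule polytope_imp_convex[OF octs_polytope])
  moreover have "boundary_complex P \<simeq>\<^sub>c boundary_complex P"
    unfolding face_poset_iso_def by (rule exI[of _ id]) simp
  ultimately show ?thesis
    by (simp add: proper_cross_polytopal_subdivision_def cross_polytopal_subdivision_def boundary_eq)
qed

lemma f_number_octs: "int (f_number 3 (cells_of octs)) = 23 * (int (card (vertices_of P)) - 2)"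
proof -
  have "f_number 3 (cells_of octs) = card octs" unfolding f_number_def using octs_maximal(2) by simp
  moreover have "2 * int (card octs) = 23 * int (card facets)" using arg_cong[OF card_octs, of int] by simp
  ultimately show ?thesis using card_facets by simp
qed

end

text \<open>There are finitely many facets, pyramids and base corners, and each condition holds for
  all sufficiently small \<open>e\<close>.\<close>

lemma (in balanced3) exists_flattening:
  "\<exists>e. subdivided P col p e"
proof -
  define \<delta> where "\<delta> F i = frame.bary (corner F) i (corner (mate F) 3)" for F i
  have "eventually (\<lambda>e. \<forall>F\<in>facets. \<forall>M\<in>{9..<14}. \<forall>j\<in>{..<4}. 0 < cross_coeff (\<delta> F) e M j) (at_right 0)"
  proof (intro eventually_ball_finite ballI finite_facets finite_atLeastLessThan finite_lessThan)
    fix F and M j :: nat assume F: "F \<in> facets" and M: "M \<in> {9..<14}" and j: "j \<in> {..<4}"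
    \<comment> \<open>The coordinates \<open>bary\<close> depend on \<open>corner F\<close> only, so
      their sign may be determined with the weight 1.\<close>
    have "\<delta> F 3 < 0" unfolding \<delta>_def by (rule mate_opposite_side[OF F zero_less_one])
    then show "eventually (\<lambda>e. 0 < cross_coeff (\<delta> F) e M j) (at_right 0)"
      by (intro cross_coeff_eventually_pos) (use M j in auto)
  qed
  moreover have "eventually (\<lambda>e::real. 0 < e) (at_right 0)" by (rule eventually_at_right_less)
  ultimately have "eventually (\<lambda>e. (\<forall>F\<in>facets. \<forall>M\<in>{9..<14}. \<forall>j\<in>{..<4}. 0 < cross_coeff (\<delta> F) e M j) \<and> 0 < e) (at_right 0)"
    by (rule eventually_conj)
  then obtain e where e: "\<forall>F\<in>facets. \<forall>M\<in>{9..<14}. \<forall>j\<in>{..<4}. 0 < cross_coeff (\<delta> F) e M j" "0 < e"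
    using eventually_happens'[OF trivial_limit_at_right_real] by blast
  have "subdivided P col p e"
  proof (unfold_locales)
    show "0 < e" by (rule e(2))
    fix F M j assume "F \<in> facets" "9 \<le> M" "M < (14::nat)" "j < (4::nat)"
    then have "0 < cross_coeff (\<delta> F) e M j" using e(1) by simp
    then show "0 < cross_coeff (\<lambda>i. frame.bary (corner F) i (corner (mate F) 3)) e M j" unfolding \<delta>_def[abs_def] .
  qed
  then show ?thesis by blast
qed

theorem theorem1p5:
  fixes P :: "(real ^ 3) set"
  assumes "balanced_polytope 3 P"
  shows "(\<exists>\<Delta>. proper_cross_polytopal_subdivision \<Delta> P) \<and>
         (\<exists>\<Delta>. proper_cross_polytopal_subdivision \<Delta> P \<and>
              int (f_number 3 \<Delta>) = 23 * (int (f_number 0 (faces P)) - 2))"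
proof -
  have S: "polytope P" "aff_dim P = 3" "\<And>F. F face_of P \<Longrightarrow> F \<noteq> P \<Longrightarrow> \<exists>n. n simplex F"
    using assms by (auto simp: balanced_polytope_def simplicial_polytope_def boundary_complex_def)
  obtain col where col: "\<And>v. v \<in> polytope_vertices P \<Longrightarrow> col v < 3" "\<And>u v. {u, v} \<in> polytope_edges P \<Longrightarrow> col u \<noteq> (col v :: nat)"
    using assms unfolding balanced_polytope_def graph_colorable_def by blast
  interpret S: simplicial3 P by unfold_locales (use S in auto)
  obtain p where p: "p \<in> interior P" using S.interior_nonempty by blast
  interpret B: balanced3 P col p
  proof unfold_locales
    show "col v < 3" if "v \<in> vertices_of P" for v using col(1)[of v] that by (simp add: polytope_vertices_def vertices_of_def)
    show "col v \<noteq> col w" if "closed_segment v w edge_of P" for v w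
      using col(2)[of v w] that unfolding polytope_edges_def by blast
  qed (rule p)
  obtain e where "subdivided P col p e" using B.exists_flattening by blast
  then interpret D: subdivided P col p e .
  have "{F \<in> faces P. aff_dim F = 0} = (\<lambda>v. {v}) ` vertices_of P"
    by (auto simp: faces_def vertices_of_def aff_dim_eq_0 face_of_singleton)
  then have "f_number 0 (faces P) = card ((\<lambda>v. {v}) ` vertices_of P)" by (simp add: f_number_def)
  also have "\<dots> = card (vertices_of P)" by (rule card_image) simp
  finally have f0: "f_number 0 (faces P) = card (vertices_of P)" .
  show ?thesis using D.proper_subdivision D.f_number_octs f0 by auto
qed

end
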